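(* Let $D$ be a smooth and bounded domain of the Heisenberg group $\mathbb{H}^n$ and let $g:\mathbb{R}\to\mathbb{R}$ be a continuous function with $g(0)\neq 0$ for which there exist $a_1,a_2>0$ and $p\in\left[1,\,2\left(\frac{n+1}{n}\right)\right)$ such that $$|g(t)|\leq a_1+a_2|t|^{p-1}\quad\text{for every } t\in\mathbb{R}.$$ Then there exists an open interval $\Lambda\subset(0,+\infty)$ such that for every $\lambda\in\Lambda$ the subelliptic problem $$\begin{cases}-\Delta_{\mathbb{H}^n}u=|u|^{2^*_h-2}u+\lambda g(u) & \text{in } D,\\ u|_{\partial D}=0,\end{cases}$$ where $2^*_h=2\left(\frac{n+1}{n}\right)$ is the critical Sobolev exponent for $\Delta_{\mathbb{H}^n}$, admits at least one nontrivial (that is, not identically zero) weak solution in the Folland-Stein space $\mathbb{H}^1_0(D)$.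
   Context: Let $n\geq 1$ be an integer. The Heisenberg group $\mathbb{H}^n=(\mathbb{R}^{2n+1},\circ)$ has group law $$p\circ q=\Big(p_1+q_1,\dots,p_{2n}+q_{2n},\,p_{2n+1}+q_{2n+1}+\tfrac12\sum_{k=1}^{n}(p_kq_{k+n}-p_{k+n}q_k)\Big)$$ and dilatations $\delta_\eta(p)=(\eta p_1,\dots,\eta p_{2n},\eta^2p_{2n+1})$, $\eta>0$. Its homogeneous dimension is $2n+2$. For $k=1,\dots,n$ let $$X_k=\partial_k-\tfrac{p_{n+k}}{2}\partial_{2n+1},\qquad Y_k=\partial_{n+k}+\tfrac{p_k}{2}\partial_{2n+1},$$ which are left invariant vector fields. The horizontal gradient is $\nabla_{\mathbb{H}^n}=(X_1,\dots,X_n,Y_1,\dots,Y_n)$ and the Kohn-Laplacian is $\Delta_{\mathbb{H}^n}=\sum_{k=1}^n(X_k^2+Y_k^2)$. Integrals are with respect to Lebesgue measure $d\xi$ on $\mathbb{R}^{2n+1}$. The Folland-Stein space $\mathbb{H}^1_0(D)$ is the completion of $C_0^\infty(D)$ with respect to the norm $\left(\int_D|\nabla_{\mathbb{H}^n}u(\xi)|^2\,d\xi\right)^{1/2}$. It embeds continuously into $L^{2^*_h}(D)$ and compactly into $L^q(D)$ for $1\leq q<2^*_h$. A weak solution of the problem is a function $u\in \mathbb{H}^1_0(D)$ such that for all $\varphi\in \mathbb{H}^1_0(D)$ $$\int_D\langle\nabla_{\mathbb{H}^n}u(\xi),\nabla_{\mathbb{H}^n}\varphi(\xi)\rangle\,d\xi-\int_D|u(\xi)|^{2^*_h-2}u(\xi)\varphi(\xi)\,d\xi=\lambda\int_Dg(u(\xi))\varphi(\xi)\,d\xi.$$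 "Open interval" means nonempty open interval. A smooth bounded domain is a nonempty bounded connected open set with smooth boundary. *)

theory Defs
  imports "HOL-Analysis.Analysis"
begin

(* The underlying space R^(2n+1) of the Heisenberg group, with n = CARD('n):
   a point is p = (x, y, t), where x $ k is p_k, y $ k is p_(n+k) and t is p_(2n+1). *)
type_synonym 'n heis = "(real ^ 'n) \<times> (real ^ 'n) \<times> real"

(* Directional derivative; a partial derivative when the direction is a basis vector. *)
definition dir_deriv :: "'a::euclidean_space \<Rightarrow> ('a \<Rightarrow> real) \<Rightarrow> 'a \<Rightarrow> real" where
  "dir_deriv b f p = frechet_derivative f (at p) b"

(* The predicates Ck_on and smooth_on are meant for open sets S only. *)
primrec Ck_on :: "nat \<Rightarrow> 'a::euclidean_space set \<Rightarrow> ('a \<Rightarrow> real) \<Rightarrow> bool" where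
  "Ck_on 0 S f = continuous_on S f"
| "Ck_on (Suc k) S f =
     ((\<forall>p\<in>S. f differentiable (at p)) \<and> (\<forall>b\<in>Basis. Ck_on k S (dir_deriv b f)))"

definition smooth_on :: "'a::euclidean_space set \<Rightarrow> ('a \<Rightarrow> real) \<Rightarrow> bool" where
  "smooth_on S f \<longleftrightarrow> (\<forall>k. Ck_on k S f)"

(* Local defining functions: near each of its boundary points, D is one side of a smooth
   hypersurface. *)
definition smooth_boundary :: "'a::euclidean_space set \<Rightarrow> bool" where
  "smooth_boundary D \<longleftrightarrow>
     (\<forall>p\<in>frontier D. \<exists>W \<rho>. open W \<and> p \<in> W \<and> smooth_on W \<rho> \<and>
        D \<inter> W = {q \<in> W. \<rho> q < 0} \<and> frontier D \<inter> W = {q \<in> W. \<rho> q = 0} \<and>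
        (\<forall>q\<in>W. \<exists>b\<in>Basis. dir_deriv b \<rho> q \<noteq> 0))"

definition smooth_bounded_domain :: "'a::euclidean_space set \<Rightarrow> bool" where
  "smooth_bounded_domain D \<longleftrightarrow>
     D \<noteq> {} \<and> open D \<and> connected D \<and> bounded D \<and> smooth_boundary D"

definition X_field :: "'n::finite \<Rightarrow> ('n heis \<Rightarrow> real) \<Rightarrow> 'n heis \<Rightarrow> real" where
  "X_field k f = (\<lambda>(x, y, t).
     dir_deriv (axis k 1, 0, 0) f (x, y, t) - y $ k / 2 * dir_deriv (0, 0, 1) f (x, y, t))"

definition Y_field :: "'n::finite \<Rightarrow> ('n heis \<Rightarrow> real) \<Rightarrow> 'n heis \<Rightarrow> real" where
  "Y_field k f = (\<lambda>(x, y, t).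
     dir_deriv (0, axis k 1, 0) f (x, y, t) + x $ k / 2 * dir_deriv (0, 0, 1) f (x, y, t))"

definition hgrad :: "('n::finite heis \<Rightarrow> real) \<Rightarrow> 'n heis \<Rightarrow> (real ^ 'n) \<times> (real ^ 'n)" where
  "hgrad f p = ((\<chi> k. X_field k f p), (\<chi> k. Y_field k f p))"

definition test_functions :: "'a::euclidean_space set \<Rightarrow> ('a \<Rightarrow> real) set" where
  "test_functions D =
     {\<phi>. smooth_on UNIV \<phi> \<and> compact (closure {p. \<phi> p \<noteq> 0}) \<and> closure {p. \<phi> p \<noteq> 0} \<subseteq> D}"

definition crit_exponent :: "nat \<Rightarrow> real" where
  "crit_exponent n = 2 * ((real n + 1) / real n)"

(* |t|^a with the convention 0^0 = 1; note that 0 powr 0 = 0. *)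
definition abs_power :: "real \<Rightarrow> real \<Rightarrow> real" where
  "abs_power t a = (if a = 0 then 1 else \<bar>t\<bar> powr a)"

definition Lp_tendsto ::
    "real \<Rightarrow> 'a::euclidean_space set \<Rightarrow> (nat \<Rightarrow> 'a \<Rightarrow> 'b::euclidean_space) \<Rightarrow> ('a \<Rightarrow> 'b) \<Rightarrow> bool" where
  "Lp_tendsto q D F f \<longleftrightarrow>
     (\<forall>j. F j \<in> borel_measurable (lebesgue_on D)) \<and> f \<in> borel_measurable (lebesgue_on D) \<and>
     (\<lambda>j. \<integral>\<^sup>+ p. ennreal (norm (F j p - f p) powr q) \<partial>lebesgue_on D) \<longlonglongrightarrow> 0"

definition FS_norm :: "'n::finite heis set \<Rightarrow> ('n heis \<Rightarrow> real) \<Rightarrow> real" where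
  "FS_norm D \<phi> = sqrt (LINT p|lebesgue_on D. (norm (hgrad \<phi> p))\<^sup>2)"

definition FS_Cauchy :: "'n::finite heis set \<Rightarrow> (nat \<Rightarrow> 'n heis \<Rightarrow> real) \<Rightarrow> bool" where
  "FS_Cauchy D \<Phi> \<longleftrightarrow>
     (\<forall>e>0. \<exists>N. \<forall>i\<ge>N. \<forall>j\<ge>N. FS_norm D (\<lambda>p. \<Phi> i p - \<Phi> j p) < e)"

(* The completion of the test functions with respect to FS_norm, realised as a space of
   functions on D: by the Folland-Stein inequality every FS_Cauchy sequence of test functions
   converges in L^q with q = crit_exponent n, and its class in the completion is identified with
   that limit.
   Functions that agree almost everywhere on D represent the same element; values outside D
   are irrelevant. *)
definition folland_stein :: "'n::finite heis set \<Rightarrow> ('n heis \<Rightarrow> real) set" where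
  "folland_stein D =
     {u. \<exists>\<Phi>. (\<forall>j. \<Phi> j \<in> test_functions D) \<and> FS_Cauchy D \<Phi> \<and>
           Lp_tendsto (crit_exponent CARD('n)) D \<Phi> u}"

(* The continuous extension of hgrad from the test functions to the completion, as an L^2 limit. *)
definition has_weak_hgrad ::
    "'n::finite heis set \<Rightarrow> ('n heis \<Rightarrow> real) \<Rightarrow> ('n heis \<Rightarrow> (real ^ 'n) \<times> (real ^ 'n)) \<Rightarrow> bool" where
  "has_weak_hgrad D u U \<longleftrightarrow>
     (\<exists>\<Phi>. (\<forall>j. \<Phi> j \<in> test_functions D) \<and>
          Lp_tendsto (crit_exponent CARD('n)) D \<Phi> u \<and>
          Lp_tendsto 2 D (\<lambda>j. hgrad (\<Phi> j)) U)"

(* U is unique up to null sets, so the choice does not affect integrals over D. *)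
definition weak_hgrad ::
    "'n::finite heis set \<Rightarrow> ('n heis \<Rightarrow> real) \<Rightarrow> 'n heis \<Rightarrow> (real ^ 'n) \<times> (real ^ 'n)" where
  "weak_hgrad D u = (SOME U. has_weak_hgrad D u U)"

(* If D is bounded and g is continuous with |g(t)| <= a1 + a2 |t|^(q - 1), q = crit_exponent n,
   then all three integrands are integrable by Hoelder's inequality. *)
definition weak_solution ::
    "'n::finite heis set \<Rightarrow> (real \<Rightarrow> real) \<Rightarrow> real \<Rightarrow> ('n heis \<Rightarrow> real) \<Rightarrow> bool" where
  "weak_solution D g l u \<longleftrightarrow> u \<in> folland_stein D \<and>
     (\<forall>\<phi>\<in>folland_stein D.
        (LINT p|lebesgue_on D. weak_hgrad D u p \<bullet> weak_hgrad D \<phi> p)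
        - (LINT p|lebesgue_on D. abs_power (u p) (crit_exponent CARD('n) - 2) * u p * \<phi> p)
        = l * (LINT p|lebesgue_on D. g (u p) * \<phi> p))"

end

theory Submission
  imports Defs
begin

text \<open>
  For small \<open>\<lambda>\<close> the problem has ordered bounded barriers, which makes the critical growth harmless, and
  neither the Folland-Stein inequality nor a compact embedding is needed. After replacing \<open>g\<close> by
  \<open>t \<mapsto> - g (- t)\<close> one may assume \<open>g 0 > 0\<close>, so that \<open>0\<close> is a subsolution; a supersolution is
  \<open>\<epsilon> (2 + cos (\<kappa> p\<^sub>1))\<close> with \<open>\<kappa>\<close> small depending on \<open>D\<close>, since the critical power
  is superlinear at \<open>0\<close>. If \<open>F + K id\<close> is increasing, solving \<open>- \<Delta> v + K v = F u + K u\<close> repeatedly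
  gives an increasing sequence between the barriers, whose limit solves \<open>- \<Delta> u = F u\<close>. A continuous
  nonlinearity is the uniform limit of an increasing sequence of polynomials, and a solution for one
  of them is a subsolution for the next, so the solutions can again be chosen increasing.
  Monotonicity replaces compactness: if the solutions and the right-hand sides converge boundedly almost
  everywhere, testing the difference of two equations with the difference of their solutions
  shows that the gradients converge strongly. Comparison is obtained by testing with
  a smooth approximation of the positive part.
\<close>


section \<open>Smooth functions on Euclidean space\<close>

text \<open>The function space is handled as the set of pairs (u, U) that are L^2 limits of (\<phi>,
  \<open>hgrad \<phi>\<close>): a closed subspace, so the linear problem becomes an orthogonal
  projection. A weak solution must however be a limit in the critical exponent; for bounded u this
  is achieved by truncating the approximating test functions. The shift K makes the quadratic form
  coercive in L^2 and gives the comparison principle its sign. The positive part is smoothed because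
  test functions must stay smooth. A merely continuous nonlinearity may admit no K with F + K id
  increasing; a polynomial does on a bounded interval, and the polynomials are placed in gaps below
  f that halve at each stage, which orders them. The barrier satisfies - \<Delta> w \<ge> \<epsilon>
  \<kappa>^2 / 2 on D. Half of this budget pays for the critical term, through the choice of
  \<epsilon> in terms of \<kappa>; the other half pays for \<lambda> g, which fixes the bound on
  \<lambda>. Zero is not a solution because the right-hand side at 0 is \<lambda> g 0 \<noteq>
  0.\<close>

lemma dir_deriv_eq: "(f has_derivative f') (at p) \<Longrightarrow> dir_deriv b f p = f' b"
  unfolding dir_deriv_def by (metis frechet_derivative_at)

lemma has_derivative_dir_deriv:
  "f differentiable (at p) \<Longrightarrow> (f has_derivative (\<lambda>b. dir_deriv b f p)) (at p)"
  unfolding dir_deriv_def by (simp add: frechet_derivative_works)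

lemma dir_deriv_add:
  "f differentiable (at p) \<Longrightarrow> g differentiable (at p) \<Longrightarrow>
    dir_deriv b (\<lambda>p. f p + g p) p = dir_deriv b f p + dir_deriv b g p"
  using dir_deriv_eq[OF has_derivative_add[OF has_derivative_dir_deriv has_derivative_dir_deriv], of f p g b]
  by simp

lemma dir_deriv_mult:
  "f differentiable (at p) \<Longrightarrow> g differentiable (at p) \<Longrightarrow>
    dir_deriv b (\<lambda>p. f p * g p) p = f p * dir_deriv b g p + dir_deriv b f p * g p"
  by (rule dir_deriv_eq[THEN trans, OF has_derivative_mult[OF has_derivative_dir_deriv has_derivative_dir_deriv]]) auto

lemma dir_deriv_compose:
  assumes "(h has_real_derivative h') (at (f p))" "f differentiable (at p)"
  shows "dir_deriv b (\<lambda>p. h (f p)) p = h' * dir_deriv b f p"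
    and "(\<lambda>p. h (f p)) differentiable (at p)"
proof -
  have *: "((\<lambda>p. h (f p)) has_derivative (\<lambda>b. h' * dir_deriv b f p)) (at p)"
    using has_derivative_compose[OF has_derivative_dir_deriv[OF assms(2)]
        assms(1)[unfolded has_field_derivative_def]] .
  show "dir_deriv b (\<lambda>p. h (f p)) p = h' * dir_deriv b f p"
    by (rule dir_deriv_eq[OF *])
  show "(\<lambda>p. h (f p)) differentiable (at p)" using * differentiableI by blast
qed

lemma dir_deriv_const [simp]: "dir_deriv b (\<lambda>_. c) = (\<lambda>_. 0)"
  by (rule ext) (rule dir_deriv_eq[OF has_derivative_const])

lemma dir_deriv_bounded_linear: "bounded_linear f \<Longrightarrow> dir_deriv b f = (\<lambda>_. f b)"
  by (rule ext) (rule dir_deriv_eq[OF bounded_linear_imp_has_derivative])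

lemma Ck_on_const: "Ck_on k UNIV (\<lambda>_. c)"
  by (induction k arbitrary: c) auto

lemma Ck_on_bounded_linear: "bounded_linear f \<Longrightarrow> Ck_on k UNIV f"
  by (cases k) (auto simp: dir_deriv_bounded_linear Ck_on_const linear_continuous_on
      bounded_linear_imp_differentiable)

text \<open>\<open>Ck_on (Suc k)\<close> mentions only differentiability and the derivatives, so the
  lower order has to be recovered by induction. The product rule calls for it, because it leaves one
  factor undifferentiated.\<close>

lemma Ck_on_SucD: "Ck_on (Suc k) UNIV f \<Longrightarrow> Ck_on k UNIV f"
proof (induction k arbitrary: f)
  case 0
  then show ?case
    by (auto intro!: differentiable_imp_continuous_on simp: differentiable_on_def)
next
  case (Suc k)
  then show ?case by (metis Ck_on.simps(2))
qed

lemma Ck_on_add: "Ck_on k UNIV f \<Longrightarrow> Ck_on k UNIV g \<Longrightarrow> Ck_on k UNIV (\<lambda>p. f p + g p)"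
proof (induction k arbitrary: f g)
  case 0
  then show ?case by (auto intro: continuous_intros)
next
  case (Suc k)
  then have "dir_deriv b (\<lambda>p. f p + g p) = (\<lambda>p. dir_deriv b f p + dir_deriv b g p)" for b
    by (auto simp: dir_deriv_add)
  with Suc show ?case by simp
qed

lemma Ck_on_mult: "Ck_on k UNIV f \<Longrightarrow> Ck_on k UNIV g \<Longrightarrow> Ck_on k UNIV (\<lambda>p. f p * g p)"
proof (induction k arbitrary: f g)
  case 0
  then show ?case by (auto intro: continuous_intros)
next
  case (Suc k)
  then have "dir_deriv b (\<lambda>p. f p * g p) = (\<lambda>p. f p * dir_deriv b g p + dir_deriv b f p * g p)" for b
    by (auto simp: dir_deriv_mult)
  moreover have "Ck_on k UNIV f" "Ck_on k UNIV g"
    using Suc.prems by (auto intro: Ck_on_SucD)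
  ultimately show ?case using Suc by (auto intro!: Ck_on_add)
qed

lemma smooth_on_const: "smooth_on UNIV (\<lambda>_. c)"
  by (simp add: smooth_on_def Ck_on_const)

lemma smooth_on_bounded_linear: "bounded_linear f \<Longrightarrow> smooth_on UNIV f"
  by (simp add: smooth_on_def Ck_on_bounded_linear)

lemma smooth_on_add: "smooth_on UNIV f \<Longrightarrow> smooth_on UNIV g \<Longrightarrow> smooth_on UNIV (\<lambda>p. f p + g p)"
  by (simp add: smooth_on_def Ck_on_add)

lemma smooth_on_mult: "smooth_on UNIV f \<Longrightarrow> smooth_on UNIV g \<Longrightarrow> smooth_on UNIV (\<lambda>p. f p * g p)"
  by (simp add: smooth_on_def Ck_on_mult)

lemma smooth_on_cmult: "smooth_on UNIV f \<Longrightarrow> smooth_on UNIV (\<lambda>p. c * f p)"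
  by (intro smooth_on_mult smooth_on_const)

lemma smooth_on_diff:
  assumes "smooth_on UNIV f" "smooth_on UNIV g"
  shows "smooth_on UNIV (\<lambda>p. f p - g p)"
  using smooth_on_add[OF assms(1) smooth_on_cmult[OF assms(2), of "-1"]] by simp

lemma smooth_on_sum:
  "(\<And>i. i \<in> I \<Longrightarrow> smooth_on UNIV (f i)) \<Longrightarrow> smooth_on UNIV (\<lambda>p. \<Sum>i\<in>I. f i p)"
  by (induction I rule: infinite_finite_induct) (auto intro: smooth_on_const smooth_on_add)

lemma smooth_on_dir_deriv: "smooth_on UNIV f \<Longrightarrow> b \<in> Basis \<Longrightarrow> smooth_on UNIV (dir_deriv b f)"
  unfolding smooth_on_def by (metis Ck_on.simps(2))

lemma smooth_on_differentiable: "smooth_on UNIV f \<Longrightarrow> f differentiable (at p)"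
  unfolding smooth_on_def by (metis Ck_on.simps(2) UNIV_I)

lemma smooth_on_continuous_on: "smooth_on UNIV f \<Longrightarrow> continuous_on S f"
  unfolding smooth_on_def by (metis Ck_on.simps(1) continuous_on_subset subset_UNIV)

text \<open>The phase \<open>a\<close> makes the family closed under differentiation: the derivative
  of cos (t + a) is cos (t + a + pi / 2), so a single induction covers the sine as well.\<close>

lemma smooth_on_cos:
  assumes "smooth_on UNIV f"
  shows "smooth_on UNIV (\<lambda>p. cos (f p + a))"
proof -
  have "Ck_on k UNIV (\<lambda>p. cos (f p + a))" for k a
  proof (induction k arbitrary: a)
    case 0
    then show ?case
      using smooth_on_continuous_on[OF assms] by (auto intro!: continuous_intros)
  next
    case (Suc k)
    have d: "((\<lambda>t. cos (t + a)) has_real_derivative cos (f p + (a + pi / 2))) (at (f p))" for p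
      by (rule derivative_eq_intros refl | simp add: cos_add sin_add)+
    have "dir_deriv b (\<lambda>p. cos (f p + a)) = (\<lambda>p. cos (f p + (a + pi / 2)) * dir_deriv b f p)" for b
      using dir_deriv_compose(1)[OF d smooth_on_differentiable[OF assms]] by blast
    moreover have "(\<lambda>p. cos (f p + a)) differentiable (at p)" for p
      using dir_deriv_compose(2)[OF d smooth_on_differentiable[OF assms]] by blast
    moreover have "Ck_on k UNIV (dir_deriv b f)" if "b \<in> Basis" for b
      using smooth_on_dir_deriv[OF assms that] by (simp add: smooth_on_def)
    ultimately show ?case using Suc by (auto intro!: Ck_on_mult)
  qed
  then show ?thesis by (simp add: smooth_on_def)
qed

text \<open>The linear span of this family is closed under differentiation, which gives smoothness of each
  member by induction on the order of the derivative.\<close>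

definition flat :: "nat \<Rightarrow> real \<Rightarrow> real" where
  "flat i t = (if t > 0 then t * exp (- 1 / t) / t ^ i else 0)"

text \<open>For t > 0, \<open>flat i\<close> is t^(1 - i) exp (-1/t), which explains the coefficient
  1 - i. At 0 both one-sided difference quotients tend to 0.\<close>

lemma flat_has_real_derivative:
  "(flat i has_real_derivative (1 - real i) * flat (Suc i) t + flat (i + 2) t) (at t)"
proof -
  consider "t > 0" | "t < 0" | "t = 0" by linarith
  then show ?thesis
  proof cases
    case 1
    have "((\<lambda>t. t * exp (- 1 / t) / t ^ i) has_real_derivative
            (1 - real i) * flat (Suc i) t + flat (i + 2) t) (at t)"
      using 1 by (auto intro!: derivative_eq_intros simp: flat_def field_simps)
        (cases i; simp add: field_simps power2_eq_square)
    then show ?thesis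
      by (rule has_field_derivative_transform_within_open[where S = "{0<..}"])
        (use 1 in \<open>auto simp: flat_def\<close>)
  next
    case 2
    have "((\<lambda>_. 0) has_real_derivative (1 - real i) * flat (Suc i) t + flat (i + 2) t) (at t)"
      using 2 by (simp add: flat_def)
    then show ?thesis
      by (rule has_field_derivative_transform_within_open[where S = "{..<0}"])
        (use 2 in \<open>auto simp: flat_def\<close>)
  next
    case 3
    \<comment> \<open>With x = 1/h the right difference quotient h^(-i) exp (-1/h) becomes x^i / exp
      x.\<close>
    have "((\<lambda>x::real. x ^ i / exp x) \<longlongrightarrow> 0) at_top"
      by (rule tendsto_power_div_exp_0)
    then have "((\<lambda>h::real. (inverse h) ^ i / exp (inverse h)) \<longlongrightarrow> 0) (at_right 0)"
      by (rule filterlim_compose) (rule filterlim_inverse_at_top_right)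
    then have r: "((\<lambda>h. flat i h / h) \<longlongrightarrow> 0) (at_right 0)"
      by (rule Lim_transform_eventually)
        (auto intro!: eventually_at_rightI[of 0 1] simp: flat_def field_simps exp_minus)
    have l: "((\<lambda>h. flat i h / h) \<longlongrightarrow> 0) (at_left 0)"
      by (rule Lim_transform_eventually[OF tendsto_const])
        (auto intro!: eventually_at_leftI[of "-1"] simp: flat_def)
    show ?thesis
      using filterlim_split_at[OF l r] 3 by (simp add: DERIV_def flat_def)
  qed
qed

lemma continuous_on_flat: "continuous_on S (flat i)"
  using DERIV_continuous_on[OF has_field_derivative_at_within[OF flat_has_real_derivative]] .

lemma smooth_on_flat:
  assumes "smooth_on UNIV f"
  shows "smooth_on UNIV (\<lambda>p. flat i (f p))"
proof -
  have "Ck_on k UNIV (\<lambda>p. flat i (f p))" for k i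
  proof (induction k arbitrary: i)
    case 0
    then show ?case
      using continuous_on_compose2[OF continuous_on_flat smooth_on_continuous_on[OF assms]] by auto
  next
    case (Suc k)
    note d = flat_has_real_derivative[of i]
    have "dir_deriv b (\<lambda>p. flat i (f p)) =
        (\<lambda>p. ((1 - real i) * flat (Suc i) (f p) + flat (i + 2) (f p)) * dir_deriv b f p)" for b
      using dir_deriv_compose(1)[OF d smooth_on_differentiable[OF assms]] by blast
    moreover have "(\<lambda>p. flat i (f p)) differentiable (at p)" for p
      using dir_deriv_compose(2)[OF d smooth_on_differentiable[OF assms]] by blast
    moreover have "Ck_on k UNIV (dir_deriv b f)" if "b \<in> Basis" for b
      using smooth_on_dir_deriv[OF assms that] by (simp add: smooth_on_def)
    ultimately show ?case using Suc by (auto intro!: Ck_on_mult Ck_on_add Ck_on_const)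
  qed
  then show ?thesis by (simp add: smooth_on_def)
qed

text \<open>A smooth substitute \<open>t exp (- 1 / t)\<close> for the positive part: its derivative
  \<open>(1 + 1 / t) exp (- 1 / t)\<close> lies between \<open>0\<close> and \<open>1\<close>.\<close>

definition soft_pos :: "real \<Rightarrow> real" where "soft_pos t = flat 0 t"
definition soft_pos' :: "real \<Rightarrow> real" where "soft_pos' t = flat 1 t + flat 2 t"

lemma soft_pos_has_real_derivative: "(soft_pos has_real_derivative soft_pos' t) (at t)"
  using flat_has_real_derivative[of 0 t] by (simp add: soft_pos_def[abs_def] soft_pos'_def numeral_2_eq_2)

text \<open>The upper bound is 1 + x \<le> exp x at x = 1 / t.\<close>

lemma soft_pos'_bounds: "0 \<le> soft_pos' t" "soft_pos' t \<le> 1"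
proof -
  show "0 \<le> soft_pos' t" by (simp add: soft_pos'_def flat_def)
  show "soft_pos' t \<le> 1"
  proof (cases "t > 0")
    case True
    have "soft_pos' t = (1 + 1 / t) * exp (- (1 / t))"
      using True by (simp add: soft_pos'_def flat_def field_simps power2_eq_square)
    also have "\<dots> \<le> exp (1 / t) * exp (- (1 / t))"
      by (intro mult_right_mono exp_ge_add_one_self) auto
    also have "\<dots> = 1" by (simp add: exp_minus)
    finally show ?thesis .
  qed (simp add: soft_pos'_def flat_def)
qed

lemma continuous_on_soft_pos: "continuous_on S soft_pos" "continuous_on S soft_pos'"
  unfolding soft_pos_def soft_pos'_def by (intro continuous_intros continuous_on_flat)+

lemma soft_pos_nonpos: "t \<le> 0 \<Longrightarrow> soft_pos t = 0" "t \<le> 0 \<Longrightarrow> soft_pos' t = 0"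
  by (simp_all add: soft_pos_def soft_pos'_def flat_def)

lemma soft_pos_pos: "t > 0 \<Longrightarrow> soft_pos t > 0"
  by (simp add: soft_pos_def flat_def)

lemma soft_pos_nonneg: "soft_pos t \<ge> 0"
  by (simp add: soft_pos_def flat_def)

text \<open>From exp (-1/t) \<ge> 1 - 1/t. The function lags behind the positive part by at most 1,
  which later limits the overshoot of the smooth truncation.\<close>

lemma soft_pos_lower: "t - 1 \<le> soft_pos t"
proof (cases "t > 0")
  case True
  have "t - 1 = t * (1 + (- 1 / t))" using True by (simp add: field_simps)
  also have "\<dots> \<le> t * exp (- 1 / t)"
    using True by (intro mult_left_mono exp_ge_add_one_self) auto
  finally show ?thesis using True by (simp add: soft_pos_def flat_def)
qed (simp add: soft_pos_def flat_def)

lemma soft_pos_upper: "t \<ge> 0 \<Longrightarrow> soft_pos t \<le> t"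
  by (cases "t > 0") (auto simp: soft_pos_def flat_def)

text \<open>By the mean value theorem, as \<open>soft_pos'\<close> takes values in [0, 1].
  Composition with \<open>soft_pos\<close> therefore preserves L^2 convergence.\<close>

lemma soft_pos_lipschitz: "\<bar>soft_pos s - soft_pos t\<bar> \<le> \<bar>s - t\<bar>"
proof -
  have *: "\<bar>soft_pos s - soft_pos t\<bar> \<le> \<bar>s - t\<bar>" if st: "s < t" for s t
  proof -
    obtain z where "soft_pos t - soft_pos s = (t - s) * soft_pos' z"
      using MVT2[OF st soft_pos_has_real_derivative] by blast
    then show ?thesis using soft_pos'_bounds[of z] st
      by (simp add: abs_mult abs_minus_commute[of "soft_pos s"] mult_left_le)
  qed
  show ?thesis using *[of s t] *[of t s] by (cases s t rule: linorder_cases) (auto simp: abs_minus_commute)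
qed

lemma smooth_on_soft_pos: "smooth_on UNIV f \<Longrightarrow> smooth_on UNIV (\<lambda>p. soft_pos (f p))"
  unfolding soft_pos_def by (rule smooth_on_flat)

section \<open>Square-integrable functions\<close>

definition sq_integrable :: "'a measure \<Rightarrow> ('a \<Rightarrow> 'b::euclidean_space) \<Rightarrow> bool" where
  "sq_integrable M f \<longleftrightarrow> f \<in> borel_measurable M \<and> integrable M (\<lambda>x. (norm (f x))\<^sup>2)"

text \<open>Square integrability is part of the notion because the Bochner integral of a
  non-integrable function is 0, so the bare limit could hold vacuously.\<close>

definition L2_tendsto ::
    "'a measure \<Rightarrow> (nat \<Rightarrow> 'a \<Rightarrow> 'b::euclidean_space) \<Rightarrow> ('a \<Rightarrow> 'b) \<Rightarrow> bool" where
  "L2_tendsto M F f \<longleftrightarrow> (\<forall>j. sq_integrable M (F j)) \<and> sq_integrable M f \<and>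
     (\<lambda>j. LINT x|M. (norm (F j x - f x))\<^sup>2) \<longlonglongrightarrow> 0"

lemma sq_integrable_measurable: "sq_integrable M f \<Longrightarrow> f \<in> borel_measurable M"
  by (simp add: sq_integrable_def)

lemma sq_integrable_norm: "sq_integrable M f \<Longrightarrow> integrable M (\<lambda>x. (norm (f x))\<^sup>2)"
  by (simp add: sq_integrable_def)

lemma sq_integrable_bound:
  assumes "sq_integrable M f" "g \<in> borel_measurable M" "AE x in M. norm (g x) \<le> c * norm (f x)"
  shows "sq_integrable M g"
proof -
  have "integrable M (\<lambda>x. c\<^sup>2 * (norm (f x))\<^sup>2)"
    using assms(1) by (simp add: sq_integrable_def)
  then have "integrable M (\<lambda>x. (norm (g x))\<^sup>2)"
  proof (rule Bochner_Integration.integrable_bound)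
    show "(\<lambda>x. (norm (g x))\<^sup>2) \<in> borel_measurable M" using assms(2) by measurable
    show "AE x in M. norm ((norm (g x))\<^sup>2) \<le> norm (c\<^sup>2 * (norm (f x))\<^sup>2)"
      using assms(3) by eventually_elim (simp add: power_mult_distrib[symmetric] power_mono)
  qed
  then show ?thesis using assms(2) by (simp add: sq_integrable_def)
qed

lemma sq_integrable_cong_AE:
  assumes "sq_integrable M f" "g \<in> borel_measurable M" "AE x in M. g x = f x"
  shows "sq_integrable M g"
  by (rule sq_integrable_bound[OF assms(1,2), of 1]) (use assms(3) in auto)

lemma norm_add_sq_le: "(norm (x + y))\<^sup>2 \<le> 2 * (norm x)\<^sup>2 + 2 * (norm (y::'a::real_inner))\<^sup>2"
proof -
  have "0 \<le> (norm (x - y))\<^sup>2" by simp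
  then show ?thesis by (simp add: power2_norm_eq_inner algebra_simps inner_commute)
qed

lemma sq_integrable_add:
  assumes "sq_integrable M f" "sq_integrable M g"
  shows "sq_integrable M (\<lambda>x. f x + g x)"
proof -
  note [measurable] = assms[THEN sq_integrable_measurable]
  have "integrable M (\<lambda>x. 2 * (norm (f x))\<^sup>2 + 2 * (norm (g x))\<^sup>2)"
    using assms by (simp add: sq_integrable_def)
  then have "integrable M (\<lambda>x. (norm (f x + g x))\<^sup>2)"
    by (rule Bochner_Integration.integrable_bound) (auto simp: norm_add_sq_le)
  then show ?thesis by (simp add: sq_integrable_def)
qed

lemma sq_integrable_bounded_linear:
  assumes "bounded_linear T" "sq_integrable M f"
  shows "sq_integrable M (\<lambda>x. T (f x))"
proof -
  obtain K where K: "\<And>x. norm (T x) \<le> norm x * K"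
    using bounded_linear.bounded[OF assms(1)] by blast
  have "T \<in> borel_measurable borel"
    by (intro borel_measurable_continuous_onI linear_continuous_on assms)
  then have "(\<lambda>x. T (f x)) \<in> borel_measurable M"
    using sq_integrable_measurable[OF assms(2)] by measurable
  then show ?thesis
    by (rule sq_integrable_bound[OF assms(2), of _ K]) (use K in \<open>auto simp: mult.commute\<close>)
qed

lemma sq_integrable_scaleR: "sq_integrable M f \<Longrightarrow> sq_integrable M (\<lambda>x. c *\<^sub>R f x)"
  by (rule sq_integrable_bounded_linear[OF bounded_linear_scaleR_right])

lemma sq_integrable_diff:
  assumes "sq_integrable M f" "sq_integrable M g"
  shows "sq_integrable M (\<lambda>x. f x - g x)"
  using sq_integrable_add[OF assms(1) sq_integrable_scaleR[OF assms(2), of "-1"]] by simp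

lemma sq_integrable_Pair:
  assumes "sq_integrable M f" "sq_integrable M g"
  shows "sq_integrable M (\<lambda>x. (f x, g x))"
proof -
  have "bounded_linear (\<lambda>x. (x, 0))" "bounded_linear (\<lambda>x. (0, x))"
    by (intro bounded_linear_Pair bounded_linear_ident bounded_linear_zero)+
  then have "sq_integrable M (\<lambda>x. (f x, 0) + (0, g x))"
    by (intro sq_integrable_add sq_integrable_bounded_linear[of "\<lambda>x. (x, 0)"]
        sq_integrable_bounded_linear[of "\<lambda>x. (0, x)"] assms)
  then show ?thesis by simp
qed

lemma sq_integrable_bounded:
  assumes "finite_measure M" "f \<in> borel_measurable M" "AE x in M. norm (f x) \<le> c"
  shows "sq_integrable M f"
proof -
  interpret finite_measure M by fact
  note [measurable] = assms(2)
  have "integrable M (\<lambda>x. (norm (f x))\<^sup>2)"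
    by (rule integrable_const_bound[where B = "c\<^sup>2"])
      (use assms(3) in \<open>auto elim!: eventually_mono intro!: power_mono\<close>)
  then show ?thesis by (simp add: sq_integrable_def)
qed

lemma sq_integrable_inner:
  assumes "sq_integrable M f" "sq_integrable M g"
  shows "integrable M (\<lambda>x. f x \<bullet> g x)"
proof -
  note [measurable] = assms[THEN sq_integrable_measurable]
  have "integrable M (\<lambda>x. (norm (f x))\<^sup>2 + (norm (g x))\<^sup>2)"
    using assms by (simp add: sq_integrable_def)
  then show ?thesis
  proof (rule Bochner_Integration.integrable_bound)
    have "\<bar>f x \<bullet> g x\<bar> \<le> (norm (f x))\<^sup>2 + (norm (g x))\<^sup>2" for x
    proof -
      have "0 \<le> norm (f x) * norm (g x)" by simp
      then show ?thesis
        using Cauchy_Schwarz_ineq2[of "f x" "g x"] sum_squares_bound[of "norm (f x)" "norm (g x)"]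
        by linarith
    qed
    then show "AE x in M. norm (f x \<bullet> g x) \<le> norm ((norm (f x))\<^sup>2 + (norm (g x))\<^sup>2)"
      by (simp add: abs_of_nonneg)
  qed measurable
qed

lemma integral_norm_add_scaleR:
  assumes "sq_integrable M f" "sq_integrable M g"
  shows "(LINT x|M. (norm (f x + t *\<^sub>R g x))\<^sup>2) =
    (LINT x|M. (norm (f x))\<^sup>2) + 2 * t * (LINT x|M. f x \<bullet> g x) + t\<^sup>2 * (LINT x|M. (norm (g x))\<^sup>2)"
proof -
  have "(norm (f x + t *\<^sub>R g x))\<^sup>2 =
      (norm (f x))\<^sup>2 + 2 * t * (f x \<bullet> g x) + t\<^sup>2 * (norm (g x))\<^sup>2" for x
    unfolding power2_norm_eq_inner by (simp add: inner_commute power2_eq_square algebra_simps)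
  moreover have "integrable M (\<lambda>x. (norm (f x))\<^sup>2)" "integrable M (\<lambda>x. (norm (g x))\<^sup>2)"
    "integrable M (\<lambda>x. f x \<bullet> g x)"
    using assms sq_integrable_inner by (auto simp: sq_integrable_def)
  ultimately show ?thesis by simp
qed

text \<open>The discriminant criterion, including the degenerate case c = 0. It gives the
  Cauchy-Schwarz inequality and, with a = 0, the orthogonality relation of the projection.\<close>

lemma nonneg_quadratic_imp:
  fixes a b c :: real
  assumes "\<And>t. 0 \<le> a + 2 * t * b + t\<^sup>2 * c" "0 \<le> c"
  shows "b\<^sup>2 \<le> a * c"
proof (cases "c = 0")
  case True
  have "b = 0"
  proof (rule ccontr)
    assume "b \<noteq> 0"
    \<comment> \<open>For c = 0 the affine function takes the value -1 at this t.\<close>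
    then show False using assms(1)[of "- (a + 1) / (2 * b)"] True by (simp add: field_simps)
  qed
  then show ?thesis using True by simp
next
  case False
  then have "0 \<le> a - b\<^sup>2 / c"
    using assms(1)[of "- b / c"] by (simp add: power2_eq_square)
  then show ?thesis using False assms(2) by (simp add: field_simps)
qed

lemma L2_Cauchy_Schwarz:
  assumes "sq_integrable M f" "sq_integrable M g"
  shows "(LINT x|M. f x \<bullet> g x)\<^sup>2 \<le> (LINT x|M. (norm (f x))\<^sup>2) * (LINT x|M. (norm (g x))\<^sup>2)"
proof (rule nonneg_quadratic_imp)
  show "0 \<le> (LINT x|M. (norm (f x))\<^sup>2) + 2 * t * (LINT x|M. f x \<bullet> g x) +
      t\<^sup>2 * (LINT x|M. (norm (g x))\<^sup>2)" for t
    unfolding integral_norm_add_scaleR[OF assms, symmetric] by simp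
qed simp

section \<open>Strong convergence in L^2\<close>

lemma L2_tendstoD:
  assumes "L2_tendsto M F f"
  shows "sq_integrable M (F j)" "sq_integrable M f"
    "(\<lambda>j. LINT x|M. (norm (F j x - f x))\<^sup>2) \<longlonglongrightarrow> 0"
  using assms by (auto simp: L2_tendsto_def)

lemma L2_tendsto_const: "sq_integrable M f \<Longrightarrow> L2_tendsto M (\<lambda>_. f) f"
  by (simp add: L2_tendsto_def)

lemma L2_tendsto_subseq:
  "L2_tendsto M F f \<Longrightarrow> strict_mono r \<Longrightarrow> L2_tendsto M (\<lambda>j. F (r j)) f"
  unfolding L2_tendsto_def using LIMSEQ_subseq_LIMSEQ[unfolded o_def] by blast

lemma L2_tendstoI_bound:
  assumes "\<And>j. sq_integrable M (F j)" "sq_integrable M f" "b \<longlonglongrightarrow> 0"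
    "\<And>j. (LINT x|M. (norm (F j x - f x))\<^sup>2) \<le> b j"
  shows "L2_tendsto M F f"
  unfolding L2_tendsto_def
  using assms(1,2) tendsto_sandwich[OF _ _ tendsto_const assms(3)] assms(4) by auto

lemma L2_tendsto_cong_AE:
  assumes "L2_tendsto M F f" "g \<in> borel_measurable M" "AE x in M. g x = f x"
  shows "L2_tendsto M F g"
proof -
  have "sq_integrable M g" by (rule sq_integrable_cong_AE[OF L2_tendstoD(2)[OF assms(1)] assms(2,3)])
  moreover have "(LINT x|M. (norm (F j x - g x))\<^sup>2) = (LINT x|M. (norm (F j x - f x))\<^sup>2)" for j
  proof -
    note [measurable] = assms(2) L2_tendstoD(1,2)[OF assms(1), THEN sq_integrable_measurable]
    show ?thesis by (rule integral_cong_AE) (use assms(3) in \<open>auto elim!: eventually_mono\<close>)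
  qed
  ultimately show ?thesis using assms(1) by (simp add: L2_tendsto_def)
qed

lemma L2_tendsto_inner:
  assumes "L2_tendsto M F f" "sq_integrable M g"
  shows "(\<lambda>j. LINT x|M. F j x \<bullet> g x) \<longlonglongrightarrow> (LINT x|M. f x \<bullet> g x)"
proof -
  note F = L2_tendstoD[OF assms(1)]
  have "(LINT x|M. F j x \<bullet> g x) - (LINT x|M. f x \<bullet> g x) = (LINT x|M. (F j x - f x) \<bullet> g x)" for j
    by (simp add: inner_diff_left sq_integrable_inner F assms(2))
  then have *: "((LINT x|M. F j x \<bullet> g x) - (LINT x|M. f x \<bullet> g x))\<^sup>2
      \<le> (LINT x|M. (norm (F j x - f x))\<^sup>2) * (LINT x|M. (norm (g x))\<^sup>2)" for j
    using L2_Cauchy_Schwarz[OF sq_integrable_diff[OF F(1)[of j] F(2)] assms(2)] by simp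
  have "(\<lambda>j. (LINT x|M. (norm (F j x - f x))\<^sup>2) * (LINT x|M. (norm (g x))\<^sup>2)) \<longlonglongrightarrow> 0"
    using tendsto_mult_left_zero[OF F(3)] by simp
  then have "(\<lambda>j. ((LINT x|M. F j x \<bullet> g x) - (LINT x|M. f x \<bullet> g x))\<^sup>2) \<longlonglongrightarrow> 0"
    by (rule tendsto_sandwich[OF _ _ tendsto_const, rotated 2]) (use * in auto)
  then have "(\<lambda>j. (LINT x|M. F j x \<bullet> g x) - (LINT x|M. f x \<bullet> g x)) \<longlonglongrightarrow> 0"
    by (simp add: power_tendsto_0_iff)
  then show ?thesis by (simp add: LIM_zero_iff)
qed

lemma L2_norm_add_le:
  assumes "sq_integrable M f" "sq_integrable M g"
  shows "(LINT x|M. (norm (f x + g x))\<^sup>2) \<le> 2 * (LINT x|M. (norm (f x))\<^sup>2) + 2 * (LINT x|M. (norm (g x))\<^sup>2)"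
proof -
  have "(LINT x|M. (norm (f x + g x))\<^sup>2) \<le> (LINT x|M. 2 * (norm (f x))\<^sup>2 + 2 * (norm (g x))\<^sup>2)"
    by (intro integral_mono norm_add_sq_le sq_integrable_norm sq_integrable_add assms
        Bochner_Integration.integrable_add integrable_mult_right)
  then show ?thesis using assms by (simp add: sq_integrable_def)
qed

lemma L2_tendsto_add:
  assumes "L2_tendsto M F f" "L2_tendsto M G g"
  shows "L2_tendsto M (\<lambda>j x. F j x + G j x) (\<lambda>x. f x + g x)"
proof (rule L2_tendstoI_bound)
  note F = L2_tendstoD[OF assms(1)] and G = L2_tendstoD[OF assms(2)]
  show "sq_integrable M (\<lambda>x. F j x + G j x)" "sq_integrable M (\<lambda>x. f x + g x)" for j
    by (intro sq_integrable_add F G)+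
  show "(\<lambda>j. 2 * (LINT x|M. (norm (F j x - f x))\<^sup>2) + 2 * (LINT x|M. (norm (G j x - g x))\<^sup>2)) \<longlonglongrightarrow> 0"
    using tendsto_add[OF tendsto_mult_right_zero[OF F(3), of 2] tendsto_mult_right_zero[OF G(3), of 2]] by simp
  show "(LINT x|M. (norm (F j x + G j x - (f x + g x)))\<^sup>2) \<le>
      2 * (LINT x|M. (norm (F j x - f x))\<^sup>2) + 2 * (LINT x|M. (norm (G j x - g x))\<^sup>2)" for j
    using L2_norm_add_le[OF sq_integrable_diff[OF F(1)[of j] F(2)] sq_integrable_diff[OF G(1)[of j] G(2)]]
    by (simp add: algebra_simps)
qed

lemma L2_tendsto_bounded_linear:
  assumes "bounded_linear T" "L2_tendsto M F f"
  shows "L2_tendsto M (\<lambda>j x. T (F j x)) (\<lambda>x. T (f x))"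
proof -
  note F = L2_tendstoD[OF assms(2)]
  obtain K where K: "\<And>x. norm (T x) \<le> norm x * K"
    using bounded_linear.bounded[OF assms(1)] by blast
  show ?thesis
  proof (rule L2_tendstoI_bound)
    show "sq_integrable M (\<lambda>x. T (F j x))" "sq_integrable M (\<lambda>x. T (f x))" for j
      using sq_integrable_bounded_linear[OF assms(1)] F by blast+
    show "(\<lambda>j. K\<^sup>2 * (LINT x|M. (norm (F j x - f x))\<^sup>2)) \<longlonglongrightarrow> 0"
      by (intro tendsto_mult_right_zero F)
    fix j
    have sq: "sq_integrable M (\<lambda>x. F j x - f x)" by (intro sq_integrable_diff F)
    have "(norm (T (F j x) - T (f x)))\<^sup>2 \<le> K\<^sup>2 * (norm (F j x - f x))\<^sup>2" for x
      using power_mono[OF K[of "F j x - f x"] norm_ge_zero, of 2]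
      by (simp add: linear_diff[OF bounded_linear.linear[OF assms(1)]] power_mult_distrib mult.commute)
    moreover have "integrable M (\<lambda>x. (norm (T (F j x - f x)))\<^sup>2)"
      by (rule sq_integrable_norm[OF sq_integrable_bounded_linear[OF assms(1) sq]])
    ultimately have "(LINT x|M. (norm (T (F j x) - T (f x)))\<^sup>2) \<le> (LINT x|M. K\<^sup>2 * (norm (F j x - f x))\<^sup>2)"
      by (intro integral_mono integrable_mult_right sq_integrable_norm[OF sq])
        (auto simp: linear_diff[OF bounded_linear.linear[OF assms(1)]])
    then show "(LINT x|M. (norm (T (F j x) - T (f x)))\<^sup>2) \<le> K\<^sup>2 * (LINT x|M. (norm (F j x - f x))\<^sup>2)"
      by simp
  qed
qed

lemma L2_tendsto_Pair:
  assumes "L2_tendsto M F f" "L2_tendsto M G g"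
  shows "L2_tendsto M (\<lambda>j x. (F j x, G j x)) (\<lambda>x. (f x, g x))"
proof -
  have *: "bounded_linear (\<lambda>x. (x, 0))" "bounded_linear (\<lambda>x. (0, x))"
    by (intro bounded_linear_Pair bounded_linear_ident bounded_linear_zero)+
  show ?thesis
    using L2_tendsto_add[OF L2_tendsto_bounded_linear[OF *(1) assms(1)]
        L2_tendsto_bounded_linear[OF *(2) assms(2)]] by simp
qed

lemma L2_tendsto_AE_subseq:
  assumes "L2_tendsto M F f"
  obtains r :: "nat \<Rightarrow> nat" where "strict_mono r" "AE x in M. (\<lambda>j. F (r j) x) \<longlonglongrightarrow> f x"
proof -
  note F = L2_tendstoD[OF assms]
  obtain r :: "nat \<Rightarrow> nat" where r: "strict_mono r" "AE x in M. (\<lambda>j. (norm (F (r j) x - f x))\<^sup>2) \<longlonglongrightarrow> 0"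
    using tendsto_L1_AE_subseq[of M "\<lambda>j x. (norm (F j x - f x))\<^sup>2"]
      sq_integrable_norm[OF sq_integrable_diff[OF F(1,2)]] F(3) by auto
  moreover have "(\<lambda>j. F (r j) x) \<longlonglongrightarrow> f x" if "(\<lambda>j. (norm (F (r j) x - f x))\<^sup>2) \<longlonglongrightarrow> 0" for x
  proof -
    have "(\<lambda>j. norm (F (r j) x - f x)) \<longlonglongrightarrow> 0" using that by (simp add: power_tendsto_0_iff)
    then show ?thesis by (simp add: tendsto_norm_zero_iff LIM_zero_iff)
  qed
  ultimately show thesis using that by (metis (no_types, lifting) eventually_mono)
qed

text \<open>Each row is entered far enough for its squared error to drop below 1 / (i + 1). Applied
  to pairs, this shows that the closure of the graph of \<open>hgrad\<close> is closed.\<close>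

lemma L2_tendsto_diagonal:
  assumes "\<And>i. L2_tendsto M (F i) (f i)" "L2_tendsto M f g"
  obtains s where "L2_tendsto M (\<lambda>i. F i (s i)) g"
proof -
  have "\<exists>j. (LINT x|M. (norm (F i j x - f i x))\<^sup>2) < 1 / Suc i" for i
    using order_tendstoD(2)[OF L2_tendstoD(3)[OF assms(1)[of i]], of "1 / Suc i"]
    by (auto simp: eventually_sequentially)
  then obtain s where s: "\<And>i. (LINT x|M. (norm (F i (s i) x - f i x))\<^sup>2) < 1 / Suc i" by metis
  note F = L2_tendstoD[OF assms(1)] and G = L2_tendstoD[OF assms(2)]
  have "L2_tendsto M (\<lambda>i x. F i (s i) x - f i x) (\<lambda>_. 0)"
  proof (rule L2_tendstoI_bound)
    show "(\<lambda>i. 1 / Suc i) \<longlonglongrightarrow> 0" using LIMSEQ_inverse_real_of_nat by (simp add: inverse_eq_divide)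
    show "sq_integrable M (\<lambda>x. F i (s i) x - f i x)" for i by (intro sq_integrable_diff F)
    show "(LINT x|M. (norm (F i (s i) x - f i x - 0))\<^sup>2) \<le> 1 / Suc i" for i using s[of i] by simp
  qed (simp add: sq_integrable_def)
  from L2_tendsto_add[OF this assms(2)] show thesis using that[of s] by simp
qed

text \<open>Split m_j F_j - m' f as m_j (F_j - f) + (m_j - m') f: the first part is controlled by
  the L^2 distance, the second by dominated convergence with majorant 4 |f|^2. Almost everywhere
  convergence of the multipliers is what is available when the chain rule is passed to the
  limit.\<close>

lemma L2_tendsto_mult_bounded:
  fixes F :: "nat \<Rightarrow> 'a \<Rightarrow> 'b::euclidean_space" and m :: "nat \<Rightarrow> 'a \<Rightarrow> real"
  assumes "L2_tendsto M F f" "\<And>j. m j \<in> borel_measurable M" "m' \<in> borel_measurable M"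
    "\<And>j x. \<bar>m j x\<bar> \<le> 1" "\<And>x. \<bar>m' x\<bar> \<le> 1" "AE x in M. (\<lambda>j. m j x) \<longlonglongrightarrow> m' x"
  shows "L2_tendsto M (\<lambda>j x. m j x *\<^sub>R F j x) (\<lambda>x. m' x *\<^sub>R f x)"
proof -
  note F = L2_tendstoD[OF assms(1)]
  note [measurable] = assms(2,3) F(1,2)[THEN sq_integrable_measurable]
  have sq: "sq_integrable M (\<lambda>x. k x *\<^sub>R h x)"
    if "sq_integrable M h" "k \<in> borel_measurable M" "\<And>x. \<bar>k x\<bar> \<le> 1" for h :: "'a \<Rightarrow> 'b" and k
  proof -
    note [measurable] = sq_integrable_measurable[OF that(1)] that(2)
    show ?thesis
      by (rule sq_integrable_bound[OF that(1), of _ 1])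
        (use that(3) in \<open>auto simp: mult_left_le_one_le\<close>)
  qed
  have "L2_tendsto M (\<lambda>j x. m j x *\<^sub>R (F j x - f x)) (\<lambda>_. 0)"
  proof (rule L2_tendstoI_bound)
    show "sq_integrable M (\<lambda>x. m j x *\<^sub>R (F j x - f x))" for j
      by (intro sq sq_integrable_diff F assms)
    show "sq_integrable M (\<lambda>x. 0)" by (simp add: sq_integrable_def)
    show "(LINT x|M. (norm (m j x *\<^sub>R (F j x - f x) - 0))\<^sup>2) \<le> (LINT x|M. (norm (F j x - f x))\<^sup>2)" for j
      by (rule integral_mono)
        (use assms(4) in \<open>auto intro!: sq_integrable_norm sq sq_integrable_diff F assms power_mono
          simp: mult_left_le_one_le simp del: norm_scaleR\<close>, auto simp: mult_left_le_one_le)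
  qed (rule F(3))
  moreover have "L2_tendsto M (\<lambda>j x. (m j x - m' x) *\<^sub>R f x) (\<lambda>_. 0)"
  proof -
    have b: "\<bar>m j x - m' x\<bar> \<le> 2" for j x using assms(4)[of j x] assms(5)[of x] by linarith
    have "(\<lambda>j. LINT x|M. (norm ((m j x - m' x) *\<^sub>R f x - 0))\<^sup>2) \<longlonglongrightarrow> (LINT x|M. 0)"
    proof (rule integral_dominated_convergence)
      show "integrable M (\<lambda>x. 4 * (norm (f x))\<^sup>2)" using F(2) by (simp add: sq_integrable_def)
      show "AE x in M. (\<lambda>j. (norm ((m j x - m' x) *\<^sub>R f x - 0))\<^sup>2) \<longlonglongrightarrow> 0"
        using assms(6)
      proof eventually_elim
        case (elim x)
        then have "(\<lambda>j. (norm ((m j x - m' x) *\<^sub>R f x - 0))\<^sup>2) \<longlonglongrightarrow> (norm ((m' x - m' x) *\<^sub>R f x - 0))\<^sup>2"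
          by (intro tendsto_intros)
        then show ?case by simp
      qed
      show "AE x in M. norm ((norm ((m j x - m' x) *\<^sub>R f x - 0))\<^sup>2) \<le> 4 * (norm (f x))\<^sup>2" for j
      proof (rule AE_I2)
        fix x
        have "\<bar>m j x - m' x\<bar>\<^sup>2 \<le> 2\<^sup>2" using b by (intro power_mono) auto
        then show "norm ((norm ((m j x - m' x) *\<^sub>R f x - 0))\<^sup>2) \<le> 4 * (norm (f x))\<^sup>2"
          by (auto simp: power_mult_distrib intro!: mult_right_mono)
      qed
    qed measurable
    moreover have "sq_integrable M (\<lambda>x. (m j x - m' x) *\<^sub>R f x)" for j
      by (rule sq_integrable_bound[OF F(2), of _ 2]) (use b in \<open>auto intro!: mult_right_mono\<close>)
    moreover have "sq_integrable M (\<lambda>x. 0::'b)" by (simp add: sq_integrable_def)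
    ultimately show ?thesis by (simp add: L2_tendsto_def)
  qed
  moreover have "L2_tendsto M (\<lambda>j x. m' x *\<^sub>R f x) (\<lambda>x. m' x *\<^sub>R f x)"
    by (intro L2_tendsto_const sq F assms)
  ultimately have "L2_tendsto M (\<lambda>j x. m j x *\<^sub>R (F j x - f x) + (m j x - m' x) *\<^sub>R f x + m' x *\<^sub>R f x)
      (\<lambda>x. 0 + 0 + m' x *\<^sub>R f x)"
    by (intro L2_tendsto_add)
  then show ?thesis by (simp add: algebra_simps)
qed

text \<open>Riesz-Fischer by way of L^1: on a finite measure space the sequence is Cauchy in L^1, a
  subsequence converges almost everywhere, and Fatou's lemma bounds the L^2 distance to that
  limit.\<close>

lemma L2_complete:
  fixes F :: "nat \<Rightarrow> 'a \<Rightarrow> 'b::euclidean_space"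
  assumes "finite_measure M" and F: "\<And>j. sq_integrable M (F j)"
    and C: "\<And>e. e > 0 \<Longrightarrow> \<exists>N. \<forall>i\<ge>N. \<forall>j\<ge>N. (LINT x|M. (norm (F i x - F j x))\<^sup>2) < e"
  obtains f where "L2_tendsto M F f"
proof -
  interpret finite_measure M by fact
  note [measurable] = F[THEN sq_integrable_measurable]
  have int: "integrable M h" if "sq_integrable M h" for h :: "'a \<Rightarrow> 'b"
  proof -
    have "integrable M (\<lambda>x. norm (h x))"
      by (rule square_integrable_imp_integrable)
        (use sq_integrable_measurable[OF that] sq_integrable_norm[OF that] in simp_all)
    from integrable_norm_cancel[OF this sq_integrable_measurable[OF that]] show ?thesis .
  qed
  define \<mu> where "\<mu> = measure M (space M)"
  have L1: "(LINT x|M. norm (F i x - F j x))\<^sup>2 \<le> (LINT x|M. (norm (F i x - F j x))\<^sup>2) * \<mu>" for i j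
  proof -
    have "sq_integrable M (\<lambda>x. norm (F i x - F j x))" "sq_integrable M (\<lambda>x. 1::real)"
      using sq_integrable_diff[OF F[of i] F[of j]] by (auto simp: sq_integrable_def)
    from L2_Cauchy_Schwarz[OF this] show ?thesis by (simp add: \<mu>_def)
  qed
  have "\<exists>N. \<forall>i\<ge>N. \<forall>j\<ge>N. (LINT x|M. norm (F i x - F j x)) < e" if "e > 0" for e
  proof -
    \<comment> \<open>The summand 1 keeps the denominator positive when the measure is zero.\<close>
    have pos: "e\<^sup>2 / (\<mu> + 1) > 0" using that by (simp add: \<mu>_def add_nonneg_pos)
    obtain N where N: "\<And>i j. i \<ge> N \<Longrightarrow> j \<ge> N \<Longrightarrow> (LINT x|M. (norm (F i x - F j x))\<^sup>2) < e\<^sup>2 / (\<mu> + 1)"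
      using C[OF pos] by blast
    have "(LINT x|M. norm (F i x - F j x)) < e" if "i \<ge> N" "j \<ge> N" for i j
    proof -
      have "(LINT x|M. norm (F i x - F j x))\<^sup>2 \<le> (LINT x|M. (norm (F i x - F j x))\<^sup>2) * (\<mu> + 1)"
        by (rule order_trans[OF L1]) (auto intro!: mult_left_mono)
      also have "\<dots> < e\<^sup>2 / (\<mu> + 1) * (\<mu> + 1)"
        using N[OF that] by (intro mult_strict_right_mono) (auto simp: \<mu>_def add_nonneg_pos)
      also have "\<dots> = e\<^sup>2" using pos by (simp add: \<mu>_def add_nonneg_eq_0_iff)
      finally show ?thesis using \<open>e > 0\<close> by (meson less_imp_le power_less_imp_less_base)
    qed
    then show ?thesis by blast
  qed
  then obtain r where r: "strict_mono r" "AE x in M. Cauchy (\<lambda>i. F (r i) x)"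
    using cauchy_L1_AE_cauchy_subseq[of M F] int[OF F] by blast
  \<comment> \<open>Where the subsequence diverges, \<open>lim\<close> is an unspecified value; this
    happens on a null set only.\<close>
  define f where "f x = lim (\<lambda>i. F (r i) x)" for x
  have [measurable]: "f \<in> borel_measurable M"
    unfolding f_def[abs_def] by (rule borel_measurable_lim_metric) measurable
  have lim: "AE x in M. (\<lambda>i. F (r i) x) \<longlonglongrightarrow> f x"
    using r(2) by eventually_elim (simp add: f_def Cauchy_convergent_iff convergent_LIMSEQ_iff)
  have bound: "\<exists>N. \<forall>i\<ge>N. (\<integral>\<^sup>+x. ennreal ((norm (F i x - f x))\<^sup>2) \<partial>M) \<le> ennreal e" if "e > 0" for e
  proof -
    obtain N where N: "\<And>i j. i \<ge> N \<Longrightarrow> j \<ge> N \<Longrightarrow> (LINT x|M. (norm (F i x - F j x))\<^sup>2) < e"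
      using C[OF \<open>e > 0\<close>] by blast
    have "(\<integral>\<^sup>+x. ennreal ((norm (F i x - f x))\<^sup>2) \<partial>M) \<le> ennreal e" if "i \<ge> N" for i
    proof -
      have "(\<integral>\<^sup>+x. ennreal ((norm (F i x - f x))\<^sup>2) \<partial>M)
          = (\<integral>\<^sup>+x. liminf (\<lambda>j. ennreal ((norm (F i x - F (r j) x))\<^sup>2)) \<partial>M)"
      proof (rule nn_integral_cong_AE)
        show "AE x in M. ennreal ((norm (F i x - f x))\<^sup>2) = liminf (\<lambda>j. ennreal ((norm (F i x - F (r j) x))\<^sup>2))"
          using lim
        proof eventually_elim
          case (elim x)
          then have "(\<lambda>j. ennreal ((norm (F i x - F (r j) x))\<^sup>2)) \<longlonglongrightarrow> ennreal ((norm (F i x - f x))\<^sup>2)"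
            by (intro tendsto_intros)
          from lim_imp_Liminf[OF trivial_limit_sequentially this] show ?case by simp
        qed
      qed
      also have "\<dots> \<le> liminf (\<lambda>j. \<integral>\<^sup>+x. ennreal ((norm (F i x - F (r j) x))\<^sup>2) \<partial>M)"
        by (rule nn_integral_liminf) measurable
      also have "\<dots> \<le> liminf (\<lambda>j. ennreal e)"
      proof (rule Liminf_mono)
        have "(\<integral>\<^sup>+x. ennreal ((norm (F i x - F (r j) x))\<^sup>2) \<partial>M) \<le> ennreal e" if "j \<ge> N" for j
        proof -
          have "r j \<ge> N" using that seq_suble[OF r(1), of j] by linarith
          moreover have "integrable M (\<lambda>x. (norm (F i x - F (r j) x))\<^sup>2)"
            by (intro sq_integrable_norm sq_integrable_diff F)
          ultimately show ?thesis
            using N[OF \<open>i \<ge> N\<close>, of "r j"] by (simp add: nn_integral_eq_integral ennreal_leI)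
        qed
        then show "\<forall>\<^sub>F j in sequentially. (\<integral>\<^sup>+x. ennreal ((norm (F i x - F (r j) x))\<^sup>2) \<partial>M) \<le> ennreal e"
          by (auto simp: eventually_sequentially)
      qed
      finally show ?thesis by (simp add: Liminf_const)
    qed
    then show ?thesis by blast
  qed
  have sqN: "\<exists>N. \<forall>i\<ge>N. sq_integrable M (\<lambda>x. F i x - f x) \<and> (LINT x|M. (norm (F i x - f x))\<^sup>2) \<le> e"
    if "e > 0" for e
  proof -
    obtain N where N: "\<And>i. i \<ge> N \<Longrightarrow> (\<integral>\<^sup>+x. ennreal ((norm (F i x - f x))\<^sup>2) \<partial>M) \<le> ennreal e"
      using bound[OF \<open>e > 0\<close>] by blast
    have "sq_integrable M (\<lambda>x. F i x - f x) \<and> (LINT x|M. (norm (F i x - f x))\<^sup>2) \<le> e" if "i \<ge> N" for i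
    proof
      have i: "integrable M (\<lambda>x. (norm (F i x - f x))\<^sup>2)"
        by (rule integrableI_nonneg) (use N[OF that] in \<open>auto simp: order_le_less_trans\<close>)
      then show "sq_integrable M (\<lambda>x. F i x - f x)" by (simp add: sq_integrable_def)
      show "(LINT x|M. (norm (F i x - f x))\<^sup>2) \<le> e"
        using N[OF that] i \<open>e > 0\<close> by (simp add: nn_integral_eq_integral)
    qed
    then show ?thesis by blast
  qed
  obtain N where "sq_integrable M (\<lambda>x. F N x - f x)" using sqN[of 1] by auto
  from sq_integrable_diff[OF F[of N] this] have "sq_integrable M f" by simp
  moreover have "(\<lambda>j. LINT x|M. (norm (F j x - f x))\<^sup>2) \<longlonglongrightarrow> 0"
  proof (rule LIMSEQ_I)
    fix e :: real assume "e > 0"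
    then obtain N where "\<forall>i\<ge>N. (LINT x|M. (norm (F i x - f x))\<^sup>2) \<le> e / 2" using sqN[of "e / 2"] by auto
    with \<open>e > 0\<close> show "\<exists>N. \<forall>i\<ge>N. norm ((LINT x|M. (norm (F i x - f x))\<^sup>2) - 0) < e"
      by (intro exI[of _ N]) auto
  qed
  ultimately have "L2_tendsto M F f" using F by (simp add: L2_tendsto_def)
  then show thesis by (rule that)
qed

lemma L2_tendsto_imp_Cauchy:
  assumes "L2_tendsto M F f" "e > 0"
  shows "\<exists>N. \<forall>i\<ge>N. \<forall>j\<ge>N. (LINT x|M. (norm (F i x - F j x))\<^sup>2) < e"
proof -
  note F = L2_tendstoD[OF assms(1)]
  obtain N where N: "\<And>i. i \<ge> N \<Longrightarrow> (LINT x|M. (norm (F i x - f x))\<^sup>2) < e / 4"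
    using order_tendstoD(2)[OF F(3), of "e / 4"] assms(2) by (auto simp: eventually_sequentially)
  have "(LINT x|M. (norm (F i x - F j x))\<^sup>2) < e" if "i \<ge> N" "j \<ge> N" for i j
  proof -
    have "(LINT x|M. (norm ((F i x - f x) + (f x - F j x)))\<^sup>2)
        \<le> 2 * (LINT x|M. (norm (F i x - f x))\<^sup>2) + 2 * (LINT x|M. (norm (f x - F j x))\<^sup>2)"
      by (intro L2_norm_add_le sq_integrable_diff F)
    also have "\<dots> < e" using N[OF that(1)] N[OF that(2)] by (simp add: norm_minus_commute[of "f _"])
    finally show ?thesis by simp
  qed
  then show ?thesis by blast
qed

text \<open>The Hilbert space projection, for functions instead of classes modulo null sets:
  \<open>closed\<close> speaks of every representative of a limit. A minimizing sequence is Cauchy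
  by the parallelogram law, and its limit satisfies the first-order condition.\<close>

lemma L2_projection:
  fixes S :: "('a \<Rightarrow> 'b::euclidean_space) set"
  assumes fin: "finite_measure M" and ne: "S \<noteq> {}"
    and sq: "\<And>z. z \<in> S \<Longrightarrow> sq_integrable M z"
    and lin: "\<And>z z' a b. z \<in> S \<Longrightarrow> z' \<in> S \<Longrightarrow> (\<lambda>x. a *\<^sub>R z x + b *\<^sub>R z' x) \<in> S"
    and closed: "\<And>F f. (\<And>j. F j \<in> S) \<Longrightarrow> L2_tendsto M F f \<Longrightarrow> f \<in> S"
    and f: "sq_integrable M f"
  obtains z where "z \<in> S" "\<And>s. s \<in> S \<Longrightarrow> (LINT x|M. (f x - z x) \<bullet> s x) = 0"
proof -
  define N where "N z = (LINT x|M. (norm (f x - z x))\<^sup>2)" for z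
  define d where "d = Inf (N ` S)"
  have bdd: "bdd_below (N ` S)" by (rule bdd_belowI[of _ 0]) (auto simp: N_def)
  have d: "d \<le> N z" if "z \<in> S" for z
    unfolding d_def by (rule cInf_lower) (use that bdd in auto)
  have "\<exists>z\<in>S. N z < d + 1 / Suc j" for j
    using cInf_lessD[of "N ` S" "d + 1 / Suc j"] ne by (auto simp: d_def)
  then obtain \<Phi> where \<Phi>: "\<And>j. \<Phi> j \<in> S" "\<And>j. N (\<Phi> j) < d + 1 / Suc j" by metis
  have fin2: "sq_integrable M (\<lambda>x. f x - z x)" if "z \<in> S" for z
    by (intro sq_integrable_diff f sq that)
  have C: "(LINT x|M. (norm (\<Phi> i x - \<Phi> j x))\<^sup>2) \<le> 2 * (1 / Suc i) + 2 * (1 / Suc j)" for i j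
  proof -
    \<comment> \<open>The midpoint lies in \<open>S\<close>, so its squared distance to f is at
      least d; the parallelogram law then bounds the distance between two near-minimizers.\<close>
    define m where "m x = (1/2) *\<^sub>R \<Phi> i x + (1/2) *\<^sub>R \<Phi> j x" for x
    have m: "m \<in> S" unfolding m_def[abs_def] by (intro lin \<Phi>)
    have "(norm (\<Phi> i x - \<Phi> j x))\<^sup>2 =
        2 * (norm (f x - \<Phi> i x))\<^sup>2 + 2 * (norm (f x - \<Phi> j x))\<^sup>2 - 4 * (norm (f x - m x))\<^sup>2" for x
      unfolding power2_norm_eq_inner m_def
      by (simp add: algebra_simps inner_commute)
    then have "(LINT x|M. (norm (\<Phi> i x - \<Phi> j x))\<^sup>2) = 2 * N (\<Phi> i) + 2 * N (\<Phi> j) - 4 * N m"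
      unfolding N_def using sq_integrable_norm[OF fin2[OF \<Phi>(1)]] sq_integrable_norm[OF fin2[OF m]]
      by simp
    then show ?thesis using \<Phi>(2)[of i] \<Phi>(2)[of j] d[OF m] by linarith
  qed
  have "\<exists>N. \<forall>i\<ge>N. \<forall>j\<ge>N. (LINT x|M. (norm (\<Phi> i x - \<Phi> j x))\<^sup>2) < e" if "e > 0" for e
  proof -
    obtain K where K: "1 / real (Suc K) < e / 4"
      using reals_Archimedean[of "e / 4"] \<open>e > 0\<close> by (auto simp: inverse_eq_divide)
    have "(LINT x|M. (norm (\<Phi> i x - \<Phi> j x))\<^sup>2) < e" if "i \<ge> K" "j \<ge> K" for i j
    proof -
      have "1 / real (Suc i) \<le> 1 / real (Suc K)" "1 / real (Suc j) \<le> 1 / real (Suc K)"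
        using that by (auto intro!: divide_left_mono)
      then show ?thesis using C[of i j] K by linarith
    qed
    then show ?thesis by blast
  qed
  from L2_complete[of M \<Phi>, OF fin sq[OF \<Phi>(1)] this]
  obtain z where z: "L2_tendsto M \<Phi> z" by blast
  have zS: "z \<in> S" by (rule closed[OF \<Phi>(1) z])
  moreover have "(LINT x|M. (f x - z x) \<bullet> s x) = 0" if s: "s \<in> S" for s
  proof -
    \<comment> \<open>Stated with constant term 0, so that the discriminant criterion forces the
      integral to vanish.\<close>
    have "0 \<le> 0 + 2 * t * (LINT x|M. (f x - z x) \<bullet> s x) + t\<^sup>2 * (LINT x|M. (norm (s x))\<^sup>2)" for t
    proof -
      \<comment> \<open>The function \<open>\<Phi> j - t s\<close> is a competitor, and the value at
        \<open>\<Phi> j\<close> is within 1 / (j + 1) of the infimum. The limit in j is taken for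
        fixed t.\<close>
      have ge: "2 * t * (LINT x|M. (f x - \<Phi> j x) \<bullet> s x) + t\<^sup>2 * (LINT x|M. (norm (s x))\<^sup>2) \<ge> - 1 / Suc j" for j
      proof -
        have "(\<lambda>x. 1 *\<^sub>R \<Phi> j x + (- t) *\<^sub>R s x) \<in> S" by (intro lin \<Phi> s)
        from d[OF this] \<Phi>(2)[of j] show ?thesis
          using integral_norm_add_scaleR[OF fin2[OF \<Phi>(1)] sq[OF s], of j t]
          by (simp add: N_def algebra_simps)
      qed
      have "(\<lambda>j. LINT x|M. (f x - \<Phi> j x) \<bullet> s x) \<longlonglongrightarrow> (LINT x|M. (f x - z x) \<bullet> s x)"
      proof (rule L2_tendsto_inner[OF _ sq[OF s]])
        have "L2_tendsto M (\<lambda>j x. f x + (-1) *\<^sub>R \<Phi> j x) (\<lambda>x. f x + (-1) *\<^sub>R z x)"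
          by (intro L2_tendsto_add L2_tendsto_const f L2_tendsto_bounded_linear[OF _ z]
              bounded_linear_scaleR_right)
        then show "L2_tendsto M (\<lambda>j x. f x - \<Phi> j x) (\<lambda>x. f x - z x)" by simp
      qed
      then have l1: "(\<lambda>j. 2 * t * (LINT x|M. (f x - \<Phi> j x) \<bullet> s x) + t\<^sup>2 * (LINT x|M. (norm (s x))\<^sup>2)) \<longlonglongrightarrow>
          2 * t * (LINT x|M. (f x - z x) \<bullet> s x) + t\<^sup>2 * (LINT x|M. (norm (s x))\<^sup>2)"
        by (intro tendsto_intros)
      have l2: "(\<lambda>j. - 1 / real (Suc j)) \<longlonglongrightarrow> 0"
        using tendsto_minus[OF LIMSEQ_inverse_real_of_nat] by (simp add: inverse_eq_divide)
      have "0 \<le> 2 * t * (LINT x|M. (f x - z x) \<bullet> s x) + t\<^sup>2 * (LINT x|M. (norm (s x))\<^sup>2)"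
        by (rule LIMSEQ_le[OF l2 l1]) (use ge in auto)
      then show ?thesis by simp
    qed
    from nonneg_quadratic_imp[OF this] show ?thesis by simp
  qed
  ultimately show thesis by (rule that)
qed

section \<open>Horizontal vector fields and test functions\<close>

lemma X_field_eq:
  "X_field k f p = dir_deriv (axis k 1, 0, 0) f p - fst (snd p) $ k / 2 * dir_deriv (0, 0, 1) f p"
  by (cases p) (simp add: X_field_def)

lemma Y_field_eq:
  "Y_field k f p = dir_deriv (0, axis k 1, 0) f p + fst p $ k / 2 * dir_deriv (0, 0, 1) f p"
  by (cases p) (simp add: Y_field_def)

lemma heis_Basis:
  "(axis k 1, 0, 0) \<in> (Basis :: 'n::finite heis set)"
  "(0, axis k 1, 0) \<in> (Basis :: 'n::finite heis set)"
  "(0, 0, 1) \<in> (Basis :: 'n::finite heis set)"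
  by (auto simp: Basis_prod_def zero_prod_def axis_in_Basis_iff image_iff)

lemma bounded_linear_coords:
  "bounded_linear (\<lambda>p :: 'n::finite heis. fst p $ k)"
  "bounded_linear (\<lambda>p :: 'n::finite heis. fst (snd p) $ k)"
  using bounded_linear_compose[OF bounded_linear_vec_nth bounded_linear_fst]
    bounded_linear_compose[OF bounded_linear_vec_nth
      bounded_linear_compose[OF bounded_linear_fst bounded_linear_snd]] by auto

lemma smooth_on_coords:
  "smooth_on UNIV (\<lambda>p :: 'n::finite heis. fst p $ k)"
  "smooth_on UNIV (\<lambda>p :: 'n::finite heis. fst (snd p) $ k)"
  by (intro smooth_on_bounded_linear bounded_linear_coords)+

lemma smooth_on_X_field: "smooth_on UNIV f \<Longrightarrow> smooth_on UNIV (X_field k f)"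
  and smooth_on_Y_field: "smooth_on UNIV f \<Longrightarrow> smooth_on UNIV (Y_field k f)"
proof -
  assume f: "smooth_on UNIV f"
  have eq: "X_field k f = (\<lambda>p. dir_deriv (axis k 1, 0, 0) f p
      - ((1/2) * fst (snd p) $ k) * dir_deriv (0, 0, 1) f p)"
    "Y_field k f = (\<lambda>p. dir_deriv (0, axis k 1, 0) f p
      + ((1/2) * fst p $ k) * dir_deriv (0, 0, 1) f p)"
    by (auto simp: X_field_eq Y_field_eq)
  show "smooth_on UNIV (X_field k f)" "smooth_on UNIV (Y_field k f)"
    unfolding eq by (intro smooth_on_add smooth_on_diff smooth_on_mult smooth_on_const
        smooth_on_coords smooth_on_dir_deriv heis_Basis f)+
qed

lemma X_field_mult:
  assumes "smooth_on UNIV f" "smooth_on UNIV g"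
  shows "X_field k (\<lambda>p. f p * g p) p = f p * X_field k g p + X_field k f p * g p"
  by (simp add: X_field_eq dir_deriv_mult smooth_on_differentiable assms algebra_simps)

lemma Y_field_mult:
  assumes "smooth_on UNIV f" "smooth_on UNIV g"
  shows "Y_field k (\<lambda>p. f p * g p) p = f p * Y_field k g p + Y_field k f p * g p"
  by (simp add: Y_field_eq dir_deriv_mult smooth_on_differentiable assms algebra_simps)

lemma hgrad_const [simp]: "hgrad (\<lambda>_. c) p = 0"
  by (simp add: hgrad_def X_field_eq Y_field_eq zero_prod_def vec_eq_iff)

lemma hgrad_add:
  assumes "smooth_on UNIV f" "smooth_on UNIV g"
  shows "hgrad (\<lambda>p. f p + g p) p = hgrad f p + hgrad g p"
  by (simp add: hgrad_def X_field_eq Y_field_eq dir_deriv_add smooth_on_differentiable assms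
      vec_eq_iff algebra_simps)

lemma hgrad_compose:
  assumes "(h has_real_derivative h') (at (f p))" "smooth_on UNIV f"
  shows "hgrad (\<lambda>p. h (f p)) p = h' *\<^sub>R hgrad f p"
  by (simp add: hgrad_def X_field_eq Y_field_eq vec_eq_iff algebra_simps
      dir_deriv_compose(1)[OF assms(1) smooth_on_differentiable[OF assms(2)]])

lemma hgrad_cmult:
  assumes "smooth_on UNIV f"
  shows "hgrad (\<lambda>p. c * f p) p = c *\<^sub>R hgrad f p"
proof (rule hgrad_compose[OF _ assms])
  show "((*) c has_real_derivative c) (at (f p))"
    by (auto intro!: derivative_eq_intros)
qed

lemma hgrad_diff:
  assumes "smooth_on UNIV f" "smooth_on UNIV g"
  shows "hgrad (\<lambda>p. f p - g p) p = hgrad f p - hgrad g p"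
  using hgrad_add[OF assms(1) smooth_on_cmult[OF assms(2), of "-1"]] hgrad_cmult[OF assms(2), of "-1"]
  by simp

lemma hgrad_inner:
  "hgrad f p \<bullet> hgrad g p = (\<Sum>k\<in>UNIV. X_field k f p * X_field k g p + Y_field k f p * Y_field k g p)"
  by (simp add: hgrad_def inner_vec_def sum.distrib)

lemma continuous_on_hgrad:
  assumes "smooth_on UNIV f"
  shows "continuous_on S (hgrad f)"
  unfolding hgrad_def[abs_def]
  by (intro continuous_on_Pair continuous_on_vec_lambda smooth_on_continuous_on
      smooth_on_X_field[OF assms] smooth_on_Y_field[OF assms])

definition kohn_laplacian :: "('n::finite heis \<Rightarrow> real) \<Rightarrow> 'n heis \<Rightarrow> real" where
  "kohn_laplacian f p = (\<Sum>k\<in>UNIV. X_field k (X_field k f) p + Y_field k (Y_field k f) p)"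

lemma smooth_on_kohn_laplacian: "smooth_on UNIV f \<Longrightarrow> smooth_on UNIV (kohn_laplacian f)"
  unfolding kohn_laplacian_def[abs_def]
  by (intro smooth_on_sum smooth_on_add smooth_on_X_field smooth_on_Y_field)

lemma outside_closure_support: "p \<notin> closure {p. f p \<noteq> 0} \<Longrightarrow> f p = 0"
  using closure_subset[of "{p. f p \<noteq> 0}"] by blast

lemma test_functionsD: "f \<in> test_functions D \<Longrightarrow> smooth_on UNIV f"
  by (simp add: test_functions_def)

text \<open>A closed subset of a compact support is compact. Products, derivatives and composites
  with \<open>soft_pos\<close> all reduce to this criterion.\<close>

lemma test_functions_support_mono:
  assumes "f \<in> test_functions D" "smooth_on UNIV h" "{p. h p \<noteq> 0} \<subseteq> closure {p. f p \<noteq> 0}"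
  shows "h \<in> test_functions D"
proof -
  have "closure {p. h p \<noteq> 0} \<subseteq> closure {p. f p \<noteq> 0}"
    using closure_minimal[OF assms(3) closed_closure] .
  moreover from this have "compact (closure {p. h p \<noteq> 0})"
    using assms(1) compact_Int_closed[of "closure {p. f p \<noteq> 0}" "closure {p. h p \<noteq> 0}"]
    by (simp add: test_functions_def Int_absorb1)
  ultimately show ?thesis
    using assms(1,2) by (auto simp: test_functions_def)
qed

lemma test_functions_mult:
  assumes "f \<in> test_functions D" "smooth_on UNIV g"
  shows "(\<lambda>p. f p * g p) \<in> test_functions D"
proof (rule test_functions_support_mono[OF assms(1)])
  show "smooth_on UNIV (\<lambda>p. f p * g p)"
    by (intro smooth_on_mult assms test_functionsD[OF assms(1)])
  show "{p. f p * g p \<noteq> 0} \<subseteq> closure {p. f p \<noteq> 0}"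
    by (rule subset_trans[OF _ closure_subset]) auto
qed

lemma test_functions_cmult: "f \<in> test_functions D \<Longrightarrow> (\<lambda>p. c * f p) \<in> test_functions D"
  using test_functions_mult[OF _ smooth_on_const, of f D c] by (simp add: mult.commute)

lemma test_functions_add:
  assumes "f \<in> test_functions D" "g \<in> test_functions D"
  shows "(\<lambda>p. f p + g p) \<in> test_functions D"
proof -
  have "closure {p. f p + g p \<noteq> 0} \<subseteq> closure ({p. f p \<noteq> 0} \<union> {p. g p \<noteq> 0})"
    by (intro closure_mono) auto
  then have *: "closure {p. f p + g p \<noteq> 0} \<subseteq> closure {p. f p \<noteq> 0} \<union> closure {p. g p \<noteq> 0}"
    by simp
  have "compact (closure {p. f p \<noteq> 0} \<union> closure {p. g p \<noteq> 0})"
    using assms by (auto simp: test_functions_def)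
  then have "compact (closure {p. f p + g p \<noteq> 0})"
    using compact_Int_closed[of "closure {p. f p \<noteq> 0} \<union> closure {p. g p \<noteq> 0}",
        OF _ closed_closure[of "{p. f p + g p \<noteq> 0}"]] *
    by (simp only: Int_absorb1)
  with * assms show ?thesis
    by (auto simp: test_functions_def intro!: smooth_on_add)
qed

lemma test_functions_diff:
  assumes "f \<in> test_functions D" "g \<in> test_functions D"
  shows "(\<lambda>p. f p - g p) \<in> test_functions D"
  using test_functions_add[OF assms(1) test_functions_cmult[OF assms(2), of "-1"]] by simp

lemma test_functions_zero: "(\<lambda>_. 0) \<in> test_functions D"
  by (simp add: test_functions_def smooth_on_const)

section \<open>Integration by parts along the horizontal fields\<close>

lemma test_functions_dir_deriv:
  assumes "f \<in> test_functions D" "b \<in> Basis"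
  shows "dir_deriv b f \<in> test_functions D"
proof (rule test_functions_support_mono[OF assms(1)])
  show "smooth_on UNIV (dir_deriv b f)"
    by (intro smooth_on_dir_deriv test_functionsD[OF assms(1)] assms(2))
  show "{p. dir_deriv b f p \<noteq> 0} \<subseteq> closure {p. f p \<noteq> 0}"
  proof (rule ccontr)
    assume "\<not> ?thesis"
    then obtain p where p: "dir_deriv b f p \<noteq> 0" "p \<in> - closure {p. f p \<noteq> 0}" by auto
    \<comment> \<open>On the open complement of its support f coincides with the zero function, so
      the derivative vanishes there.\<close>
    have "((\<lambda>_. 0) has_derivative (\<lambda>_. 0)) (at p)" by simp
    then have "(f has_derivative (\<lambda>_. 0)) (at p)"
      by (rule has_derivative_transform_within_open[OF _ _ p(2)])
        (simp_all only: open_Compl closed_closure Compl_iff, metis outside_closure_support)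
    from dir_deriv_eq[OF this] p(1) show False by simp
  qed
qed

lemma test_functions_eq_0: "f \<in> test_functions D \<Longrightarrow> p \<notin> D \<Longrightarrow> f p = 0"
  using closure_subset[of "{p. f p \<noteq> 0}"] by (auto simp: test_functions_def)

lemma test_functions_integrable:
  assumes "f \<in> test_functions D"
  shows "integrable lborel f"
proof -
  have "compact (closure {p. f p \<noteq> 0})" using assms by (simp add: test_functions_def)
  from borel_integrable_compact[OF this smooth_on_continuous_on[OF test_functionsD[OF assms]]]
  have "integrable lborel (\<lambda>x. indicator (closure {p. f p \<noteq> 0}) x *\<^sub>R f x)" .
  moreover have "(\<lambda>x. indicator (closure {p. f p \<noteq> 0}) x *\<^sub>R f x) = f"
  proof
    fix x
    show "indicator (closure {p. f p \<noteq> 0}) x *\<^sub>R f x = f x"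
      by (cases "x \<in> closure {p. f p \<noteq> 0}") (simp, metis outside_closure_support scaleR_zero_right)
  qed
  ultimately show ?thesis by simp
qed

text \<open>Translation invariance of Lebesgue measure makes every difference quotient integrate to
  0, and the quotients converge to the derivative under a fixed integrable majorant.\<close>

lemma integral_dir_deriv:
  fixes f :: "'a::euclidean_space \<Rightarrow> real"
  assumes f: "f \<in> test_functions D" and b: "b \<in> Basis"
  shows "(LINT p|lborel. dir_deriv b f p) = 0"
proof -
  define d where "d = dir_deriv b f"
  have d: "d \<in> test_functions D" unfolding d_def by (rule test_functions_dir_deriv[OF f b])
  have cont [measurable]: "f \<in> borel_measurable borel" "d \<in> borel_measurable borel"
    using smooth_on_continuous_on[OF test_functionsD[OF f]] smooth_on_continuous_on[OF test_functionsD[OF d]]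
    by (auto intro!: borel_measurable_continuous_onI)
  define K where "K = closure {p. f p \<noteq> 0}"
  have K: "compact K" "\<And>p. p \<notin> K \<Longrightarrow> f p = 0"
    using f closure_subset[of "{p. f p \<noteq> 0}"] by (auto simp: K_def test_functions_def)
  obtain R where R: "\<And>p. p \<in> K \<Longrightarrow> norm p \<le> R"
    using compact_imp_bounded[OF K(1)] by (auto simp: bounded_iff)
  have "bounded (d ` closure {p. d p \<noteq> 0})"
    using d smooth_on_continuous_on[OF test_functionsD[OF d]]
    by (intro compact_imp_bounded compact_continuous_image) (auto simp: test_functions_def)
  then obtain B where B: "\<And>p. p \<in> closure {p. d p \<noteq> 0} \<Longrightarrow> \<bar>d p\<bar> \<le> B" by (auto simp: bounded_iff)
  have Bd: "\<bar>d p\<bar> \<le> \<bar>B\<bar>" for p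
  proof (cases "d p = 0")
    case False
    then have "p \<in> closure {p. d p \<noteq> 0}" by (intro subsetD[OF closure_subset]) simp
    then show ?thesis using B[of p] by linarith
  qed simp
  have line: "((\<lambda>t. f (p + t *\<^sub>R b)) has_real_derivative d (p + t *\<^sub>R b)) (at t)" for p t
  proof -
    have "((\<lambda>t. p + t *\<^sub>R b) has_derivative (\<lambda>t. t *\<^sub>R b)) (at t)"
      by (auto intro!: derivative_eq_intros)
    from this have "((\<lambda>t. f (p + t *\<^sub>R b)) has_derivative (\<lambda>s. dir_deriv (s *\<^sub>R b) f (p + t *\<^sub>R b))) (at t)"
      by (rule has_derivative_compose[OF _ has_derivative_dir_deriv[OF smooth_on_differentiable[OF test_functionsD[OF f]]]])
    moreover have "dir_deriv (s *\<^sub>R b) f q = d q * s" for s q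
      using linear_cmul[OF has_derivative_linear[OF has_derivative_dir_deriv[OF
            smooth_on_differentiable[OF test_functionsD[OF f]]]], of s b q]
      by (simp add: d_def)
    ultimately show ?thesis by (simp add: has_field_derivative_def)
  qed
  define s where "s j = 1 / real (Suc j)" for j
  define q where "q j p = (f (p + s j *\<^sub>R b) - f p) / s j" for j p
  have s: "0 < s j" "s j \<le> 1" for j by (auto simp: s_def)
  have s0: "s \<longlonglongrightarrow> 0" using LIMSEQ_inverse_real_of_nat by (simp add: s_def[abs_def] inverse_eq_divide)
  have "(\<lambda>j. LINT p|lborel. q j p) \<longlonglongrightarrow> (LINT p|lborel. d p)"
  proof (rule integral_dominated_convergence)
    \<comment> \<open>By the mean value theorem a bound for the derivative bounds the quotients; the
      radius R + 1 allows for shifts of length at most 1.\<close>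
    show "integrable lborel (\<lambda>p. \<bar>B\<bar> * indicator (cball 0 (R + 1)) p)"
      by (intro integrable_mult_right integrable_real_indicator)
        (auto simp: emeasure_bounded_finite[unfolded infinity_ennreal_def])
    show "AE p in lborel. (\<lambda>j. q j p) \<longlonglongrightarrow> d p"
    proof (rule AE_I2)
      fix p
      have "((\<lambda>h. (f (p + h *\<^sub>R b) - f p) / h) \<longlongrightarrow> d p) (at 0)"
        using line[of p 0] by (simp add: DERIV_def)
      moreover have "filterlim s (at 0) sequentially"
        using s0 s(1) by (auto simp: filterlim_at intro!: always_eventually) (metis less_irrefl)
      ultimately show "(\<lambda>j. q j p) \<longlonglongrightarrow> d p"
        unfolding q_def by (rule filterlim_compose)
    qed
    show "AE p in lborel. norm (q j p) \<le> \<bar>B\<bar> * indicator (cball 0 (R + 1)) p" for j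
    proof (rule AE_I2)
      fix p
      show "norm (q j p) \<le> \<bar>B\<bar> * indicator (cball 0 (R + 1)) p"
      proof (cases "p \<in> cball 0 (R + 1)")
        case True
        obtain z where "f (p + s j *\<^sub>R b) - f (p + 0 *\<^sub>R b) = (s j - 0) * d (p + z *\<^sub>R b)"
          using MVT2[OF s(1)[of j] line[of p]] by blast
        then have "q j p = d (p + z *\<^sub>R b)" using s(1)[of j] by (simp add: q_def)
        then show ?thesis using Bd True by simp
      next
        case False
        then have n: "norm p > R + 1" by simp
        moreover have "norm p \<le> norm (p + s j *\<^sub>R b) + norm (s j *\<^sub>R b)"
          using norm_triangle_ineq4[of "p + s j *\<^sub>R b" "s j *\<^sub>R b"] by simp
        moreover have "norm (s j *\<^sub>R b) \<le> 1" using s[of j] b by simp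
        ultimately have "norm (p + s j *\<^sub>R b) > R" by linarith
        then have "f (p + s j *\<^sub>R b) = 0" "f p = 0"
          using n R K(2) by fastforce+
        then show ?thesis by (simp add: q_def)
      qed
    qed
  qed (unfold q_def, measurable)
  moreover have "(LINT p|lborel. q j p) = 0" for j
  proof -
    have "(LINT p|lborel. f (s j *\<^sub>R b + p)) = (LINT p|distr lborel borel ((+) (s j *\<^sub>R b)). f p)"
      by (subst integral_distr) auto
    then have e: "(LINT p|lborel. f (p + s j *\<^sub>R b)) = (LINT p|lborel. f p)"
      by (simp add: lborel_distr_plus add.commute)
    have "integrable (distr lborel borel ((+) (s j *\<^sub>R b))) f"
      using test_functions_integrable[OF f] by (simp add: lborel_distr_plus)
    then have "integrable lborel (\<lambda>p. f (p + s j *\<^sub>R b))"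
      by (subst (asm) integrable_distr_eq) (auto simp: add.commute)
    with e test_functions_integrable[OF f] show ?thesis
      by (simp add: q_def)
  qed
  ultimately show ?thesis by (simp add: d_def LIMSEQ_const_iff)
qed

lemma test_functions_X_field: "f \<in> test_functions D \<Longrightarrow> X_field k f \<in> test_functions D"
  and test_functions_Y_field: "f \<in> test_functions D \<Longrightarrow> Y_field k f \<in> test_functions D"
proof -
  assume f: "f \<in> test_functions D"
  have eq: "X_field k f = (\<lambda>p. dir_deriv (axis k 1, 0, 0) f p
      - dir_deriv (0, 0, 1) f p * ((1/2) * fst (snd p) $ k))"
    "Y_field k f = (\<lambda>p. dir_deriv (0, axis k 1, 0) f p
      + dir_deriv (0, 0, 1) f p * ((1/2) * fst p $ k))"
    by (auto simp: X_field_eq Y_field_eq)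
  show "X_field k f \<in> test_functions D" "Y_field k f \<in> test_functions D"
    unfolding eq by (intro test_functions_add test_functions_diff test_functions_mult
        test_functions_dir_deriv smooth_on_cmult smooth_on_coords heis_Basis f)+
qed

text \<open>The coefficient of the last derivative does not depend on the last coordinate and can be
  moved under that derivative, so the field is divergence free. The same argument applies to
  \<open>Y_field\<close>.\<close>

lemma integral_X_field:
  assumes f: "f \<in> test_functions D"
  shows "(LINT p|lborel. X_field k f p) = 0"
proof -
  define c where "c p = (1/2) * fst (snd p) $ k" for p :: "'a heis"
  have cl: "bounded_linear c"
    unfolding c_def[abs_def] by (intro bounded_linear_const_mult bounded_linear_coords)
  note c = smooth_on_bounded_linear[OF cl]
  have "dir_deriv (0, 0, 1) c p = 0" for p by (simp add: dir_deriv_bounded_linear[OF cl] c_def)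
  then have "X_field k f p = dir_deriv (axis k 1, 0, 0) f p - dir_deriv (0, 0, 1) (\<lambda>p. f p * c p) p" for p
    by (simp add: X_field_eq dir_deriv_mult smooth_on_differentiable c test_functionsD[OF f] c_def[symmetric])
      (simp add: c_def)
  then show ?thesis
    using integral_dir_deriv[OF f heis_Basis(1)[of k]] integral_dir_deriv[OF test_functions_mult[OF f c] heis_Basis(3)]
      test_functions_integrable[OF test_functions_dir_deriv[OF f heis_Basis(1)[of k]]]
      test_functions_integrable[OF test_functions_dir_deriv[OF test_functions_mult[OF f c] heis_Basis(3)]]
    by simp
qed

lemma integral_Y_field:
  assumes f: "f \<in> test_functions D"
  shows "(LINT p|lborel. Y_field k f p) = 0"
proof -
  define c where "c p = (1/2) * fst p $ k" for p :: "'a heis"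
  have cl: "bounded_linear c"
    unfolding c_def[abs_def] by (intro bounded_linear_const_mult bounded_linear_coords)
  note c = smooth_on_bounded_linear[OF cl]
  have "dir_deriv (0, 0, 1) c p = 0" for p by (simp add: dir_deriv_bounded_linear[OF cl] c_def)
  then have "Y_field k f p = dir_deriv (0, axis k 1, 0) f p + dir_deriv (0, 0, 1) (\<lambda>p. f p * c p) p" for p
    by (simp add: Y_field_eq dir_deriv_mult smooth_on_differentiable c test_functionsD[OF f] c_def[symmetric])
      (simp add: c_def)
  then show ?thesis
    using integral_dir_deriv[OF f heis_Basis(2)[of k]] integral_dir_deriv[OF test_functions_mult[OF f c] heis_Basis(3)]
      test_functions_integrable[OF test_functions_dir_deriv[OF f heis_Basis(2)[of k]]]
      test_functions_integrable[OF test_functions_dir_deriv[OF test_functions_mult[OF f c] heis_Basis(3)]]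
    by simp
qed

text \<open>Test functions vanish off D, so integrals over D can be moved to the whole space, where
  translation invariance is available.\<close>

lemma test_functions_integral_lebesgue_on:
  assumes "f \<in> test_functions D" "open D"
  shows "(LINT p|lebesgue_on D. f p) = (LINT p|lborel. f p)" "integrable (lebesgue_on D) f"
proof -
  have D: "D \<in> sets lebesgue" using assms(2) by (simp add: borel_open)
  have f: "f \<in> borel_measurable lborel"
    using smooth_on_continuous_on[OF test_functionsD[OF assms(1)]]
    by (auto intro!: borel_measurable_continuous_onI)
  have i: "(\<lambda>p. indicator D p *\<^sub>R f p) = f"
    using test_functions_eq_0[OF assms(1)] by (intro ext) (simp add: indicator_def, blast)
  show "(LINT p|lebesgue_on D. f p) = (LINT p|lborel. f p)"
    using integral_restrict_space[of D lebesgue f] D integral_completion[OF f] i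
    by simp
  show "integrable (lebesgue_on D) f"
    using integrable_restrict_space[of D lebesgue f] D integrable_completion[OF f] i
      test_functions_integrable[OF assms(1)]
    by simp
qed

text \<open>The functions X(\<phi> X \<psi>) and Y(\<phi> Y \<psi>) have integral 0; expand them by
  the product rule. Compact support is asked of \<phi> alone, so \<psi> may be a barrier that does
  not vanish on the boundary.\<close>

lemma hgrad_integration_by_parts:
  assumes "open D" and \<phi>: "\<phi> \<in> test_functions D" and \<psi>: "smooth_on UNIV \<psi>"
  shows "(LINT p|lebesgue_on D. hgrad \<phi> p \<bullet> hgrad \<psi> p) = - (LINT p|lebesgue_on D. \<phi> p * kohn_laplacian \<psi> p)"
proof -
  note sX = smooth_on_X_field[OF \<psi>] and sY = smooth_on_Y_field[OF \<psi>] and s\<phi> = test_functionsD[OF \<phi>]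
  let ?X = "\<lambda>k. X_field k (\<lambda>p. \<phi> p * X_field k \<psi> p)" and ?Y = "\<lambda>k. Y_field k (\<lambda>p. \<phi> p * Y_field k \<psi> p)"
  have tX: "(\<lambda>p. \<phi> p * X_field k \<psi> p) \<in> test_functions D" and tY: "(\<lambda>p. \<phi> p * Y_field k \<psi> p) \<in> test_functions D" for k
    by (intro test_functions_mult \<phi> sX sY)+
  note t = test_functions_X_field[OF tX] test_functions_Y_field[OF tY]
  have i1: "integrable (lebesgue_on D) (\<lambda>p. \<phi> p * kohn_laplacian \<psi> p)"
    by (intro test_functions_integral_lebesgue_on(2) test_functions_mult \<phi> smooth_on_kohn_laplacian \<psi> assms(1))
  have "hgrad \<phi> p \<bullet> hgrad \<psi> p = (\<Sum>k\<in>UNIV. ?X k p + ?Y k p) - \<phi> p * kohn_laplacian \<psi> p" for p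
    by (simp add: hgrad_inner kohn_laplacian_def X_field_mult Y_field_mult sX sY s\<phi> sum.distrib
        sum_distrib_left algebra_simps)
  moreover have "(LINT p|lebesgue_on D. (\<Sum>k\<in>UNIV. ?X k p + ?Y k p)) = 0"
    using test_functions_integral_lebesgue_on[OF t(1) assms(1)]
      test_functions_integral_lebesgue_on[OF t(2) assms(1)] integral_X_field[OF tX] integral_Y_field[OF tY]
    by (subst Bochner_Integration.integral_sum) auto
  moreover have "integrable (lebesgue_on D) (\<lambda>p. \<Sum>k\<in>UNIV. ?X k p + ?Y k p)"
    by (intro Bochner_Integration.integrable_sum Bochner_Integration.integrable_add
        test_functions_integral_lebesgue_on(2) t assms(1))
  ultimately show ?thesis using i1 by simp
qed

section \<open>The closure of the test functions\<close>

locale bounded_open =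
  fixes D :: "'n::finite heis set"
  assumes open_D: "open D" and bounded_D: "bounded D"
begin

abbreviation M where "M \<equiv> lebesgue_on D"

lemma sets_D: "D \<in> sets lebesgue"
  using open_D by (simp add: borel_open)

lemma finite_M: "finite_measure M"
  by (intro finite_measure_lebesgue_on lmeasurable_open bounded_D open_D)

lemma continuous_measurable: "continuous_on UNIV (f :: 'n heis \<Rightarrow> 'b::euclidean_space) \<Longrightarrow> f \<in> borel_measurable M"
  by (intro continuous_imp_measurable_on_sets_lebesgue sets_D) (auto intro: continuous_on_subset)

lemma continuous_sq_integrable:
  fixes f :: "'n heis \<Rightarrow> 'b::euclidean_space"
  assumes "continuous_on UNIV f"
  shows "sq_integrable M f"
proof -
  have "bounded (f ` closure D)"
    using assms bounded_D
    by (intro compact_imp_bounded compact_continuous_image) (auto intro: continuous_on_subset)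
  then obtain B where "\<And>p. p \<in> closure D \<Longrightarrow> norm (f p) \<le> B" by (auto simp: bounded_iff)
  then have "AE p in M. norm (f p) \<le> B"
    using closure_subset[of D] by (intro AE_I2) auto
  then show ?thesis
    by (rule sq_integrable_bounded[OF finite_M continuous_measurable[OF assms]])
qed

lemma smooth_sq_integrable:
  assumes "smooth_on UNIV f"
  shows "sq_integrable M f" "sq_integrable M (hgrad f)"
  by (intro continuous_sq_integrable smooth_on_continuous_on continuous_on_hgrad assms)+

lemma sq_integrable_const: "sq_integrable M (\<lambda>_. c)"
  by (intro continuous_sq_integrable) simp

lemma sq_integrable_mult:
  "sq_integrable M f \<Longrightarrow> sq_integrable M g \<Longrightarrow> integrable M (\<lambda>p. f p * (g p :: real))"
  using sq_integrable_inner[of M f g] by (simp add: inner_real_def)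

lemma sq_integrable_cmult: "sq_integrable M f \<Longrightarrow> sq_integrable M (\<lambda>p. c * f p :: real)"
  using sq_integrable_scaleR[of M f c] by simp

text \<open>The closure of the graph of \<open>hgrad\<close> in L^2 x L^2. Until closability is
  proved U is not known to be determined by u, hence a relation. L^2 convergence of the functions,
  instead of convergence in the critical exponent, fits the projection theorem.\<close>

definition H10 :: "('n heis \<Rightarrow> real) \<Rightarrow> ('n heis \<Rightarrow> (real ^ 'n) \<times> (real ^ 'n)) \<Rightarrow> bool" where
  "H10 u U \<longleftrightarrow> (\<exists>\<Phi>. (\<forall>j. \<Phi> j \<in> test_functions D) \<and> L2_tendsto M \<Phi> u \<and>
     L2_tendsto M (\<lambda>j. hgrad (\<Phi> j)) U)"

lemma H10_sq_integrable:
  assumes "H10 u U"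
  shows "sq_integrable M u" "sq_integrable M U"
  using assms by (auto simp: H10_def L2_tendsto_def)

lemma H10_test: "\<phi> \<in> test_functions D \<Longrightarrow> H10 \<phi> (hgrad \<phi>)"
  unfolding H10_def
  by (intro exI[of _ "\<lambda>_. \<phi>"]) (auto intro!: L2_tendsto_const smooth_sq_integrable test_functionsD)

lemma H10_zero: "H10 (\<lambda>_. 0) (\<lambda>_. 0)"
proof -
  have "hgrad (\<lambda>_ :: 'n heis. 0) = (\<lambda>_. 0)" by auto
  then show ?thesis using H10_test[OF test_functions_zero] by simp
qed

lemma H10_add:
  assumes "H10 u U" "H10 v V"
  shows "H10 (\<lambda>p. u p + v p) (\<lambda>p. U p + V p)"
proof -
  obtain \<Phi> \<Psi> where 1: "\<And>j. \<Phi> j \<in> test_functions D" "L2_tendsto M \<Phi> u" "L2_tendsto M (\<lambda>j. hgrad (\<Phi> j)) U"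
    and 2: "\<And>j. \<Psi> j \<in> test_functions D" "L2_tendsto M \<Psi> v" "L2_tendsto M (\<lambda>j. hgrad (\<Psi> j)) V"
    using assms unfolding H10_def by metis
  have "hgrad (\<lambda>p. \<Phi> j p + \<Psi> j p) = (\<lambda>p. hgrad (\<Phi> j) p + hgrad (\<Psi> j) p)" for j
    by (intro ext hgrad_add test_functionsD[OF 1(1)] test_functionsD[OF 2(1)])
  with L2_tendsto_add[OF 1(2) 2(2)] L2_tendsto_add[OF 1(3) 2(3)] test_functions_add[OF 1(1) 2(1)]
  show ?thesis unfolding H10_def by (intro exI[of _ "\<lambda>j p. \<Phi> j p + \<Psi> j p"]) simp
qed

lemma H10_cmult:
  assumes "H10 u U"
  shows "H10 (\<lambda>p. c * u p) (\<lambda>p. c *\<^sub>R U p)"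
proof -
  obtain \<Phi> where 1: "\<And>j. \<Phi> j \<in> test_functions D" "L2_tendsto M \<Phi> u" "L2_tendsto M (\<lambda>j. hgrad (\<Phi> j)) U"
    using assms unfolding H10_def by metis
  have "hgrad (\<lambda>p. c * \<Phi> j p) = (\<lambda>p. c *\<^sub>R hgrad (\<Phi> j) p)" for j
    by (intro ext hgrad_cmult test_functionsD[OF 1(1)])
  with L2_tendsto_bounded_linear[OF bounded_linear_scaleR_right 1(2), of c]
    L2_tendsto_bounded_linear[OF bounded_linear_scaleR_right 1(3), of c] test_functions_cmult[OF 1(1)]
  show ?thesis unfolding H10_def by (intro exI[of _ "\<lambda>j p. c * \<Phi> j p"]) simp
qed

lemma H10_diff:
  assumes "H10 u U" "H10 v V"
  shows "H10 (\<lambda>p. u p - v p) (\<lambda>p. U p - V p)"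
  using H10_add[OF assms(1) H10_cmult[OF assms(2), of "-1"]] by simp

text \<open>The diagonal choice is made for the pairs, so that one index serves both the function
  and its gradient.\<close>

lemma H10_closed:
  assumes "\<And>j. H10 (u j) (U j)" "L2_tendsto M u v" "L2_tendsto M U V"
  shows "H10 v V"
proof -
  have "\<exists>\<Phi>. \<forall>i. (\<forall>j. \<Phi> i j \<in> test_functions D) \<and> L2_tendsto M (\<Phi> i) (u i) \<and>
      L2_tendsto M (\<lambda>j. hgrad (\<Phi> i j)) (U i)"
    using assms(1) unfolding H10_def by (intro choice) blast
  then obtain \<Phi> where \<Phi>: "\<And>i j. \<Phi> i j \<in> test_functions D" "\<And>i. L2_tendsto M (\<Phi> i) (u i)"
    "\<And>i. L2_tendsto M (\<lambda>j. hgrad (\<Phi> i j)) (U i)" by blast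
  obtain s where s: "L2_tendsto M (\<lambda>i p. (\<Phi> i (s i) p, hgrad (\<Phi> i (s i)) p)) (\<lambda>p. (v p, V p))"
    using L2_tendsto_diagonal[OF L2_tendsto_Pair[OF \<Phi>(2,3)] L2_tendsto_Pair[OF assms(2,3)]] .
  from L2_tendsto_bounded_linear[OF bounded_linear_fst s] L2_tendsto_bounded_linear[OF bounded_linear_snd s] \<Phi>(1)
  show ?thesis unfolding H10_def by (intro exI[of _ "\<lambda>i. \<Phi> i (s i)"]) simp
qed

section \<open>Stability under the smooth positive part\<close>

lemma soft_pos_measurable [measurable]: "soft_pos \<in> borel_measurable borel" "soft_pos' \<in> borel_measurable borel"
  by (intro borel_measurable_continuous_onI continuous_on_soft_pos)+

lemma abs_soft_pos_le: "\<bar>soft_pos t\<bar> \<le> \<bar>t\<bar>"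
  using soft_pos_lipschitz[of t 0] soft_pos_nonpos(1)[of 0] by simp

text \<open>Where \<phi> vanishes, \<phi> - w \<le> 0 and \<open>soft_pos\<close> is 0.
  Nonnegativity of w thus keeps the support inside D even if w does not vanish on the
  boundary.\<close>

lemma soft_pos_test:
  assumes "\<phi> \<in> test_functions D" "smooth_on UNIV w" "\<And>p. 0 \<le> w p"
  shows "(\<lambda>p. soft_pos (\<phi> p - w p)) \<in> test_functions D"
    "hgrad (\<lambda>p. soft_pos (\<phi> p - w p)) p = soft_pos' (\<phi> p - w p) *\<^sub>R (hgrad \<phi> p - hgrad w p)"
proof -
  have s: "smooth_on UNIV (\<lambda>p. \<phi> p - w p)" by (intro smooth_on_diff test_functionsD[OF assms(1)] assms(2))
  show "(\<lambda>p. soft_pos (\<phi> p - w p)) \<in> test_functions D"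
  proof (rule test_functions_support_mono[OF assms(1) smooth_on_soft_pos[OF s]])
    have "soft_pos (\<phi> p - w p) = 0" if "\<phi> p = 0" for p
      using that assms(3)[of p] by (intro soft_pos_nonpos) simp
    then show "{p. soft_pos (\<phi> p - w p) \<noteq> 0} \<subseteq> closure {p. \<phi> p \<noteq> 0}"
      by (intro subset_trans[OF _ closure_subset]) auto
  qed
  show "hgrad (\<lambda>p. soft_pos (\<phi> p - w p)) p = soft_pos' (\<phi> p - w p) *\<^sub>R (hgrad \<phi> p - hgrad w p)"
    by (simp add: hgrad_compose[OF soft_pos_has_real_derivative s] hgrad_diff[OF test_functionsD[OF assms(1)] assms(2)])
qed

lemma L2_tendsto_soft_pos:
  assumes "L2_tendsto M \<Phi> u" "sq_integrable M w"
  shows "L2_tendsto M (\<lambda>j p. soft_pos (\<Phi> j p - w p)) (\<lambda>p. soft_pos (u p - w p))"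
proof -
  note F = L2_tendstoD[OF assms(1)]
  note [measurable] = F(1,2)[THEN sq_integrable_measurable] sq_integrable_measurable[OF assms(2)]
  have sq: "sq_integrable M (\<lambda>p. soft_pos (v p - w p))" if v: "sq_integrable M v" for v
  proof -
    note [measurable] = sq_integrable_measurable[OF v]
    show ?thesis
      by (rule sq_integrable_bound[OF sq_integrable_diff[OF v assms(2)], of _ 1])
        (auto simp: abs_soft_pos_le)
  qed
  show ?thesis
  proof (rule L2_tendstoI_bound[OF sq[OF F(1)] sq[OF F(2)] F(3)])
    fix j
    have "\<bar>soft_pos (\<Phi> j p - w p) - soft_pos (u p - w p)\<bar> \<le> \<bar>\<Phi> j p - u p\<bar>" for p
      using soft_pos_lipschitz[of "\<Phi> j p - w p" "u p - w p"] by simp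
    then show "(LINT p|M. (norm (soft_pos (\<Phi> j p - w p) - soft_pos (u p - w p)))\<^sup>2) \<le> (LINT p|M. (norm (\<Phi> j p - u p))\<^sup>2)"
      by (intro integral_mono sq_integrable_norm sq_integrable_diff sq F power_mono) auto
  qed
qed

lemma L2_tendsto_soft_pos':
  assumes "L2_tendsto M G U" "\<And>j. \<Phi> j \<in> borel_measurable M" "u \<in> borel_measurable M"
    "w \<in> borel_measurable M" "sq_integrable M W" "AE p in M. (\<lambda>j. \<Phi> j p) \<longlonglongrightarrow> u p"
  shows "L2_tendsto M (\<lambda>j p. soft_pos' (\<Phi> j p - w p) *\<^sub>R (G j p - W p)) (\<lambda>p. soft_pos' (u p - w p) *\<^sub>R (U p - W p))"
proof (rule L2_tendsto_mult_bounded)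
  have "L2_tendsto M (\<lambda>j p. G j p + (-1) *\<^sub>R W p) (\<lambda>p. U p + (-1) *\<^sub>R W p)"
    by (intro L2_tendsto_add assms(1) L2_tendsto_const sq_integrable_scaleR assms(5))
  then show "L2_tendsto M (\<lambda>j p. G j p - W p) (\<lambda>p. U p - W p)" by simp
  show "AE p in M. (\<lambda>j. soft_pos' (\<Phi> j p - w p)) \<longlonglongrightarrow> soft_pos' (u p - w p)"
    using assms(6)
  proof eventually_elim
    case (elim p)
    then have "(\<lambda>j. \<Phi> j p - w p) \<longlonglongrightarrow> u p - w p" by (intro tendsto_intros)
    with continuous_on_soft_pos(2)[of UNIV] show ?case by (rule continuous_on_tendsto_compose) auto
  qed
qed (use assms(2-4) soft_pos'_bounds in \<open>auto simp: abs_of_nonneg\<close>)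

text \<open>The chain rule survives the limit: \<open>soft_pos\<close> is Lipschitz, so the
  functions converge, and \<open>soft_pos'\<close> is bounded and continuous, so the multipliers of
  the gradients converge almost everywhere along a subsequence.\<close>

lemma H10_soft_pos:
  assumes "H10 u U" "smooth_on UNIV w" "\<And>p. 0 \<le> w p"
  shows "H10 (\<lambda>p. soft_pos (u p - w p)) (\<lambda>p. soft_pos' (u p - w p) *\<^sub>R (U p - hgrad w p))"
proof -
  obtain \<Phi> where \<Phi>: "\<And>j. \<Phi> j \<in> test_functions D" "L2_tendsto M \<Phi> u" "L2_tendsto M (\<lambda>j. hgrad (\<Phi> j)) U"
    using assms unfolding H10_def by metis
  obtain r where r: "strict_mono r" "AE p in M. (\<lambda>j. \<Phi> (r j) p) \<longlonglongrightarrow> u p"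
    using L2_tendsto_AE_subseq[OF \<Phi>(2)] .
  note t = soft_pos_test[OF \<Phi>(1) assms(2,3)]
  have "L2_tendsto M (\<lambda>j p. soft_pos (\<Phi> (r j) p - w p)) (\<lambda>p. soft_pos (u p - w p))"
    by (intro L2_tendsto_soft_pos L2_tendsto_subseq[OF \<Phi>(2) r(1)] smooth_sq_integrable assms(2))
  moreover have "L2_tendsto M (\<lambda>j p. soft_pos' (\<Phi> (r j) p - w p) *\<^sub>R (hgrad (\<Phi> (r j)) p - hgrad w p))
      (\<lambda>p. soft_pos' (u p - w p) *\<^sub>R (U p - hgrad w p))"
    by (rule L2_tendsto_soft_pos'[OF L2_tendsto_subseq[OF \<Phi>(3) r(1)] _ _ _ _ r(2)])
      (auto intro!: sq_integrable_measurable smooth_sq_integrable L2_tendstoD[OF \<Phi>(2)] assms)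
  moreover have "hgrad (\<lambda>p. soft_pos (\<Phi> (r j) p - w p)) =
      (\<lambda>p. soft_pos' (\<Phi> (r j) p - w p) *\<^sub>R (hgrad (\<Phi> (r j)) p - hgrad w p))" for j
    by (intro ext t(2))
  ultimately show ?thesis
    unfolding H10_def using t(1) by (intro exI[of _ "\<lambda>j p. soft_pos (\<Phi> (r j) p - w p)"]) simp
qed

text \<open>For fixed \<psi> both sides are continuous in L^2, because the derivatives of \<psi> are
  bounded on the bounded set D.\<close>

lemma H10_integration_by_parts:
  assumes "H10 u U" "smooth_on UNIV \<psi>"
  shows "(LINT p|M. U p \<bullet> hgrad \<psi> p) = - (LINT p|M. u p * kohn_laplacian \<psi> p)"
proof -
  obtain \<Phi> where \<Phi>: "\<And>j. \<Phi> j \<in> test_functions D" "L2_tendsto M \<Phi> u" "L2_tendsto M (\<lambda>j. hgrad (\<Phi> j)) U"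
    using assms unfolding H10_def by metis
  have "(\<lambda>j. LINT p|M. hgrad (\<Phi> j) p \<bullet> hgrad \<psi> p) \<longlonglongrightarrow> (LINT p|M. U p \<bullet> hgrad \<psi> p)"
    by (intro L2_tendsto_inner \<Phi>(3) smooth_sq_integrable assms(2))
  moreover have "(\<lambda>j. LINT p|M. \<Phi> j p \<bullet> kohn_laplacian \<psi> p) \<longlonglongrightarrow> (LINT p|M. u p \<bullet> kohn_laplacian \<psi> p)"
    by (intro L2_tendsto_inner \<Phi>(2) smooth_sq_integrable smooth_on_kohn_laplacian assms(2))
  then have "(\<lambda>j. - (LINT p|M. \<Phi> j p * kohn_laplacian \<psi> p)) \<longlonglongrightarrow> - (LINT p|M. u p * kohn_laplacian \<psi> p)"
    by (intro tendsto_minus) (simp add: inner_real_def)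
  ultimately show ?thesis
    using hgrad_integration_by_parts[OF open_D \<Phi>(1) assms(2)] by (simp add: LIMSEQ_unique)
qed

text \<open>Closability: integrating by parts against the approximating test functions themselves avoids
  any density argument.\<close>

lemma H10_zero_imp:
  assumes "H10 u U" "AE p in M. u p = 0"
  shows "AE p in M. U p = 0"
proof -
  obtain \<Phi> where \<Phi>: "\<And>j. \<Phi> j \<in> test_functions D" "L2_tendsto M \<Phi> u" "L2_tendsto M (\<lambda>j. hgrad (\<Phi> j)) U"
    using assms unfolding H10_def by metis
  have U: "sq_integrable M U" by (rule H10_sq_integrable[OF assms(1)])
  have "(LINT p|M. U p \<bullet> hgrad (\<Phi> j) p) = 0" for j
  proof -
    have "(LINT p|M. u p * kohn_laplacian (\<Phi> j) p) = 0"
      using assms(2) by (intro integral_eq_zero_AE) auto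
    then show ?thesis
      using H10_integration_by_parts[OF assms(1) test_functionsD[OF \<Phi>(1)]] by simp
  qed
  then have "(LINT p|M. hgrad (\<Phi> j) p \<bullet> U p) = 0" for j by (simp add: inner_commute)
  with L2_tendsto_inner[OF \<Phi>(3) U] have "(LINT p|M. (norm (U p))\<^sup>2) = 0"
    by (simp add: LIMSEQ_const_iff power2_norm_eq_inner)
  then have "AE p in M. (norm (U p))\<^sup>2 = 0"
    using integral_nonneg_eq_0_iff_AE[OF sq_integrable_norm[OF U]] by simp
  then show ?thesis by simp
qed

lemma H10_unique:
  assumes "H10 u U" "H10 v V" "AE p in M. u p = v p"
  shows "AE p in M. U p = V p"
  using H10_zero_imp[OF H10_diff[OF assms(1,2)]] assms(3) by auto

text \<open>The solution is the orthogonal projection of \<open>(h / sqrt K, 0)\<close> onto the pairs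
  \<open>(sqrt K u, U)\<close>.\<close>

lemma linear_problem:
  assumes "K > 0" "sq_integrable M h"
  obtains u U where "H10 u U"
    "\<And>v V. H10 v V \<Longrightarrow> (LINT p|M. U p \<bullet> V p) + K * (LINT p|M. u p * v p) = (LINT p|M. h p * v p)"
proof -
  define S where "S = {\<lambda>p. (sqrt K * u p, U p) | u U. H10 u U}"
  define f where "f p = (h p / sqrt K, 0 :: (real ^ 'n) \<times> (real ^ 'n))" for p
  have K: "sqrt K > 0" using assms(1) by simp
  have "\<exists>z\<in>S. \<forall>s\<in>S. (LINT x|M. (f x - z x) \<bullet> s x) = 0"
  proof (rule L2_projection[OF finite_M, of S f])
    show "S \<noteq> {}" using H10_zero by (auto simp: S_def)
    show "sq_integrable M z" if "z \<in> S" for z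
      using that
      by (auto simp: S_def intro!: sq_integrable_Pair sq_integrable_cmult dest: H10_sq_integrable)
    show "(\<lambda>x. a *\<^sub>R z x + b *\<^sub>R z' x) \<in> S" if "z \<in> S" "z' \<in> S" for z z' a b
    proof -
      obtain u U v V where *: "H10 u U" "H10 v V" "z = (\<lambda>p. (sqrt K * u p, U p))" "z' = (\<lambda>p. (sqrt K * v p, V p))"
        using \<open>z \<in> S\<close> \<open>z' \<in> S\<close> by (auto simp: S_def)
      have "H10 (\<lambda>p. a * u p + b * v p) (\<lambda>p. a *\<^sub>R U p + b *\<^sub>R V p)"
        by (intro H10_add H10_cmult *)
      then show ?thesis unfolding S_def *(3,4)
        by (auto simp: algebra_simps intro!: exI[of _ "\<lambda>p. a * u p + b * v p"] exI[of _ "\<lambda>p. a *\<^sub>R U p + b *\<^sub>R V p"])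
    qed
    show "g \<in> S" if F: "\<And>j. F j \<in> S" "L2_tendsto M F g" for F g
    proof -
      have "\<exists>y. H10 (fst y) (snd y) \<and> F j = (\<lambda>p. (sqrt K * fst y p, snd y p))" for j
      proof -
        obtain u U where "F j = (\<lambda>p. (sqrt K * u p, U p))" "H10 u U"
          using F(1)[of j] unfolding S_def by blast
        then show ?thesis by (intro exI[of _ "(u, U)"]) simp
      qed
      then have "\<exists>y. \<forall>j. H10 (fst (y j)) (snd (y j)) \<and> F j = (\<lambda>p. (sqrt K * fst (y j) p, snd (y j) p))"
        by (intro choice allI)
      then obtain y where y: "\<And>j. H10 (fst (y j)) (snd (y j))" "\<And>j. F j = (\<lambda>p. (sqrt K * fst (y j) p, snd (y j) p))"
        by blast
      have 1: "L2_tendsto M (\<lambda>j p. (1 / sqrt K) *\<^sub>R fst (F j p)) (\<lambda>p. (1 / sqrt K) *\<^sub>R fst (g p))"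
        by (rule L2_tendsto_bounded_linear[OF _ F(2)])
          (intro bounded_linear_const_scaleR bounded_linear_fst)
      have 2: "L2_tendsto M (\<lambda>j p. snd (F j p)) (\<lambda>p. snd (g p))"
        by (rule L2_tendsto_bounded_linear[OF bounded_linear_snd F(2)])
      have "H10 (\<lambda>p. (1 / sqrt K) *\<^sub>R fst (g p)) (\<lambda>p. snd (g p))"
        using 1 2 K by (intro H10_closed[OF y(1)]) (simp_all add: y(2))
      moreover have "g = (\<lambda>p. (sqrt K * ((1 / sqrt K) *\<^sub>R fst (g p)), snd (g p)))" using K by simp
      ultimately show ?thesis unfolding S_def mem_Collect_eq by (intro exI conjI)
    qed
    show "sq_integrable M f"
      unfolding f_def[abs_def] using sq_integrable_cmult[OF assms(2), of "1 / sqrt K"]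
      by (intro sq_integrable_Pair sq_integrable_const) simp
  qed blast
  then obtain u U where u: "H10 u U" and o: "\<And>s. s \<in> S \<Longrightarrow> (LINT p|M. (f p - (sqrt K * u p, U p)) \<bullet> s p) = 0"
    by (auto simp: S_def)
  show thesis
  proof (rule that[OF u])
    fix v V assume v: "H10 v V"
    note sq = H10_sq_integrable[OF u] H10_sq_integrable[OF v] assms(2)
    \<comment> \<open>The weights sqrt K and 1 / sqrt K cancel and leave the weak form of the
      equation.\<close>
    have "(f p - (sqrt K * u p, U p)) \<bullet> (sqrt K * v p, V p) = h p * v p - K * (u p * v p) - U p \<bullet> V p" for p
      using K by (simp add: f_def algebra_simps inner_real_def)
    then have "(LINT p|M. h p * v p - K * (u p * v p) - U p \<bullet> V p) = 0"
      using o[of "\<lambda>p. (sqrt K * v p, V p)"] v by (auto simp: S_def)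
    then show "(LINT p|M. U p \<bullet> V p) + K * (LINT p|M. u p * v p) = (LINT p|M. h p * v p)"
      by (simp add: sq sq_integrable_inner sq_integrable_mult)
  qed
qed

text \<open>Testing with v = \<open>soft_pos (u - w)\<close> turns the gradient term into the
  integral of \<open>soft_pos' (u - w)\<close> |U - \<open>hgrad w\<close>|^2 \<ge> 0, so K times
  the integral of (u - w) v is at most 0. The integrand (u - w) v is nonnegative, and positive where
  u > w.\<close>

lemma comparison:
  assumes "H10 u U" "smooth_on UNIV w" "\<And>p. 0 \<le> w p" "K > 0"
    and le: "\<And>v V. H10 v V \<Longrightarrow> AE p in M. 0 \<le> v p \<Longrightarrow>
      (LINT p|M. (U p - hgrad w p) \<bullet> V p) + K * (LINT p|M. (u p - w p) * v p) \<le> 0"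
  shows "AE p in M. u p \<le> w p"
proof -
  define v where "v p = soft_pos (u p - w p)" for p
  define V where "V p = soft_pos' (u p - w p) *\<^sub>R (U p - hgrad w p)" for p
  have v: "H10 v V" unfolding v_def[abs_def] V_def[abs_def] by (rule H10_soft_pos[OF assms(1-3)])
  have "0 \<le> (U p - hgrad w p) \<bullet> V p" for p by (simp add: V_def soft_pos'_bounds)
  then have "0 \<le> (LINT p|M. (U p - hgrad w p) \<bullet> V p)" by simp
  with le[OF v] have "K * (LINT p|M. (u p - w p) * v p) \<le> 0" by (simp add: v_def soft_pos_nonneg)
  then have "(LINT p|M. (u p - w p) * v p) \<le> 0" using assms(4) by (simp add: mult_le_0_iff)
  moreover have nn: "0 \<le> (u p - w p) * v p" for p
    by (cases "u p - w p \<le> 0") (simp_all add: v_def soft_pos_nonpos soft_pos_nonneg)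
  moreover have "integrable M (\<lambda>p. (u p - w p) * v p)"
    by (intro sq_integrable_mult sq_integrable_diff H10_sq_integrable[OF assms(1)] H10_sq_integrable[OF v]
        smooth_sq_integrable assms(2))
  ultimately have "AE p in M. (u p - w p) * v p = 0"
    using integral_nonneg_eq_0_iff_AE[of M "\<lambda>p. (u p - w p) * v p"] by (simp add: order_antisym)
  then show ?thesis
  proof eventually_elim
    case (elim p)
    then show ?case using soft_pos_pos[of "u p - w p"] by (cases "u p \<le> w p") (auto simp: v_def)
  qed
qed

section \<open>Limits of bounded solutions\<close>

lemma L2_tendsto_bounded:
  fixes F :: "nat \<Rightarrow> 'n heis \<Rightarrow> real"
  assumes "\<And>j. F j \<in> borel_measurable M" "f \<in> borel_measurable M"
    "\<And>j. AE p in M. \<bar>F j p\<bar> \<le> c" "AE p in M. (\<lambda>j. F j p) \<longlonglongrightarrow> f p"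
  shows "L2_tendsto M F f"
proof -
  interpret finite_measure M by (rule finite_M)
  note [measurable] = assms(1,2)
  have "AE p in M. \<forall>j. \<bar>F j p\<bar> \<le> c" using assms(3) by (simp add: AE_all_countable)
  with assms(4) have f: "AE p in M. \<bar>f p\<bar> \<le> c"
  proof eventually_elim
    case (elim p)
    from tendsto_rabs[OF elim(1)] elim(2) show ?case by (intro LIMSEQ_le_const2) auto
  qed
  have "(\<lambda>j. LINT p|M. (norm (F j p - f p))\<^sup>2) \<longlonglongrightarrow> (LINT p|M. 0)"
  proof (rule integral_dominated_convergence[where w = "\<lambda>_. (2 * c)\<^sup>2"])
    show "AE p in M. (\<lambda>j. (norm (F j p - f p))\<^sup>2) \<longlonglongrightarrow> 0"
      using assms(4)
    proof eventually_elim
      case (elim p)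
      then have "(\<lambda>j. (norm (F j p - f p))\<^sup>2) \<longlonglongrightarrow> (norm (f p - f p))\<^sup>2" by (intro tendsto_intros)
      then show ?case by simp
    qed
    show "AE p in M. norm ((norm (F j p - f p))\<^sup>2) \<le> (2 * c)\<^sup>2" for j
      using f assms(3)[of j]
    proof eventually_elim
      case (elim p)
      then have "\<bar>F j p - f p\<bar>\<^sup>2 \<le> (2 * c)\<^sup>2" by (intro power_mono) auto
      then show ?case by simp
    qed
  qed auto
  moreover have "sq_integrable M (F j)" for j
    by (rule sq_integrable_bounded[OF finite_M assms(1)]) (use assms(3) in simp)
  moreover have "sq_integrable M f"
    by (rule sq_integrable_bounded[OF finite_M assms(2)]) (use f in simp)
  ultimately show ?thesis by (simp add: L2_tendsto_def)
qed

text \<open>The right-hand sides are arbitrary bounded functions \<open>h j\<close>, so that one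
  lemma serves both limits: the linear iteration, where \<open>h j\<close> involves two consecutive
  iterates, and the passage through the polynomials, where the nonlinearity itself changes with
  j.\<close>

lemma solution_limit:
  assumes u: "\<And>j. H10 (u j) (U j)" and v: "v \<in> borel_measurable M"
    and uc: "\<And>j. AE p in M. \<bar>u j p\<bar> \<le> c" and uv: "AE p in M. (\<lambda>j. u j p) \<longlonglongrightarrow> v p"
    and h: "\<And>j. h j \<in> borel_measurable M" "h' \<in> borel_measurable M"
    and hB: "\<And>j. AE p in M. \<bar>h j p\<bar> \<le> B" and hh: "AE p in M. (\<lambda>j. h j p) \<longlonglongrightarrow> h' p"
    and eq: "\<And>j \<zeta> Z. H10 \<zeta> Z \<Longrightarrow> (LINT p|M. U j p \<bullet> Z p) = (LINT p|M. h j p * \<zeta> p)"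
  obtains V where "H10 v V" "\<And>\<zeta> Z. H10 \<zeta> Z \<Longrightarrow> (LINT p|M. V p \<bullet> Z p) = (LINT p|M. h' p * \<zeta> p)"
proof -
  note squ = H10_sq_integrable[OF u]
  have tu: "L2_tendsto M u v"
    by (rule L2_tendsto_bounded[OF sq_integrable_measurable[OF squ(1)] v uc uv])
  have th: "L2_tendsto M h h'" by (rule L2_tendsto_bounded[OF h hB hh])
  note sqh = L2_tendstoD(1)[OF th]
  have "(LINT p|M. (norm (U i p - U j p))\<^sup>2)
      \<le> (LINT p|M. (norm (h i p - h j p))\<^sup>2) + (LINT p|M. (norm (u i p - u j p))\<^sup>2)" for i j
  proof -
    have d: "H10 (\<lambda>p. u i p - u j p) (\<lambda>p. U i p - U j p)" by (intro H10_diff u)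
    have "(LINT p|M. (norm (U i p - U j p))\<^sup>2) = (LINT p|M. U i p \<bullet> (U i p - U j p) - U j p \<bullet> (U i p - U j p))"
      by (simp add: power2_norm_eq_inner inner_diff_left)
    also have "\<dots> = (LINT p|M. U i p \<bullet> (U i p - U j p)) - (LINT p|M. U j p \<bullet> (U i p - U j p))"
      by (intro Bochner_Integration.integral_diff sq_integrable_inner sq_integrable_diff squ)
    also have "\<dots> = (LINT p|M. h i p * (u i p - u j p)) - (LINT p|M. h j p * (u i p - u j p))"
      by (simp only: eq[OF d])
    also have "\<dots> = (LINT p|M. (h i p - h j p) * (u i p - u j p))"
      by (simp add: left_diff_distrib sq_integrable_mult sq_integrable_diff squ sqh)
    also have "\<dots> \<le> (LINT p|M. (norm (h i p - h j p))\<^sup>2 + (norm (u i p - u j p))\<^sup>2)"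
    proof (rule integral_mono)
      fix p
      show "(h i p - h j p) * (u i p - u j p) \<le> (norm (h i p - h j p))\<^sup>2 + (norm (u i p - u j p))\<^sup>2"
        using sum_squares_bound[of "h i p - h j p" "u i p - u j p"]
          sum_power2_ge_zero[of "h i p - h j p" "u i p - u j p"]
        unfolding real_norm_def power2_abs mult.assoc by linarith
    qed (intro sq_integrable_mult Bochner_Integration.integrable_add sq_integrable_norm sq_integrable_diff squ sqh)+
    also have "\<dots> = (LINT p|M. (norm (h i p - h j p))\<^sup>2) + (LINT p|M. (norm (u i p - u j p))\<^sup>2)"
      by (intro Bochner_Integration.integral_add sq_integrable_norm sq_integrable_diff squ sqh)
    finally show ?thesis .
  qed
  note est = this
  have "\<exists>N. \<forall>i\<ge>N. \<forall>j\<ge>N. (LINT p|M. (norm (U i p - U j p))\<^sup>2) < e" if e: "e > 0" for e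
  proof -
    obtain N1 where N1: "\<And>i j. i \<ge> N1 \<Longrightarrow> j \<ge> N1 \<Longrightarrow> (LINT p|M. (norm (h i p - h j p))\<^sup>2) < e / 2"
      using L2_tendsto_imp_Cauchy[OF th, of "e / 2"] e by auto
    obtain N2 where N2: "\<And>i j. i \<ge> N2 \<Longrightarrow> j \<ge> N2 \<Longrightarrow> (LINT p|M. (norm (u i p - u j p))\<^sup>2) < e / 2"
      using L2_tendsto_imp_Cauchy[OF tu, of "e / 2"] e by auto
    have "(LINT p|M. (norm (U i p - U j p))\<^sup>2) < e" if "i \<ge> max N1 N2" "j \<ge> max N1 N2" for i j
      using est[of i j] N1[of i j] N2[of i j] that by linarith
    then show ?thesis by blast
  qed
  from L2_complete[of M U, OF finite_M squ(2) this] obtain V where V: "L2_tendsto M U V" by blast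
  show thesis
  proof (rule that)
    show "H10 v V" by (rule H10_closed[OF u tu V])
    fix \<zeta> Z assume z: "H10 \<zeta> Z"
    note sqz = H10_sq_integrable[OF z]
    have "(\<lambda>j. LINT p|M. h j p * \<zeta> p) \<longlonglongrightarrow> (LINT p|M. h' p * \<zeta> p)"
      using L2_tendsto_inner[OF th sqz(1)] by (simp add: inner_real_def)
    with L2_tendsto_inner[OF V sqz(2)] show "(LINT p|M. V p \<bullet> Z p) = (LINT p|M. h' p * \<zeta> p)"
      by (simp add: eq[OF z] LIMSEQ_unique)
  qed
qed

end

section \<open>Monotone iteration\<close>

context bounded_open
begin

text \<open>The gradient is a separate argument, and membership of u in the closure of the test
  functions is stated apart from this notion and the two that follow: a barrier does not vanish on
  the boundary, and only the test function carries the boundary condition.\<close>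

definition subsolution :: "(real \<Rightarrow> real) \<Rightarrow> ('n heis \<Rightarrow> real) \<Rightarrow> ('n heis \<Rightarrow> (real ^ 'n) \<times> (real ^ 'n)) \<Rightarrow> bool" where
  "subsolution F u U \<longleftrightarrow> (\<forall>v V. H10 v V \<longrightarrow> (AE p in M. 0 \<le> v p) \<longrightarrow>
     (LINT p|M. U p \<bullet> V p) \<le> (LINT p|M. F (u p) * v p))"

definition supersolution :: "(real \<Rightarrow> real) \<Rightarrow> ('n heis \<Rightarrow> real) \<Rightarrow> ('n heis \<Rightarrow> (real ^ 'n) \<times> (real ^ 'n)) \<Rightarrow> bool" where
  "supersolution F u U \<longleftrightarrow> (\<forall>v V. H10 v V \<longrightarrow> (AE p in M. 0 \<le> v p) \<longrightarrow>
     (LINT p|M. F (u p) * v p) \<le> (LINT p|M. U p \<bullet> V p))"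

definition solution :: "(real \<Rightarrow> real) \<Rightarrow> ('n heis \<Rightarrow> real) \<Rightarrow> ('n heis \<Rightarrow> (real ^ 'n) \<times> (real ^ 'n)) \<Rightarrow> bool" where
  "solution F u U \<longleftrightarrow> (\<forall>v V. H10 v V \<longrightarrow> (LINT p|M. U p \<bullet> V p) = (LINT p|M. F (u p) * v p))"

text \<open>The superposition operator u \<mapsto> F o u. Bounds on F are taken on an interval
  [a, c], to which the barriers confine the values of u; right-hand sides are bounded in this way,
  however fast F grows.\<close>

lemma nemytskii:
  fixes F :: "real \<Rightarrow> real"
  assumes "continuous_on UNIV F" "u \<in> borel_measurable M" "AE p in M. a \<le> u p" "AE p in M. u p \<le> c"
    "\<And>t. a \<le> t \<Longrightarrow> t \<le> c \<Longrightarrow> \<bar>F t\<bar> \<le> B"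
  shows "(\<lambda>p. F (u p)) \<in> borel_measurable M" "AE p in M. \<bar>F (u p)\<bar> \<le> B" "sq_integrable M (\<lambda>p. F (u p))"
proof -
  have [measurable]: "F \<in> borel_measurable borel"
    by (rule borel_measurable_continuous_onI[OF assms(1)])
  note [measurable] = assms(2)
  show 1: "(\<lambda>p. F (u p)) \<in> borel_measurable M" by measurable
  show 2: "AE p in M. \<bar>F (u p)\<bar> \<le> B" using assms(3,4) by eventually_elim (rule assms(5))
  show "sq_integrable M (\<lambda>p. F (u p))"
    by (rule sq_integrable_bounded[OF finite_M 1, of B]) (use 2 in simp)
qed

lemma continuous_bounded_interval:
  fixes F :: "real \<Rightarrow> real"
  assumes "continuous_on UNIV F"
  obtains B where "\<And>t. a \<le> t \<Longrightarrow> t \<le> c \<Longrightarrow> \<bar>F t\<bar> \<le> B"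
proof -
  have "bounded (F ` {a..c})"
    using assms by (intro compact_imp_bounded compact_continuous_image) (auto intro: continuous_on_subset)
  then obtain B where "\<forall>x\<in>{a..c}. \<bar>F x\<bar> \<le> B" by (auto simp: bounded_iff)
  then show thesis by (intro that[of B]) auto
qed

lemma integral_mult_mono_AE:
  assumes "sq_integrable M f" "sq_integrable M g" "sq_integrable M v"
    "AE p in M. f p \<le> g p" "AE p in M. 0 \<le> (v p :: real)"
  shows "(LINT p|M. f p * v p) \<le> (LINT p|M. g p * v p)"
proof (rule integral_mono_AE)
  show "AE p in M. f p * v p \<le> g p * v p"
    using assms(4,5) by eventually_elim (rule mult_right_mono)
qed (intro sq_integrable_mult assms)+

text \<open>The step solves - \<Delta> u' + K u' = F u + K u. Comparison gives u \<le> u' because u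
  is a subsolution, and u' \<le> w because F + K id is increasing. Monotonicity again gives F u + K
  u - K u' \<le> F u', so u' is a subsolution and the step can be repeated. The equation is part of
  the conclusion for the sake of the passage to the limit.\<close>

lemma monotone_step:
  assumes K: "K > 0" and F: "continuous_on UNIV F"
    and mono: "\<And>s t. 0 \<le> s \<Longrightarrow> s \<le> t \<Longrightarrow> t \<le> c \<Longrightarrow> F s + K * s \<le> F t + K * t"
    and w: "smooth_on UNIV w" "\<And>p. 0 \<le> w p" "\<And>p. w p \<le> c" "supersolution F w (hgrad w)"
    and u: "H10 u U" "AE p in M. 0 \<le> u p" "AE p in M. u p \<le> w p" "subsolution F u U"
  obtains u' U' where "H10 u' U'" "AE p in M. u p \<le> u' p" "AE p in M. u' p \<le> w p"
    "subsolution F u' U'"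
    "\<And>v V. H10 v V \<Longrightarrow> (LINT p|M. U' p \<bullet> V p) = (LINT p|M. (F (u p) + K * u p - K * u' p) * v p)"
proof -
  obtain B where B: "\<And>t. 0 \<le> t \<Longrightarrow> t \<le> c \<Longrightarrow> \<bar>F t\<bar> \<le> B"
    using continuous_bounded_interval[OF F, where a = 0 and c = c] by blast
  note squ = H10_sq_integrable[OF u(1)] and sqw = smooth_sq_integrable[OF w(1)]
  have uc: "AE p in M. u p \<le> c" using u(3) by eventually_elim (use w(3) order_trans in blast)
  have Fu: "sq_integrable M (\<lambda>p. F (u p))"
    by (rule nemytskii[OF F sq_integrable_measurable[OF squ(1)] u(2) uc B])
  have Fw: "sq_integrable M (\<lambda>p. F (w p))"
    by (rule nemytskii[OF F sq_integrable_measurable[OF sqw(1)] _ _ B]) (use w in auto)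
  define h where "h p = F (u p) + K * u p" for p
  have h: "sq_integrable M h"
    unfolding h_def[abs_def] by (intro sq_integrable_add sq_integrable_cmult Fu squ)
  obtain u' U' where u': "H10 u' U'" and eq: "\<And>v V. H10 v V \<Longrightarrow>
      (LINT p|M. U' p \<bullet> V p) + K * (LINT p|M. u' p * v p) = (LINT p|M. h p * v p)"
    using linear_problem[OF K h] by blast
  note squ' = H10_sq_integrable[OF u']
  \<comment> \<open>The upper function in \<open>comparison\<close> has to be smooth, which u' may
    fail to be; hence u - u' is compared with 0.\<close>
  have "AE p in M. u p - u' p \<le> 0"
  proof (rule comparison[OF H10_diff[OF u(1) u'] smooth_on_const _ K])
    fix v V assume v: "H10 v V" "AE p in M. 0 \<le> v p"
    note sqv = H10_sq_integrable[OF v(1)]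
    have "(LINT p|M. (U p - U' p - hgrad (\<lambda>_. 0) p) \<bullet> V p) + K * (LINT p|M. (u p - u' p - 0) * v p)
      = (LINT p|M. U p \<bullet> V p) + K * (LINT p|M. u p * v p)
        - ((LINT p|M. U' p \<bullet> V p) + K * (LINT p|M. u' p * v p))"
      by (simp add: inner_diff_left left_diff_distrib right_diff_distrib sq_integrable_inner sq_integrable_mult squ squ' sqv)
    also have "\<dots> = (LINT p|M. U p \<bullet> V p) + K * (LINT p|M. u p * v p) - (LINT p|M. h p * v p)"
      by (simp only: eq[OF v(1)])
    also have "(LINT p|M. h p * v p) = (LINT p|M. F (u p) * v p) + K * (LINT p|M. u p * v p)"
      by (simp add: h_def distrib_right mult.assoc sq_integrable_mult Fu squ sqv)
    finally show "(LINT p|M. (U p - U' p - hgrad (\<lambda>_. 0) p) \<bullet> V p) + K * (LINT p|M. (u p - u' p - 0) * v p) \<le> 0"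
      using u(4) v by (simp add: subsolution_def)
  qed simp
  then have uu': "AE p in M. u p \<le> u' p" by simp
  have u'w: "AE p in M. u' p \<le> w p"
  proof (rule comparison[OF u' w(1,2) K])
    fix v V assume v: "H10 v V" "AE p in M. 0 \<le> v p"
    note sqv = H10_sq_integrable[OF v(1)]
    have "(LINT p|M. (U' p - hgrad w p) \<bullet> V p) + K * (LINT p|M. (u' p - w p) * v p)
      = ((LINT p|M. U' p \<bullet> V p) + K * (LINT p|M. u' p * v p))
        - (LINT p|M. hgrad w p \<bullet> V p) - K * (LINT p|M. w p * v p)"
      by (simp add: inner_diff_left left_diff_distrib right_diff_distrib sq_integrable_inner sq_integrable_mult sqw squ' sqv)
    also have "\<dots> = (LINT p|M. h p * v p) - (LINT p|M. hgrad w p \<bullet> V p) - K * (LINT p|M. w p * v p)"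
      by (simp only: eq[OF v(1)])
    also have "\<dots> \<le> (LINT p|M. (F (w p) + K * w p) * v p) - (LINT p|M. F (w p) * v p) - K * (LINT p|M. w p * v p)"
    proof (intro diff_mono order_refl)
      have "AE p in M. h p \<le> F (w p) + K * w p"
        using u(2,3) by eventually_elim (auto simp: h_def intro!: mono w(3))
      then show "(LINT p|M. h p * v p) \<le> (LINT p|M. (F (w p) + K * w p) * v p)"
        by (intro integral_mult_mono_AE h sq_integrable_add sq_integrable_cmult Fw sqw sqv v(2))
      show "(LINT p|M. F (w p) * v p) \<le> (LINT p|M. hgrad w p \<bullet> V p)"
        using w(4) v by (simp add: supersolution_def)
    qed
    also have "\<dots> = 0"
      by (simp add: distrib_right mult.assoc sq_integrable_mult Fw sqw sqv)
    finally show "(LINT p|M. (U' p - hgrad w p) \<bullet> V p) + K * (LINT p|M. (u' p - w p) * v p) \<le> 0" .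
  qed
  have u'0: "AE p in M. 0 \<le> u' p" using u(2) uu' by eventually_elim simp
  have u'c: "AE p in M. u' p \<le> c" using u'w by eventually_elim (use w(3) order_trans in blast)
  have Fu': "sq_integrable M (\<lambda>p. F (u' p))"
    by (rule nemytskii[OF F sq_integrable_measurable[OF squ'(1)] u'0 u'c B])
  have eq': "(LINT p|M. U' p \<bullet> V p) = (LINT p|M. (F (u p) + K * u p - K * u' p) * v p)" if v: "H10 v V" for v V
  proof -
    note sqv = H10_sq_integrable[OF v]
    have "(LINT p|M. (F (u p) + K * u p - K * u' p) * v p) = (LINT p|M. h p * v p) - K * (LINT p|M. u' p * v p)"
      by (simp add: h_def[symmetric] left_diff_distrib mult.assoc sq_integrable_mult h squ' sqv)
    with eq[OF v] show ?thesis by simp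
  qed
  have "subsolution F u' U'"
    unfolding subsolution_def
  proof (intro allI impI)
    fix v V assume v: "H10 v V" "AE p in M. 0 \<le> v p"
    have "AE p in M. F (u p) + K * u p - K * u' p \<le> F (u' p)"
      using u(2) uu' u'c
    proof eventually_elim
      case (elim p)
      then show ?case using mono[of "u p" "u' p"] by simp
    qed
    then show "(LINT p|M. U' p \<bullet> V p) \<le> (LINT p|M. F (u' p) * v p)"
      unfolding eq'[OF v(1)]
      by (intro integral_mult_mono_AE sq_integrable_diff sq_integrable_add sq_integrable_cmult Fu squ squ' Fu'
          v(2) H10_sq_integrable[OF v(1)])
  qed
  with that u' uu' u'w eq' show thesis by blast
qed

text \<open>The iterates increase and stay below w, hence converge almost everywhere; in the limit
  the two K terms of the right-hand side cancel.\<close>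

lemma monotone_solution:
  assumes K: "K > 0" and F: "continuous_on UNIV F"
    and mono: "\<And>s t. 0 \<le> s \<Longrightarrow> s \<le> t \<Longrightarrow> t \<le> c \<Longrightarrow> F s + K * s \<le> F t + K * t"
    and w: "smooth_on UNIV w" "\<And>p. 0 \<le> w p" "\<And>p. w p \<le> c" "supersolution F w (hgrad w)"
    and u: "H10 u U" "AE p in M. 0 \<le> u p" "AE p in M. u p \<le> w p" "subsolution F u U"
  obtains v V where "H10 v V" "AE p in M. u p \<le> v p" "AE p in M. v p \<le> w p" "solution F v V"
proof -
  \<comment> \<open>\<open>P\<close> is the invariant of a single iterate, \<open>Q\<close> relates
    consecutive ones.\<close>
  define P where "P z \<longleftrightarrow> H10 (fst z) (snd z) \<and> (AE p in M. u p \<le> fst z p) \<and> (AE p in M. fst z p \<le> w p) \<and>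
    subsolution F (fst z) (snd z)" for z
  define Q :: "('n heis \<Rightarrow> real) \<times> ('n heis \<Rightarrow> (real ^ 'n) \<times> (real ^ 'n)) \<Rightarrow>
      ('n heis \<Rightarrow> real) \<times> ('n heis \<Rightarrow> (real ^ 'n) \<times> (real ^ 'n)) \<Rightarrow> bool"
    where "Q z z' \<longleftrightarrow> (AE p in M. fst z p \<le> fst z' p) \<and> (\<forall>v V. H10 v V \<longrightarrow>
    (LINT p|M. snd z' p \<bullet> V p) = (LINT p|M. (F (fst z p) + K * fst z p - K * fst z' p) * v p))" for z z'
  have "\<exists>z. \<forall>n. P (z n) \<and> Q (z n) (z (Suc n))"
  proof (rule dependent_nat_choice)
    show "\<exists>z. P z" using u by (intro exI[of _ "(u, U)"]) (simp add: P_def)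
    fix z n assume z: "P z"
    have z0: "AE p in M. 0 \<le> fst z p" using u(2) z unfolding P_def by auto
    obtain u' U' where "H10 u' U'" "AE p in M. fst z p \<le> u' p" "AE p in M. u' p \<le> w p" "subsolution F u' U'"
      "\<And>v V. H10 v V \<Longrightarrow> (LINT p|M. U' p \<bullet> V p) = (LINT p|M. (F (fst z p) + K * fst z p - K * u' p) * v p)"
      using monotone_step[OF K F mono w, of "fst z" "snd z"] z z0 unfolding P_def by blast
    moreover from this z have "AE p in M. u p \<le> u' p" unfolding P_def by auto
    ultimately show "\<exists>z'. P z' \<and> Q z z'"
      by (intro exI[of _ "(u', U')"]) (simp add: P_def Q_def)
  qed
  then obtain z where z: "\<And>n. P (z n)" "\<And>n. Q (z n) (z (Suc n))" by blast
  define y where "y n = fst (z n)" for n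
  define Y where "Y n = snd (z n)" for n
  have y: "H10 (y n) (Y n)" "AE p in M. u p \<le> y n p" "AE p in M. y n p \<le> w p" for n
    using z(1)[of n] by (auto simp: P_def y_def Y_def)
  have yS: "AE p in M. y n p \<le> y (Suc n) p" for n using z(2)[of n] by (auto simp: Q_def y_def)
  have eq: "(LINT p|M. Y (Suc n) p \<bullet> V p) = (LINT p|M. (F (y n p) + K * y n p - K * y (Suc n) p) * v p)"
    if "H10 v V" for n v V using z(2)[of n] that by (auto simp: Q_def y_def Y_def)
  have ym [measurable]: "y n \<in> borel_measurable M" for n
    by (rule sq_integrable_measurable[OF H10_sq_integrable(1)[OF y(1)]])
  define v where "v p = lim (\<lambda>n. y n p)" for p
  have v [measurable]: "v \<in> borel_measurable M"
    unfolding v_def[abs_def] by (rule borel_measurable_lim_metric) measurable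
  have ae: "AE p in M. 0 \<le> u p \<and> (\<forall>n. u p \<le> y n p \<and> y n p \<le> w p \<and> y n p \<le> y (Suc n) p)"
    using u(2) y(2,3) yS by (simp add: AE_all_countable)
  have lim: "AE p in M. (\<lambda>n. y n p) \<longlonglongrightarrow> v p"
    using ae
  proof eventually_elim
    case (elim p)
    then have "incseq (\<lambda>n. y n p)" by (intro incseq_SucI) blast
    moreover have "\<forall>n. y n p \<le> w p" using elim by blast
    ultimately obtain L where "(\<lambda>n. y n p) \<longlonglongrightarrow> L" by (rule incseq_convergent)
    then show ?case by (simp add: v_def limI)
  qed
  have uv1: "AE p in M. u p \<le> v p"
    using lim ae
  proof eventually_elim
    case (elim p)
    show ?case by (rule LIMSEQ_le_const[OF elim(1)]) (use elim(2) in blast)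
  qed
  have uv2: "AE p in M. v p \<le> w p"
    using lim ae
  proof eventually_elim
    case (elim p)
    show ?case by (rule LIMSEQ_le_const2[OF elim(1)]) (use elim(2) in blast)
  qed
  obtain B where B: "\<And>t. 0 \<le> t \<Longrightarrow> t \<le> c \<Longrightarrow> \<bar>F t\<bar> \<le> B"
    using continuous_bounded_interval[OF F, where a = 0 and c = c] by blast
  have [measurable]: "F \<in> borel_measurable borel"
    by (rule borel_measurable_continuous_onI[OF F])
  have "AE p in M. \<forall>n. \<bar>y n p\<bar> \<le> c"
    using ae
  proof eventually_elim
    case (elim p)
    show ?case
    proof
      fix n
      have "0 \<le> u p" "u p \<le> y n p" "y n p \<le> w p" using elim by blast+
      then show "\<bar>y n p\<bar> \<le> c" using w(3)[of p] by linarith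
    qed
  qed
  then have yc: "AE p in M. \<bar>y n p\<bar> \<le> c" for n by (simp add: AE_all_countable)
  have y0: "AE p in M. 0 \<le> y n p" for n using ae by eventually_elim (meson order_trans)
  obtain V where "H10 v V" "\<And>\<zeta> Z. H10 \<zeta> Z \<Longrightarrow> (LINT p|M. V p \<bullet> Z p) = (LINT p|M. F (v p) * \<zeta> p)"
  \<comment> \<open>The index is shifted by one: \<open>y (Suc n)\<close> solves an equation whose
    right-hand side also contains \<open>y n\<close>.\<close>
  proof (rule solution_limit[of "\<lambda>n. y (Suc n)" "\<lambda>n. Y (Suc n)" v c
        "\<lambda>n p. F (y n p) + K * y n p - K * y (Suc n) p" "\<lambda>p. F (v p)" "B + K * c + K * c"])
    show "AE p in M. (\<lambda>n. y (Suc n) p) \<longlonglongrightarrow> v p"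
      using lim by eventually_elim (rule LIMSEQ_Suc)
    show "AE p in M. (\<lambda>n. F (y n p) + K * y n p - K * y (Suc n) p) \<longlonglongrightarrow> F (v p)"
      using lim
    proof eventually_elim
      case (elim p)
      have "(\<lambda>n. F (y n p)) \<longlonglongrightarrow> F (v p)"
        by (rule continuous_on_tendsto_compose[OF F elim]) auto
      then have "(\<lambda>n. F (y n p) + K * y n p - K * y (Suc n) p) \<longlonglongrightarrow> F (v p) + K * v p - K * v p"
        by (intro tendsto_intros elim LIMSEQ_Suc[OF elim])
      then show ?case by simp
    qed
    show "AE p in M. \<bar>F (y n p) + K * y n p - K * y (Suc n) p\<bar> \<le> B + K * c + K * c" for n
      using yc[of n] yc[of "Suc n"] y0[of n]
    proof eventually_elim
      case (elim p)
      have "\<bar>K * y n p\<bar> \<le> K * c" "\<bar>K * y (Suc n) p\<bar> \<le> K * c"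
        using elim K by (auto simp: abs_mult)
      moreover have "\<bar>F (y n p)\<bar> \<le> B" using elim by (intro B) auto
      ultimately show ?case by linarith
    qed
  qed (use y(1) yc eq in auto)
  with that uv1 uv2 show thesis by (auto simp: solution_def)
qed

end

section \<open>Continuous nonlinearities and the barrier\<close>

text \<open>Approximating f - 3 e to within e places p strictly between f - 4 e and f - 2 e. A
  polynomial has bounded derivative on [0, c], so adding a large multiple of the identity makes it
  increasing there.\<close>

lemma polynomial_below:
  fixes f :: "real \<Rightarrow> real"
  assumes "continuous_on UNIV f" "e > 0"
  obtains p K where "continuous_on UNIV p" "K > 0"
    "\<And>t. 0 \<le> t \<Longrightarrow> t \<le> c \<Longrightarrow> f t - 4 * e < p t \<and> p t < f t - 2 * e"
    "\<And>s t. 0 \<le> s \<Longrightarrow> s \<le> t \<Longrightarrow> t \<le> c \<Longrightarrow> p s + K * s \<le> p t + K * t"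
proof -
  have "continuous_on {0..c} (\<lambda>t. f t - 3 * e)"
    using continuous_on_subset[OF assms(1)] by (intro continuous_intros) auto
  then obtain p where p: "real_polynomial_function p" "\<And>t. t \<in> {0..c} \<Longrightarrow> \<bar>(f t - 3 * e) - p t\<bar> < e"
    using Stone_Weierstrass_real_polynomial_function[OF compact_Icc _ assms(2)] by blast
  obtain p' where p': "real_polynomial_function p'" "\<And>t. (p has_real_derivative p' t) (at t)"
    using has_real_derivative_polynomial_function[OF p(1)] by blast
  obtain p'' where p'': "\<And>t. (p' has_real_derivative p'' t) (at t)"
    using has_real_derivative_polynomial_function[OF p'(1)] by blast
  have cont: "continuous_on S p" "continuous_on S p'" for S
    using p'(2) p'' by (auto intro!: continuous_at_imp_continuous_on DERIV_isCont)
  have "bounded (p' ` {0..c})"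
    by (intro compact_imp_bounded compact_continuous_image cont) auto
  then obtain B where B: "\<forall>t\<in>{0..c}. \<bar>p' t\<bar> \<le> B" by (auto simp: bounded_iff)
  show thesis
  proof (rule that[of p "\<bar>B\<bar> + 1"])
    show "f t - 4 * e < p t \<and> p t < f t - 2 * e" if "0 \<le> t" "t \<le> c" for t
      using p(2)[of t] that by (auto simp: abs_less_iff)
    show "p s + (\<bar>B\<bar> + 1) * s \<le> p t + (\<bar>B\<bar> + 1) * t" if "0 \<le> s" "s \<le> t" "t \<le> c" for s t
    proof (rule DERIV_nonneg_imp_nondecreasing[OF that(2), of "\<lambda>x. p x + (\<bar>B\<bar> + 1) * x"])
      fix x assume x: "s \<le> x" "x \<le> t"
      have "((\<lambda>x. p x + (\<bar>B\<bar> + 1) * x) has_real_derivative (p' x + (\<bar>B\<bar> + 1))) (at x)"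
        by (auto intro!: derivative_eq_intros p'(2))
      moreover have "0 \<le> p' x + (\<bar>B\<bar> + 1)" using bspec[OF B, of x] x that by (auto simp: abs_le_iff)
      ultimately show "\<exists>y. ((\<lambda>x. p x + (\<bar>B\<bar> + 1) * x) has_real_derivative y) (at x) \<and> 0 \<le> y" by blast
    qed
  qed (use cont in auto)
qed

context bounded_open
begin

lemma continuous_solution:
  assumes f: "continuous_on UNIV f" "f 0 > 0"
    and w: "smooth_on UNIV w" "\<And>p. 0 \<le> w p" "\<And>p. w p \<le> c" "supersolution f w (hgrad w)"
  obtains u U where "H10 u U" "AE p in M. 0 \<le> u p" "AE p in M. u p \<le> w p" "solution f u U"
proof -
  have c: "0 \<le> c" using w(2,3) order_trans by blast
  \<comment> \<open>The factor 1/8 gives 4 e_0 = f 0 / 2, so \<open>P 0\<close> is positive at 0 and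
    the iteration can start from the zero function. Halving gives 2 e_k = 4 e_(k+1): the gap of
    \<open>P k\<close> ends where that of \<open>P (Suc k)\<close> begins, so the polynomials
    increase with k on [0, c].\<close>
  define e where "e k = f 0 / 8 / 2 ^ k" for k :: nat
  have e: "e k > 0" "e (Suc k) = e k / 2" for k using f(2) by (auto simp: e_def)
  have "\<exists>P K. continuous_on UNIV P \<and> K > 0 \<and>
    (\<forall>t. 0 \<le> t \<longrightarrow> t \<le> c \<longrightarrow> f t - 4 * e k < P t \<and> P t < f t - 2 * e k) \<and>
    (\<forall>s t. 0 \<le> s \<longrightarrow> s \<le> t \<longrightarrow> t \<le> c \<longrightarrow> P s + K * s \<le> P t + K * t)" for k
  proof -
    obtain P K where "continuous_on UNIV P" "K > 0"
      "\<And>t. 0 \<le> t \<Longrightarrow> t \<le> c \<Longrightarrow> f t - 4 * e k < P t \<and> P t < f t - 2 * e k"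
      "\<And>s t. 0 \<le> s \<Longrightarrow> s \<le> t \<Longrightarrow> t \<le> c \<Longrightarrow> P s + K * s \<le> P t + (K :: real) * t"
      by (rule polynomial_below[OF f(1) e(1)]) blast
    then show ?thesis by blast
  qed
  then obtain P K where PK: "\<And>k. continuous_on UNIV (P k)" "\<And>k. K k > 0"
    "\<And>k t. 0 \<le> t \<Longrightarrow> t \<le> c \<Longrightarrow> f t - 4 * e k < P k t \<and> P k t < f t - 2 * e k"
    "\<And>k s t. 0 \<le> s \<Longrightarrow> s \<le> t \<Longrightarrow> t \<le> c \<Longrightarrow> P k s + K k * s \<le> P k t + K k * t"
    by metis
  have le_f: "P k t \<le> f t" if "0 \<le> t" "t \<le> c" for k t
    using PK(3)[OF that, of k] e(1)[of k] by linarith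
  have incr: "P k t \<le> P (Suc k) t" if "0 \<le> t" "t \<le> c" for k t
    using PK(3)[OF that, of k] PK(3)[OF that, of "Suc k"] e(2)[of k] by linarith
  obtain B where B: "\<And>t. 0 \<le> t \<Longrightarrow> t \<le> c \<Longrightarrow> \<bar>f t\<bar> \<le> B"
    using continuous_bounded_interval[OF f(1), where a = 0 and c = c] by blast
  have PB: "\<bar>P k t\<bar> \<le> B + f 0" if "0 \<le> t" "t \<le> c" for k t
  proof -
    have "4 * e k \<le> f 0 / 2"
      using f(2) by (simp add: e_def field_simps)
    then show ?thesis using PK(3)[OF that, of k] B[OF that] f(2) e(1)[of k] by linarith
  qed
  note sqw = smooth_sq_integrable[OF w(1)]
  \<comment> \<open>Each \<open>P k\<close> lies below f on the range of w, so one barrier serves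
    all stages.\<close>
  have Pw: "supersolution (P k) w (hgrad w)" for k
    unfolding supersolution_def
  proof (intro allI impI)
    fix v V assume v: "H10 v V" "AE p in M. 0 \<le> v p"
    have "(LINT p|M. P k (w p) * v p) \<le> (LINT p|M. f (w p) * v p)"
    proof (rule integral_mult_mono_AE)
      show "sq_integrable M (\<lambda>p. P k (w p))"
        by (rule nemytskii(3)[OF PK(1) sq_integrable_measurable[OF sqw(1)] _ _ PB]) (use w in auto)
      show "sq_integrable M (\<lambda>p. f (w p))"
        by (rule nemytskii(3)[OF f(1) sq_integrable_measurable[OF sqw(1)] _ _ B]) (use w in auto)
    qed (use v w le_f H10_sq_integrable in auto)
    then show "(LINT p|M. P k (w p) * v p) \<le> (LINT p|M. hgrad w p \<bullet> V p)"
      using w(4) v unfolding supersolution_def by fastforce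
  qed
  \<comment> \<open>\<open>z n\<close> is a subsolution for \<open>P n\<close>; its successor solves
    the equation for \<open>P n\<close> and is a subsolution for \<open>P (Suc n)\<close>.\<close>
  define R where "R k z \<longleftrightarrow> H10 (fst z) (snd z) \<and> (AE p in M. 0 \<le> fst z p) \<and> (AE p in M. fst z p \<le> w p) \<and>
    subsolution (P k) (fst z) (snd z)" for k z
  define Q where "Q k z z' \<longleftrightarrow> (AE p in M. fst z p \<le> fst z' p) \<and> solution (P k) (fst z') (snd z')"
    for k and z z' :: "('n heis \<Rightarrow> real) \<times> ('n heis \<Rightarrow> (real ^ 'n) \<times> (real ^ 'n))"
  have "\<exists>z. \<forall>n. R n (z n) \<and> Q n (z n) (z (Suc n))"
  proof (rule dependent_nat_choice)
    have "0 \<le> P 0 0" using PK(3)[of 0 0] c f(2) by (simp add: e_def)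
    then have "subsolution (P 0) (\<lambda>_. 0) (\<lambda>_. 0)"
      unfolding subsolution_def by (auto intro!: mult_nonneg_nonneg integral_nonneg_AE)
    then show "\<exists>z. R 0 z"
      using H10_zero w(2) by (intro exI[of _ "(\<lambda>_. 0, \<lambda>_. 0)"]) (simp add: R_def)
    fix z n assume z: "R n z"
    obtain v V where v: "H10 v V" "AE p in M. fst z p \<le> v p" "AE p in M. v p \<le> w p" "solution (P n) v V"
      using monotone_solution[OF PK(2)[of n] PK(1)[of n] PK(4)[of _ _ n] w(1-3) Pw[of n], of "fst z" "snd z"] z
      unfolding R_def by blast
    have v0: "AE p in M. 0 \<le> v p" using z v(2) unfolding R_def by auto
    have vc: "AE p in M. v p \<le> c" using v(3) by eventually_elim (use w(3) order_trans in blast)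
    note sqv = H10_sq_integrable[OF v(1)]
    have "subsolution (P (Suc n)) v V"
      unfolding subsolution_def
    proof (intro allI impI)
      fix y Y assume y: "H10 y Y" "AE p in M. 0 \<le> y p"
      have "(LINT p|M. P n (v p) * y p) \<le> (LINT p|M. P (Suc n) (v p) * y p)"
      proof (rule integral_mult_mono_AE)
        show "sq_integrable M (\<lambda>p. P k (v p))" for k
          by (rule nemytskii(3)[OF PK(1) sq_integrable_measurable[OF sqv(1)] v0 vc PB])
        then show "sq_integrable M (\<lambda>p. P (Suc n) (v p))" .
        show "AE p in M. P n (v p) \<le> P (Suc n) (v p)"
          using v0 vc by eventually_elim (rule incr)
      qed (use y H10_sq_integrable in auto)
      then show "(LINT p|M. V p \<bullet> Y p) \<le> (LINT p|M. P (Suc n) (v p) * y p)"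
        using v(4) y(1) by (simp add: solution_def)
    qed
    then show "\<exists>z'. R (Suc n) z' \<and> Q n z z'"
      using v v0 by (intro exI[of _ "(v, V)"]) (simp add: R_def Q_def)
  qed
  then obtain z where z: "\<And>n. R n (z n)" "\<And>n. Q n (z n) (z (Suc n))" by blast
  define y where "y n = fst (z n)" for n
  define Y where "Y n = snd (z n)" for n
  have y: "H10 (y n) (Y n)" "AE p in M. 0 \<le> y n p" "AE p in M. y n p \<le> w p" for n
    using z(1)[of n] by (auto simp: R_def y_def Y_def)
  have yS: "AE p in M. y n p \<le> y (Suc n) p" for n using z(2)[of n] by (auto simp: Q_def y_def)
  have eq: "solution (P n) (y (Suc n)) (Y (Suc n))" for n using z(2)[of n] by (auto simp: Q_def y_def Y_def)
  have ym [measurable]: "y n \<in> borel_measurable M" for n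
    by (rule sq_integrable_measurable[OF H10_sq_integrable(1)[OF y(1)]])
  define v where "v p = lim (\<lambda>n. y n p)" for p
  have v [measurable]: "v \<in> borel_measurable M"
    unfolding v_def[abs_def] by (rule borel_measurable_lim_metric) measurable
  have ae: "AE p in M. \<forall>n. 0 \<le> y n p \<and> y n p \<le> w p \<and> y n p \<le> y (Suc n) p"
    using y(2,3) yS by (simp add: AE_all_countable)
  have lim: "AE p in M. (\<lambda>n. y n p) \<longlonglongrightarrow> v p"
    using ae
  proof eventually_elim
    case (elim p)
    then have "incseq (\<lambda>n. y n p)" by (intro incseq_SucI) blast
    moreover have "\<forall>n. y n p \<le> w p" using elim by blast
    ultimately obtain L where "(\<lambda>n. y n p) \<longlonglongrightarrow> L" by (rule incseq_convergent)
    then show ?case by (simp add: v_def limI)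
  qed
  have v0: "AE p in M. 0 \<le> v p"
    using lim ae
  proof eventually_elim
    case (elim p)
    show ?case by (rule LIMSEQ_le_const[OF elim(1)]) (use elim(2) in blast)
  qed
  have vw: "AE p in M. v p \<le> w p"
    using lim ae
  proof eventually_elim
    case (elim p)
    show ?case by (rule LIMSEQ_le_const2[OF elim(1)]) (use elim(2) in blast)
  qed
  have yc: "AE p in M. y n p \<le> c" for n using y(3)[of n] by eventually_elim (use w(3) order_trans in blast)
  have [measurable]: "f \<in> borel_measurable borel" by (rule borel_measurable_continuous_onI[OF f(1)])
  have e0: "e \<longlonglongrightarrow> 0"
    unfolding e_def by (rule LIMSEQ_divide_realpow_zero) simp
  obtain V where "H10 v V" "\<And>\<zeta> Z. H10 \<zeta> Z \<Longrightarrow> (LINT p|M. V p \<bullet> Z p) = (LINT p|M. f (v p) * \<zeta> p)"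
  proof (rule solution_limit[of "\<lambda>n. y (Suc n)" "\<lambda>n. Y (Suc n)" v c
        "\<lambda>n p. P n (y (Suc n) p)" "\<lambda>p. f (v p)" "B + f 0"])
    show "AE p in M. (\<lambda>n. y (Suc n) p) \<longlonglongrightarrow> v p"
      using lim by eventually_elim (rule LIMSEQ_Suc)
    show "AE p in M. \<bar>y (Suc n) p\<bar> \<le> c" for n
      using y(2)[of "Suc n"] yc[of "Suc n"] by eventually_elim auto
    show "(\<lambda>p. P n (y (Suc n) p)) \<in> borel_measurable M" "AE p in M. \<bar>P n (y (Suc n) p)\<bar> \<le> B + f 0" for n
      by (rule nemytskii(1,2)[OF PK(1) ym y(2) yc PB]; assumption)+
    show "AE p in M. (\<lambda>n. P n (y (Suc n) p)) \<longlonglongrightarrow> f (v p)"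
      using lim ae
    proof eventually_elim
      case (elim p)
      have l: "(\<lambda>n. f (y (Suc n) p)) \<longlonglongrightarrow> f (v p)"
        by (rule continuous_on_tendsto_compose[OF f(1) LIMSEQ_Suc[OF elim(1)]]) auto
      have r: "0 \<le> y (Suc n) p \<and> y (Suc n) p \<le> c" for n
        using elim(2) w(3)[of p] order_trans by blast
      \<comment> \<open>The bounds on \<open>P n\<close> also hold at the moving argument
        \<open>y (Suc n) p\<close>, so the limit follows by squeezing between f - 4 e_n and
        f.\<close>
      have l': "(\<lambda>n. f (y (Suc n) p) - 4 * e n) \<longlonglongrightarrow> f (v p) - 4 * 0"
        by (intro tendsto_intros l e0)
      show ?case
      proof (rule tendsto_sandwich[OF _ _ _ l])
        show "(\<lambda>n. f (y (Suc n) p) - 4 * e n) \<longlonglongrightarrow> f (v p)" using l' by simp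
        show "\<forall>\<^sub>F n in sequentially. f (y (Suc n) p) - 4 * e n \<le> P n (y (Suc n) p)"
          using PK(3) r by (intro always_eventually) (simp add: less_imp_le)
        show "\<forall>\<^sub>F n in sequentially. P n (y (Suc n) p) \<le> f (y (Suc n) p)"
          using le_f r by (intro always_eventually) simp
      qed
    qed
  qed (use y(1) eq in \<open>auto simp: solution_def\<close>)
  with that v0 vw show thesis by (auto simp: solution_def)
qed

section \<open>An explicit supersolution\<close>

lemma X_field_coord:
  assumes "\<And>t. (h has_real_derivative h' t) (at t)"
  shows "X_field j (\<lambda>p :: 'n heis. h (fst p $ k)) = (\<lambda>p. if j = k then h' (fst p $ k) else 0)"
    "Y_field j (\<lambda>p :: 'n heis. h (fst p $ k)) = (\<lambda>_. 0)"
proof -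
  have d: "dir_deriv b (\<lambda>p :: 'n heis. h (fst p $ k)) p = h' (fst p $ k) * fst b $ k" for b p
    using dir_deriv_compose(1)[OF assms smooth_on_differentiable[OF smooth_on_coords(1)]]
    by (simp add: dir_deriv_bounded_linear[OF bounded_linear_coords(1)])
  show "X_field j (\<lambda>p :: 'n heis. h (fst p $ k)) = (\<lambda>p. if j = k then h' (fst p $ k) else 0)"
    "Y_field j (\<lambda>p :: 'n heis. h (fst p $ k)) = (\<lambda>_. 0)"
    by (auto simp: X_field_eq Y_field_eq d axis_def fun_eq_iff)
qed

text \<open>A function of one horizontal coordinate sees only an ordinary second derivative, so -
  \<Delta> w = \<epsilon> \<kappa>^2 cos (\<kappa> x_k) for w = \<epsilon> (2 + cos (\<kappa> x_k)).
  On D the angle is at most pi / 3 in modulus, so the cosine is at least 1/2. The shift by 2 keeps w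
  nonnegative on the whole space, as \<open>comparison\<close> demands.\<close>

lemma barrier:
  fixes k :: 'n
  assumes "\<epsilon> > 0" "\<kappa> > 0" "\<And>p. p \<in> D \<Longrightarrow> \<kappa> * norm p \<le> pi / 3"
    and f: "continuous_on UNIV f" "\<And>t. 0 \<le> t \<Longrightarrow> t \<le> 3 * \<epsilon> \<Longrightarrow> f t \<le> \<epsilon> * \<kappa>\<^sup>2 / 2"
  obtains w where "smooth_on UNIV w" "\<And>p. 0 \<le> w p" "\<And>p. w p \<le> 3 * \<epsilon>" "supersolution f w (hgrad w)"
proof -
  define w :: "'n heis \<Rightarrow> real" where "w p = \<epsilon> * (2 + cos (\<kappa> * fst p $ k))" for p
  have "smooth_on UNIV (\<lambda>p :: 'n heis. \<epsilon> * (2 + cos (\<kappa> * fst p $ k + 0)))"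
    by (intro smooth_on_cmult smooth_on_add smooth_on_const smooth_on_cos smooth_on_coords)
  then have sw: "smooth_on UNIV w" by (simp add: w_def[abs_def])
  have w: "0 \<le> w p" "w p \<le> 3 * \<epsilon>" for p
  proof -
    have "- 1 \<le> cos (\<kappa> * fst p $ k)" "cos (\<kappa> * fst p $ k) \<le> 1" by (auto simp: cos_ge_minus_one)
    then have "0 \<le> 2 + cos (\<kappa> * fst p $ k)" "2 + cos (\<kappa> * fst p $ k) \<le> 3" by linarith+
    then show "0 \<le> w p" "w p \<le> 3 * \<epsilon>"
      using assms(1) by (simp_all add: w_def)
  qed
  have d1: "((\<lambda>t. \<epsilon> * (2 + cos (\<kappa> * t))) has_real_derivative - \<epsilon> * \<kappa> * sin (\<kappa> * t)) (at t)" for t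
    by (auto intro!: derivative_eq_intros)
  have d2: "((\<lambda>t. - \<epsilon> * \<kappa> * sin (\<kappa> * t)) has_real_derivative - \<epsilon> * \<kappa>\<^sup>2 * cos (\<kappa> * t)) (at t)" for t
    by (auto intro!: derivative_eq_intros simp: power2_eq_square)
  have X: "X_field j w = (\<lambda>p. if j = k then - \<epsilon> * \<kappa> * sin (\<kappa> * fst p $ k) else 0)" "Y_field j w = (\<lambda>_. 0)" for j
    unfolding w_def[abs_def] using X_field_coord[OF d1] by blast+
  have XX: "X_field j (X_field j w) p = (if j = k then - \<epsilon> * \<kappa>\<^sup>2 * cos (\<kappa> * fst p $ k) else 0)"
    "Y_field j (Y_field j w) p = 0" for j p
  proof -
    show "X_field j (X_field j w) p = (if j = k then - \<epsilon> * \<kappa>\<^sup>2 * cos (\<kappa> * fst p $ k) else 0)"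
    proof (cases "j = k")
      case True
      then have "X_field j w = (\<lambda>p. - \<epsilon> * \<kappa> * sin (\<kappa> * fst p $ k))" by (simp add: X)
      then show ?thesis by (simp only: X_field_coord[OF d2] True if_True)
    qed (simp add: X X_field_eq)
  qed (simp add: X Y_field_eq)
  have L: "kohn_laplacian w p = - \<epsilon> * \<kappa>\<^sup>2 * cos (\<kappa> * fst p $ k)" for p
    unfolding kohn_laplacian_def XX by (simp add: sum.delta)
  have "\<epsilon> * \<kappa>\<^sup>2 / 2 \<le> - kohn_laplacian w p" if "p \<in> D" for p
  proof -
    have "\<bar>fst p $ k\<bar> \<le> norm p"
      using component_le_norm_cart[of "fst p" k] norm_fst_le[of "fst p" "snd p"] by simp
    then have "\<kappa> * \<bar>fst p $ k\<bar> \<le> pi / 3"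
      using assms(2) assms(3)[OF that] by (meson less_imp_le mult_left_mono order_trans)
    \<comment> \<open>The cosine is even and decreasing on [0, pi], hence the absolute
      value.\<close>
    then have "cos (pi / 3) \<le> cos \<bar>\<kappa> * fst p $ k\<bar>"
      using assms(2) by (intro cos_monotone_0_pi_le) (auto simp: abs_mult)
    then have "1 / 2 \<le> cos (\<kappa> * fst p $ k)" by (simp add: cos_60)
    then have "\<epsilon> * \<kappa>\<^sup>2 * (1 / 2) \<le> \<epsilon> * \<kappa>\<^sup>2 * cos (\<kappa> * fst p $ k)"
      using assms(1) by (intro mult_left_mono) auto
    then show ?thesis by (simp add: L)
  qed
  note lap = this
  have "supersolution f w (hgrad w)"
    unfolding supersolution_def
  proof (intro allI impI)
    fix v V assume v: "H10 v V" "AE p in M. 0 \<le> v p"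
    obtain B where B: "\<And>t. 0 \<le> t \<Longrightarrow> t \<le> 3 * \<epsilon> \<Longrightarrow> \<bar>f t\<bar> \<le> B"
      using continuous_bounded_interval[OF f(1), where a = 0 and c = "3 * \<epsilon>"] by blast
    note sq = smooth_sq_integrable(1)[OF smooth_on_cmult[OF smooth_on_kohn_laplacian[OF sw], of "-1"]]
    have "(LINT p|M. f (w p) * v p) \<le> (LINT p|M. (- 1 * kohn_laplacian w p) * v p)"
    proof (rule integral_mult_mono_AE[OF _ sq _ _ v(2)])
      show "sq_integrable M (\<lambda>p. f (w p))"
        by (rule nemytskii(3)[OF f(1) sq_integrable_measurable[OF smooth_sq_integrable(1)[OF sw]] _ _ B])
          (use w in auto)
      show "sq_integrable M v" by (rule H10_sq_integrable[OF v(1)])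
      show "AE p in M. f (w p) \<le> - 1 * kohn_laplacian w p"
      proof (rule AE_I2)
        fix p assume "p \<in> space M"
        then have "\<epsilon> * \<kappa>\<^sup>2 / 2 \<le> - kohn_laplacian w p" by (intro lap) simp
        with f(2)[OF w, of p] show "f (w p) \<le> - 1 * kohn_laplacian w p" by simp
      qed
    qed
    also have "\<dots> = - (LINT p|M. v p * kohn_laplacian w p)"
      by (simp add: mult.commute[of "kohn_laplacian w _"])
    also have "\<dots> = (LINT p|M. hgrad w p \<bullet> V p)"
      using H10_integration_by_parts[OF v(1) sw] by (simp add: inner_commute)
    finally show "(LINT p|M. f (w p) * v p) \<le> (LINT p|M. hgrad w p \<bullet> V p)" .
  qed
  with sw w show thesis by (rule that)
qed

end

section \<open>The Folland-Stein space\<close>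

lemma crit_exponent_gt_2: "2 < crit_exponent CARD('n::finite)"
  by (simp add: crit_exponent_def field_simps)

lemma abs_power_mult_continuous: "a > 0 \<Longrightarrow> continuous_on S (\<lambda>t. abs_power t a * t)"
  by (simp add: abs_power_def)
    (intro continuous_on_mult continuous_on_powr' continuous_on_rabs continuous_on_id continuous_on_const; simp)

lemma abs_power_uminus: "abs_power (- t) a = abs_power t a"
  by (simp add: abs_power_def)

lemma norm_powr_2: "norm x powr 2 = (norm x)\<^sup>2"
  by simp

context bounded_open
begin

section \<open>Comparison of L^2 and L^q convergence on D\<close>

lemma Lp_tendsto_2_iff:
  "Lp_tendsto 2 D F f \<longleftrightarrow> (\<forall>j. F j \<in> borel_measurable M) \<and> f \<in> borel_measurable M \<and>
    (\<lambda>j. \<integral>\<^sup>+p. ennreal ((norm (F j p - f p))\<^sup>2) \<partial>M) \<longlonglongrightarrow> 0"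
  unfolding Lp_tendsto_def norm_powr_2 ..

lemma L2_tendsto_imp_Lp_tendsto:
  assumes "L2_tendsto M F f"
  shows "Lp_tendsto 2 D F f"
proof -
  note F = L2_tendstoD[OF assms]
  have "(\<integral>\<^sup>+p. ennreal ((norm (F j p - f p))\<^sup>2) \<partial>M) = ennreal (LINT p|M. (norm (F j p - f p))\<^sup>2)" for j
    by (intro nn_integral_eq_integral sq_integrable_norm sq_integrable_diff F) simp
  with tendsto_ennrealI[OF F(3)] show ?thesis
    using F sq_integrable_measurable by (auto simp: Lp_tendsto_2_iff)
qed

text \<open>\<open>Lp_tendsto\<close> does not assert integrability of the limit; it is recovered
  from one member of the sequence at finite L^2 distance.\<close>

lemma Lp_tendsto_imp_L2_tendsto:
  assumes "Lp_tendsto 2 D F f" "\<And>j. sq_integrable M (F j)"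
  shows "L2_tendsto M F f"
proof -
  have [measurable]: "f \<in> borel_measurable M" "F j \<in> borel_measurable M" for j
    using assms(1) by (auto simp: Lp_tendsto_2_iff)
  have lim: "(\<lambda>j. \<integral>\<^sup>+p. ennreal ((norm (F j p - f p))\<^sup>2) \<partial>M) \<longlonglongrightarrow> 0"
    using assms(1) by (auto simp: Lp_tendsto_2_iff)
  have "\<forall>\<^sub>F j in sequentially. (\<integral>\<^sup>+p. ennreal ((norm (F j p - f p))\<^sup>2) \<partial>M) < 1"
    by (rule order_tendstoD(2)[OF lim]) simp
  then obtain j where "(\<integral>\<^sup>+p. ennreal ((norm (F j p - f p))\<^sup>2) \<partial>M) < 1"
    by (auto simp: eventually_sequentially)
  then have "integrable M (\<lambda>p. (norm (F j p - f p))\<^sup>2)"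
    by (intro integrableI_nonneg) (auto intro: less_trans simp: less_top)
  then have "sq_integrable M (\<lambda>p. F j p - f p)" by (simp add: sq_integrable_def)
  from sq_integrable_diff[OF assms(2)[of j] this] have f: "sq_integrable M f" by simp
  have "(\<integral>\<^sup>+p. ennreal ((norm (F j p - f p))\<^sup>2) \<partial>M) = ennreal (LINT p|M. (norm (F j p - f p))\<^sup>2)" for j
    by (intro nn_integral_eq_integral sq_integrable_norm sq_integrable_diff f assms) simp
  with lim have "(\<lambda>j. LINT p|M. (norm (F j p - f p))\<^sup>2) \<longlonglongrightarrow> 0"
    by (simp flip: ennreal_0)
  with f assms(2) show ?thesis by (simp add: L2_tendsto_def)
qed

text \<open>For t > r compare the powers of t / r > 1. The free parameter r makes the constant term
  small before the L^q distance is sent to 0; on a set of finite measure this turns L^q convergence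
  into L^2 convergence.\<close>

lemma sq_le_powr:
  fixes q r t :: real
  assumes "2 \<le> q" "r > 0" "t \<ge> 0"
  shows "t\<^sup>2 \<le> r\<^sup>2 + r\<^sup>2 / r powr q * t powr q"
proof (cases "t \<le> r")
  case True
  then have "t\<^sup>2 \<le> r\<^sup>2" using assms(3) by (rule power_mono)
  moreover have "0 \<le> r\<^sup>2 / r powr q * t powr q" by simp
  ultimately show ?thesis by linarith
next
  case False
  then have "(t / r) powr 2 \<le> (t / r) powr q"
    using assms by (intro powr_mono) auto
  then have "t\<^sup>2 / r\<^sup>2 \<le> t powr q / r powr q"
    using assms by (simp add: powr_divide power_divide)
  then have "t\<^sup>2 \<le> r\<^sup>2 / r powr q * t powr q"
    using assms(2) by (simp add: field_simps)
  then show ?thesis by (simp add: add_increasing)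
qed

lemma Lp_tendsto_imp_Lp_tendsto_2:
  assumes "Lp_tendsto q D F f" "2 \<le> q"
  shows "Lp_tendsto 2 D F f"
proof -
  interpret finite_measure M by (rule finite_M)
  have [measurable]: "f \<in> borel_measurable M" "F j \<in> borel_measurable M" for j
    using assms(1) by (auto simp: Lp_tendsto_def)
  have lim: "(\<lambda>j. \<integral>\<^sup>+p. ennreal (norm (F j p - f p) powr q) \<partial>M) \<longlonglongrightarrow> 0"
    using assms(1) by (auto simp: Lp_tendsto_def)
  define \<mu> where "\<mu> = measure M (space M)"
  have \<mu>: "emeasure M (space M) = ennreal \<mu>" "0 \<le> \<mu>" by (auto simp: \<mu>_def emeasure_eq_measure)
  have "(\<lambda>j. \<integral>\<^sup>+p. ennreal ((norm (F j p - f p))\<^sup>2) \<partial>M) \<longlonglongrightarrow> 0"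
  proof (rule order_tendstoI)
    fix a :: ennreal assume "0 < a"
    then obtain b where b: "0 < b" "b < a" using dense by blast
    \<comment> \<open>As b < a, b is finite even when a is infinite, and can be replaced by a real
      number.\<close>
    have e: "0 < enn2real b" "ennreal (enn2real b) < a"
      using b less_top_ennreal[of b] less_trans[OF b(2)]
      by (auto simp: enn2real_positive_iff top.not_eq_extremum intro: less_le_trans)
    define e where "e = enn2real b"
    note e = e[folded e_def]
    \<comment> \<open>Chosen so that r^2 times the measure of D is at most e / 2; the summand 1
      covers measure zero.\<close>
    define r where "r = sqrt (e / (2 * (\<mu> + 1)))"
    define C where "C = r\<^sup>2 / r powr q"
    have r: "r > 0" "r\<^sup>2 * \<mu> \<le> e / 2"
      using e(1) \<mu>(2) by (auto simp: r_def field_simps)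
    have "(\<lambda>j. ennreal C * (\<integral>\<^sup>+p. ennreal (norm (F j p - f p) powr q) \<partial>M)) \<longlonglongrightarrow> ennreal C * 0"
      by (intro ennreal_tendsto_cmult lim) simp
    then have "\<forall>\<^sub>F j in sequentially. ennreal C * (\<integral>\<^sup>+p. ennreal (norm (F j p - f p) powr q) \<partial>M) < ennreal (e / 2)"
      using e(1) by (intro order_tendstoD(2)[where y = "ennreal C * 0"]) auto
    then show "\<forall>\<^sub>F j in sequentially. (\<integral>\<^sup>+p. ennreal ((norm (F j p - f p))\<^sup>2) \<partial>M) < a"
    proof eventually_elim
      case (elim j)
      have "(\<integral>\<^sup>+p. ennreal ((norm (F j p - f p))\<^sup>2) \<partial>M)
          \<le> (\<integral>\<^sup>+p. ennreal (r\<^sup>2) + ennreal C * ennreal (norm (F j p - f p) powr q) \<partial>M)"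
      proof (rule nn_integral_mono)
        fix p
        have "0 \<le> C" by (simp add: C_def)
        then show "ennreal ((norm (F j p - f p))\<^sup>2) \<le> ennreal (r\<^sup>2) + ennreal C * ennreal (norm (F j p - f p) powr q)"
          using sq_le_powr[OF assms(2) r(1), of "norm (F j p - f p)"]
          by (simp add: C_def[symmetric] ennreal_leI flip: ennreal_plus ennreal_mult)
      qed
      also have "\<dots> = ennreal (r\<^sup>2) * ennreal \<mu> + ennreal C * (\<integral>\<^sup>+p. ennreal (norm (F j p - f p) powr q) \<partial>M)"
        using \<mu>(1) by (simp add: nn_integral_add nn_integral_cmult)
      also have "\<dots> \<le> ennreal (e / 2) + ennreal C * (\<integral>\<^sup>+p. ennreal (norm (F j p - f p) powr q) \<partial>M)"
        using r(2) \<mu>(2) by (intro add_mono order_refl) (simp add: ennreal_leI flip: ennreal_mult)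
      also have "\<dots> \<le> ennreal (e / 2) + ennreal (e / 2)"
        using elim by (intro add_mono order_refl) simp
      also have "\<dots> = ennreal e" using e(1) by (simp flip: ennreal_plus)
      finally show ?case using e(2) by (rule le_less_trans)
    qed
  qed simp
  then show ?thesis by (simp add: Lp_tendsto_2_iff)
qed

text \<open>The difference x of two functions bounded by c satisfies |x|^q \<le> (2 c)^(q - 2)
  |x|^2. This is how convergence in the critical exponent is obtained.\<close>

lemma L2_tendsto_bounded_imp_Lp_tendsto:
  fixes F :: "nat \<Rightarrow> 'n heis \<Rightarrow> real"
  assumes "L2_tendsto M F f" "2 \<le> q" "\<And>j p. \<bar>F j p\<bar> \<le> c" "AE p in M. \<bar>f p\<bar> \<le> c"
  shows "Lp_tendsto q D F f"
proof -
  note F = L2_tendstoD[OF assms(1)]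
  have [measurable]: "f \<in> borel_measurable M" "F j \<in> borel_measurable M" for j
    using F sq_integrable_measurable by auto
  define C where "C = (2 * c) powr (q - 2)"
  have "(\<integral>\<^sup>+p. ennreal (norm (F j p - f p) powr q) \<partial>M)
      \<le> ennreal C * (\<integral>\<^sup>+p. ennreal ((norm (F j p - f p))\<^sup>2) \<partial>M)" for j
  proof -
    have "(\<integral>\<^sup>+p. ennreal (norm (F j p - f p) powr q) \<partial>M)
        \<le> (\<integral>\<^sup>+p. ennreal C * ennreal ((norm (F j p - f p))\<^sup>2) \<partial>M)"
    proof (rule nn_integral_mono_AE)
      show "AE p in M. ennreal (norm (F j p - f p) powr q) \<le> ennreal C * ennreal ((norm (F j p - f p))\<^sup>2)"
        using assms(4)
      proof eventually_elim
        case (elim p)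
        have "\<bar>F j p - f p\<bar> \<le> 2 * c" using elim assms(3)[of j p] by linarith
        then have "\<bar>F j p - f p\<bar> powr (q - 2) \<le> C"
          unfolding C_def using assms(2) by (intro powr_mono2) auto
        then have "\<bar>F j p - f p\<bar> powr (q - 2) * \<bar>F j p - f p\<bar> powr 2 \<le> C * \<bar>F j p - f p\<bar> powr 2"
          by (intro mult_right_mono) auto
        moreover have "\<bar>F j p - f p\<bar> powr q = \<bar>F j p - f p\<bar> powr (q - 2) * \<bar>F j p - f p\<bar> powr 2"
          by (simp only: powr_add[symmetric]) simp
        ultimately have "\<bar>F j p - f p\<bar> powr q \<le> C * (F j p - f p)\<^sup>2"
          by simp
        then show ?case
          by (simp add: C_def ennreal_leI flip: ennreal_mult)
      qed
    qed
    then show ?thesis by (simp add: nn_integral_cmult)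
  qed
  note le = this
  have "(\<lambda>j. ennreal C * (\<integral>\<^sup>+p. ennreal ((norm (F j p - f p))\<^sup>2) \<partial>M)) \<longlonglongrightarrow> ennreal C * 0"
    using L2_tendsto_imp_Lp_tendsto[OF assms(1)]
    by (intro ennreal_tendsto_cmult) (auto simp: Lp_tendsto_2_iff)
  then have up: "(\<lambda>j. ennreal C * (\<integral>\<^sup>+p. ennreal ((norm (F j p - f p))\<^sup>2) \<partial>M)) \<longlonglongrightarrow> 0"
    by simp
  have "(\<lambda>j. \<integral>\<^sup>+p. ennreal (norm (F j p - f p) powr q) \<partial>M) \<longlonglongrightarrow> 0"
    by (rule tendsto_sandwich[OF _ _ tendsto_const up]; rule always_eventually; intro allI le zero_le)
  then show ?thesis by (simp add: Lp_tendsto_def)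
qed

text \<open>A smooth truncation: it is the identity on [-c, c], and it overshoots this interval by
  at most 1 because \<open>soft_pos\<close> lags behind the positive part by at most 1.\<close>

lemma soft_pos_truncation_bound:
  assumes "c \<ge> 0"
  shows "\<bar>t - soft_pos (t - c) + soft_pos (- t - c)\<bar> \<le> c + 1"
proof -
  consider "t - c \<ge> 0" | "- t - c \<ge> 0" | "t - c \<le> 0" "- t - c \<le> 0" by linarith
  then show ?thesis
  proof cases
    case 1
    then show ?thesis using soft_pos_lower[of "t - c"] soft_pos_upper[of "t - c"] soft_pos_nonpos(1)[of "- t - c"] assms
      by linarith
  next
    case 2
    then show ?thesis using soft_pos_lower[of "- t - c"] soft_pos_upper[of "- t - c"] soft_pos_nonpos(1)[of "t - c"] assms
      by linarith
  next
    case 3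
    then show ?thesis using soft_pos_nonpos(1)[of "- t - c"] soft_pos_nonpos(1)[of "t - c"] assms by linarith
  qed
qed

text \<open>Truncating the approximating test functions keeps them smooth and compactly supported.
  The limits stay the same, since |u| \<le> c almost everywhere and both \<open>soft_pos\<close> and
  \<open>soft_pos'\<close> vanish on nonpositive arguments.\<close>

lemma H10_bounded_approximation:
  assumes "H10 u U" "AE p in M. \<bar>u p\<bar> \<le> c" "c \<ge> 0"
  obtains \<Psi> where "\<And>j. \<Psi> j \<in> test_functions D" "\<And>j p. \<bar>\<Psi> j p\<bar> \<le> c + 1" "L2_tendsto M \<Psi> u"
    "L2_tendsto M (\<lambda>j. hgrad (\<Psi> j)) U"
proof -
  obtain \<Phi>0 where \<Phi>0: "\<And>j. \<Phi>0 j \<in> test_functions D" "L2_tendsto M \<Phi>0 u" "L2_tendsto M (\<lambda>j. hgrad (\<Phi>0 j)) U"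
    using assms unfolding H10_def by metis
  obtain r where r: "strict_mono r" "AE p in M. (\<lambda>j. \<Phi>0 (r j) p) \<longlonglongrightarrow> u p"
    using L2_tendsto_AE_subseq[OF \<Phi>0(2)] .
  define \<Phi> where "\<Phi> j = \<Phi>0 (r j)" for j
  have \<Phi>: "\<And>j. \<Phi> j \<in> test_functions D" "L2_tendsto M \<Phi> u" "L2_tendsto M (\<lambda>j. hgrad (\<Phi> j)) U"
    and ae: "AE p in M. (\<lambda>j. \<Phi> j p) \<longlonglongrightarrow> u p"
    using \<Phi>0(1) L2_tendsto_subseq[OF \<Phi>0(2) r(1)] L2_tendsto_subseq[OF \<Phi>0(3) r(1)] r(2)
    by (auto simp: \<Phi>_def[abs_def])
  have \<Phi>m: "(\<lambda>p. - \<Phi> j p) \<in> test_functions D" for j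
    using test_functions_cmult[OF \<Phi>(1), of "-1"] by simp
  have g\<Phi>m: "hgrad (\<lambda>p. - \<Phi> j p) p = - hgrad (\<Phi> j) p" for j p
    using hgrad_cmult[OF test_functionsD[OF \<Phi>(1)], of "-1"] by simp
  have \<Phi>m_lim: "L2_tendsto M (\<lambda>j p. - \<Phi> j p) (\<lambda>p. - u p)" "L2_tendsto M (\<lambda>j p. - hgrad (\<Phi> j) p) (\<lambda>p. - U p)"
    by (intro L2_tendsto_bounded_linear[OF bounded_linear_minus[OF bounded_linear_ident]] \<Phi>(2,3))+
  have aem: "AE p in M. (\<lambda>j. - \<Phi> j p) \<longlonglongrightarrow> - u p" using ae by eventually_elim (rule tendsto_minus)
  note c1 = soft_pos_test[OF \<Phi>(1) smooth_on_const[of c]] and c2 = soft_pos_test[OF \<Phi>m smooth_on_const[of c]]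
  define \<Psi> where "\<Psi> j p = \<Phi> j p + (-1) * soft_pos (\<Phi> j p - c) + soft_pos (- \<Phi> j p - c)" for j p
  have t: "(\<lambda>p. \<Phi> j p + (-1) * soft_pos (\<Phi> j p - c)) \<in> test_functions D" for j
    by (intro test_functions_add test_functions_cmult \<Phi>(1) c1(1) assms(3))
  have \<Psi>: "\<Psi> j \<in> test_functions D" for j
    unfolding \<Psi>_def[abs_def] by (intro test_functions_add t c2(1) assms(3))
  \<comment> \<open>The terms \<open>- 0\<close> are the gradient of the constant c, kept so that
    the expression matches \<open>L2_tendsto_soft_pos'\<close> with \<open>W\<close> equal to
    0.\<close>
  have g: "hgrad (\<Psi> j) p = hgrad (\<Phi> j) p + (-1) *\<^sub>R (soft_pos' (\<Phi> j p - c) *\<^sub>R (hgrad (\<Phi> j) p - 0))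
      + soft_pos' (- \<Phi> j p - c) *\<^sub>R (- hgrad (\<Phi> j) p - 0)" for j p
  proof -
    have "hgrad (\<Psi> j) p = hgrad (\<lambda>p. \<Phi> j p + (-1) * soft_pos (\<Phi> j p - c)) p + hgrad (\<lambda>p. soft_pos (- \<Phi> j p - c)) p"
      unfolding \<Psi>_def[abs_def] by (intro hgrad_add test_functionsD[OF t] test_functionsD[OF c2(1)] assms(3))
    also have "hgrad (\<lambda>p. \<Phi> j p + (-1) * soft_pos (\<Phi> j p - c)) p
        = hgrad (\<Phi> j) p + hgrad (\<lambda>p. (-1) * soft_pos (\<Phi> j p - c)) p"
      by (intro hgrad_add test_functionsD[OF \<Phi>(1)] smooth_on_cmult test_functionsD[OF c1(1)] assms(3))
    also have "hgrad (\<lambda>p. (-1) * soft_pos (\<Phi> j p - c)) p = (-1) *\<^sub>R hgrad (\<lambda>p. soft_pos (\<Phi> j p - c)) p"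
      by (intro hgrad_cmult test_functionsD[OF c1(1)] assms(3))
    finally show ?thesis by (simp only: c1(2)[OF assms(3)] c2(2)[OF assms(3)] g\<Phi>m hgrad_const)
  qed
  note um = sq_integrable_measurable[OF H10_sq_integrable(1)[OF assms(1)]]
    and Um = sq_integrable_measurable[OF H10_sq_integrable(2)[OF assms(1)]]
  have in_range: "AE p in M. u p - c \<le> 0 \<and> - u p - c \<le> 0" using assms(2) by eventually_elim auto
  have "L2_tendsto M \<Psi> (\<lambda>p. u p + (-1) *\<^sub>R soft_pos (u p - c) + soft_pos (- u p - c))"
    unfolding \<Psi>_def[abs_def] real_scaleR_def[symmetric]
    by (intro L2_tendsto_add \<Phi>(2) L2_tendsto_bounded_linear[OF bounded_linear_scaleR_right] L2_tendsto_soft_pos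
        \<Phi>m_lim(1) sq_integrable_const)
  then have l1: "L2_tendsto M \<Psi> u"
    by (rule L2_tendsto_cong_AE[OF _ um]) (use in_range in \<open>eventually_elim, simp add: soft_pos_nonpos\<close>)
  have "L2_tendsto M (\<lambda>j p. hgrad (\<Phi> j) p + (-1) *\<^sub>R (soft_pos' (\<Phi> j p - c) *\<^sub>R (hgrad (\<Phi> j) p - 0))
        + soft_pos' (- \<Phi> j p - c) *\<^sub>R (- hgrad (\<Phi> j) p - 0))
      (\<lambda>p. U p + (-1) *\<^sub>R (soft_pos' (u p - c) *\<^sub>R (U p - 0)) + soft_pos' (- u p - c) *\<^sub>R (- U p - 0))"
    by (intro L2_tendsto_add \<Phi>(3) L2_tendsto_bounded_linear[OF bounded_linear_scaleR_right]
        L2_tendsto_soft_pos'[where w = "\<lambda>_. c" and W = "\<lambda>_. 0", OF \<Phi>(3) _ um _ _ ae]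
        L2_tendsto_soft_pos'[where w = "\<lambda>_. c" and W = "\<lambda>_. 0", OF \<Phi>m_lim(2) _ _ _ _ aem]
        sq_integrable_const sq_integrable_measurable[OF L2_tendstoD(1)[OF \<Phi>(2)]]
        sq_integrable_measurable[OF L2_tendstoD(1)[OF \<Phi>m_lim(1)]]
        sq_integrable_measurable[OF L2_tendstoD(2)[OF \<Phi>m_lim(1)]] borel_measurable_const)
  then have l2: "L2_tendsto M (\<lambda>j. hgrad (\<Psi> j)) U"
    unfolding g[abs_def]
    by (rule L2_tendsto_cong_AE[OF _ Um]) (use in_range in \<open>eventually_elim, simp add: soft_pos_nonpos\<close>)
  have "\<bar>\<Psi> j p\<bar> \<le> c + 1" for j p
    using soft_pos_truncation_bound[OF assms(3), of "\<Phi> j p"] by (simp add: \<Psi>_def)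
  with \<Psi> l1 l2 show thesis using that by blast
qed

text \<open>\<open>FS_norm\<close> of a difference is the L^2 distance of the gradients, and these
  converge; the uniform bound on the approximations supplies convergence in the critical
  exponent.\<close>

lemma H10_bounded_folland_stein:
  assumes "H10 u U" "AE p in M. \<bar>u p\<bar> \<le> c" "c \<ge> 0"
  shows "u \<in> folland_stein D"
proof -
  obtain \<Psi> where \<Psi>: "\<And>j. \<Psi> j \<in> test_functions D" "\<And>j p. \<bar>\<Psi> j p\<bar> \<le> c + 1" "L2_tendsto M \<Psi> u"
    "L2_tendsto M (\<lambda>j. hgrad (\<Psi> j)) U"
    by (rule H10_bounded_approximation[OF assms]) blast
  have "AE p in M. \<bar>u p\<bar> \<le> c + 1" using assms(2) by eventually_elim simp
  then have "Lp_tendsto (crit_exponent CARD('n)) D \<Psi> u"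
    using crit_exponent_gt_2[where 'n = 'n] by (intro L2_tendsto_bounded_imp_Lp_tendsto[OF \<Psi>(3) _ \<Psi>(2)]) auto
  moreover have "FS_Cauchy D \<Psi>"
    unfolding FS_Cauchy_def
  proof (intro allI impI)
    fix e :: real assume e: "e > 0"
    then obtain N where N: "\<And>i j. i \<ge> N \<Longrightarrow> j \<ge> N \<Longrightarrow> (LINT p|M. (norm (hgrad (\<Psi> i) p - hgrad (\<Psi> j) p))\<^sup>2) < e\<^sup>2"
      using L2_tendsto_imp_Cauchy[OF \<Psi>(4), of "e\<^sup>2"] by auto
    have "FS_norm D (\<lambda>p. \<Psi> i p - \<Psi> j p) < e" if "i \<ge> N" "j \<ge> N" for i j
    proof -
      have "FS_norm D (\<lambda>p. \<Psi> i p - \<Psi> j p) = sqrt (LINT p|M. (norm (hgrad (\<Psi> i) p - hgrad (\<Psi> j) p))\<^sup>2)"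
        by (simp add: FS_norm_def hgrad_diff test_functionsD[OF \<Psi>(1)])
      also have "\<dots> < sqrt (e\<^sup>2)" using N[OF that] by (rule real_sqrt_less_mono)
      finally show ?thesis using e by simp
    qed
    then show "\<exists>N. \<forall>i\<ge>N. \<forall>j\<ge>N. FS_norm D (\<lambda>p. \<Psi> i p - \<Psi> j p) < e" by blast
  qed
  ultimately show ?thesis using \<Psi>(1) by (auto simp: folland_stein_def)
qed

text \<open>\<open>weak_hgrad\<close> is a \<open>SOME\<close> choice, so existence has to be shown;
  it comes from completeness, applied to the gradients of a defining sequence. The chosen gradient
  may belong to another approximating sequence, and it is for that one that both limits are
  converted to L^2.\<close>

lemma H10_weak_hgrad:
  assumes "u \<in> folland_stein D"
  shows "H10 u (weak_hgrad D u)"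
proof -
  obtain \<Phi> where \<Phi>: "\<And>j. \<Phi> j \<in> test_functions D" "FS_Cauchy D \<Phi>" "Lp_tendsto (crit_exponent CARD('n)) D \<Phi> u"
    using assms by (auto simp: folland_stein_def)
  have "\<exists>N. \<forall>i\<ge>N. \<forall>j\<ge>N. (LINT p|M. (norm (hgrad (\<Phi> i) p - hgrad (\<Phi> j) p))\<^sup>2) < e" if e: "e > 0" for e
  proof -
    obtain N where N: "\<And>i j. i \<ge> N \<Longrightarrow> j \<ge> N \<Longrightarrow> FS_norm D (\<lambda>p. \<Phi> i p - \<Phi> j p) < sqrt e"
      using \<Phi>(2) e unfolding FS_Cauchy_def by (meson real_sqrt_gt_zero)
    have "(LINT p|M. (norm (hgrad (\<Phi> i) p - hgrad (\<Phi> j) p))\<^sup>2) < e" if "i \<ge> N" "j \<ge> N" for i j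
      using N[OF that] by (simp add: FS_norm_def hgrad_diff test_functionsD[OF \<Phi>(1)])
    then show ?thesis by blast
  qed
  from L2_complete[of M "\<lambda>j. hgrad (\<Phi> j)", OF finite_M smooth_sq_integrable(2)[OF test_functionsD[OF \<Phi>(1)]] this]
  obtain U where "L2_tendsto M (\<lambda>j. hgrad (\<Phi> j)) U" by blast
  then have "has_weak_hgrad D u U"
    unfolding has_weak_hgrad_def using \<Phi>(1,3) L2_tendsto_imp_Lp_tendsto by blast
  then have "has_weak_hgrad D u (weak_hgrad D u)" unfolding weak_hgrad_def by (rule someI[of "has_weak_hgrad D u"])
  then obtain \<Psi> where \<Psi>: "\<And>j. \<Psi> j \<in> test_functions D" "Lp_tendsto (crit_exponent CARD('n)) D \<Psi> u"
    "Lp_tendsto 2 D (\<lambda>j. hgrad (\<Psi> j)) (weak_hgrad D u)" unfolding has_weak_hgrad_def by blast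
  note s = smooth_sq_integrable[OF test_functionsD[OF \<Psi>(1)]]
  have "L2_tendsto M \<Psi> u"
    using crit_exponent_gt_2[where 'n = 'n]
    by (intro Lp_tendsto_imp_L2_tendsto[OF Lp_tendsto_imp_Lp_tendsto_2[OF \<Psi>(2)]] s) simp
  moreover have "L2_tendsto M (\<lambda>j. hgrad (\<Psi> j)) (weak_hgrad D u)"
    by (rule Lp_tendsto_imp_L2_tendsto[OF \<Psi>(3) s(2)])
  ultimately show ?thesis unfolding H10_def using \<Psi>(1) by blast
qed

text \<open>A test function from the completion may be unbounded but is square integrable, while the
  nonlinear terms in the bounded u are bounded, so the integral on the right can be split.
  Uniqueness identifies \<open>weak_hgrad D u\<close> with U almost everywhere.\<close>

lemma solution_imp_weak_solution:
  assumes g: "continuous_on UNIV g" and u: "H10 u U" "AE p in M. \<bar>u p\<bar> \<le> c" "c \<ge> 0"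
    and sol: "solution (\<lambda>t. abs_power t (crit_exponent CARD('n) - 2) * t + l * g t) u U"
  shows "weak_solution D g l u"
  unfolding weak_solution_def
proof (intro conjI ballI)
  let ?a = "crit_exponent CARD('n) - 2"
  show uF: "u \<in> folland_stein D" by (rule H10_bounded_folland_stein[OF u])
  fix \<phi> assume "\<phi> \<in> folland_stein D"
  then have \<phi>: "H10 \<phi> (weak_hgrad D \<phi>)" by (rule H10_weak_hgrad)
  have eqU: "AE p in M. weak_hgrad D u p = U p"
    by (rule H10_unique[OF H10_weak_hgrad[OF uF] u(1)]) simp
  note squ = H10_sq_integrable[OF u(1)] and sq\<phi> = H10_sq_integrable[OF \<phi>]
    and sqw = H10_sq_integrable[OF H10_weak_hgrad[OF uF]]
  note [measurable] = squ[THEN sq_integrable_measurable] sq\<phi>[THEN sq_integrable_measurable]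
    sqw[THEN sq_integrable_measurable]
  have b: "AE p in M. - c \<le> u p" "AE p in M. u p \<le> c" using u(2) by (eventually_elim, simp)+
  have f: "continuous_on UNIV (\<lambda>t. abs_power t ?a * t)"
    using crit_exponent_gt_2[where 'n = 'n] by (intro abs_power_mult_continuous) simp
  obtain B1 where B1: "\<And>t. - c \<le> t \<Longrightarrow> t \<le> c \<Longrightarrow> \<bar>abs_power t ?a * t\<bar> \<le> B1"
    using continuous_bounded_interval[OF f, of "- c" c] by blast
  obtain B2 where B2: "\<And>t. - c \<le> t \<Longrightarrow> t \<le> c \<Longrightarrow> \<bar>g t\<bar> \<le> B2"
    using continuous_bounded_interval[OF g, of "- c" c] by blast
  have i1: "integrable M (\<lambda>p. abs_power (u p) ?a * u p * \<phi> p)"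
    by (rule sq_integrable_mult[OF nemytskii(3)[OF f sq_integrable_measurable[OF squ(1)] b B1] sq\<phi>(1)])
  have i2: "integrable M (\<lambda>p. g (u p) * \<phi> p)"
    by (rule sq_integrable_mult[OF nemytskii(3)[OF g sq_integrable_measurable[OF squ(1)] b B2] sq\<phi>(1)])
  have "(LINT p|M. weak_hgrad D u p \<bullet> weak_hgrad D \<phi> p) = (LINT p|M. U p \<bullet> weak_hgrad D \<phi> p)"
    by (rule integral_cong_AE) (use eqU in auto)
  also have "\<dots> = (LINT p|M. (abs_power (u p) ?a * u p + l * g (u p)) * \<phi> p)"
    using sol \<phi> by (simp add: solution_def)
  also have "\<dots> = (LINT p|M. abs_power (u p) ?a * u p * \<phi> p) + l * (LINT p|M. g (u p) * \<phi> p)"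
    using i1 i2 by (simp add: distrib_right mult.assoc)
  finally show "(LINT p|M. weak_hgrad D u p \<bullet> weak_hgrad D \<phi> p)
      - (LINT p|M. abs_power (u p) ?a * u p * \<phi> p) = l * (LINT p|M. g (u p) * \<phi> p)" by simp
qed

section \<open>Existence for small parameters\<close>

lemma positive_solution:
  assumes a: "a > 0" and g: "continuous_on UNIV g" "g 0 > 0"
  obtains L where "L > 0" "\<And>l. 0 < l \<Longrightarrow> l < L \<Longrightarrow> \<exists>u U c. H10 u U \<and> (AE p in M. \<bar>u p\<bar> \<le> c) \<and> 0 \<le> c \<and>
    solution (\<lambda>t. abs_power t a * t + l * g t) u U"
proof -
  obtain R where R: "R > 0" "\<And>p. p \<in> D \<Longrightarrow> norm p \<le> R" using bounded_D by (auto simp: bounded_pos)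
  \<comment> \<open>The largest frequency for which the bound R on D guarantees \<kappa> |p| \<le>
    pi / 3.\<close>
  define \<kappa> where "\<kappa> = pi / (3 * R)"
  have \<kappa>: "\<kappa> > 0" "\<And>p. p \<in> D \<Longrightarrow> \<kappa> * norm p \<le> pi / 3"
    using R by (auto simp: \<kappa>_def field_simps)
  \<comment> \<open>Solves (3 \<epsilon>)^a = \<kappa>^2 / 12, so that t^a t \<le> \<epsilon>
    \<kappa>^2 / 4 for 0 \<le> t \<le> 3 \<epsilon>.\<close>
  define \<epsilon> where "\<epsilon> = (\<kappa>\<^sup>2 / 12) powr (1 / a) / 3"
  have \<epsilon>: "\<epsilon> > 0" "(3 * \<epsilon>) powr a = \<kappa>\<^sup>2 / 12"
    using a \<kappa>(1) by (auto simp: \<epsilon>_def powr_powr)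
  obtain G where G: "\<And>t. 0 \<le> t \<Longrightarrow> t \<le> 3 * \<epsilon> \<Longrightarrow> \<bar>g t\<bar> \<le> G"
    using continuous_bounded_interval[OF g(1), of 0 "3 * \<epsilon>"] by blast
  have G0: "G > 0" using G[of 0] \<epsilon>(1) g(2) by simp
  show thesis
  \<comment> \<open>For l below this bound l g t stays below \<epsilon> \<kappa>^2 / 4, the part of
    \<epsilon> \<kappa>^2 / 2 left over by the critical term.\<close>
  proof (rule that[of "\<epsilon> * \<kappa>\<^sup>2 / (4 * G)"])
    show "0 < \<epsilon> * \<kappa>\<^sup>2 / (4 * G)" using \<epsilon>(1) \<kappa>(1) G0 by simp
    fix l assume l: "0 < l" "l < \<epsilon> * \<kappa>\<^sup>2 / (4 * G)"
    define f where "f t = abs_power t a * t + l * g t" for t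
    have f: "continuous_on UNIV f" unfolding f_def[abs_def]
      by (intro continuous_intros abs_power_mult_continuous a g)
    have f0: "f 0 > 0" using l(1) g(2) by (simp add: f_def)
    have fle: "f t \<le> \<epsilon> * \<kappa>\<^sup>2 / 2" if t: "0 \<le> t" "t \<le> 3 * \<epsilon>" for t
    proof -
      have "abs_power t a \<le> \<kappa>\<^sup>2 / 12"
        using powr_mono2[of a t "3 * \<epsilon>"] a t \<epsilon>(2) by (simp add: abs_power_def)
      then have "abs_power t a * t \<le> \<kappa>\<^sup>2 / 12 * (3 * \<epsilon>)" using t by (intro mult_mono) auto
      moreover have "l * g t \<le> l * G" using G[OF t] l(1) by (intro mult_left_mono) auto
      moreover have "l * G \<le> \<epsilon> * \<kappa>\<^sup>2 / 4" using l(2) G0 by (simp add: field_simps)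
      ultimately show ?thesis unfolding f_def by (simp add: field_simps)
    qed
    obtain w where w: "smooth_on UNIV w" "\<And>p. 0 \<le> w p" "\<And>p. w p \<le> 3 * \<epsilon>" "supersolution f w (hgrad w)"
      using barrier[OF \<epsilon>(1) \<kappa> f fle] by blast
    obtain u U where u: "H10 u U" "AE p in M. 0 \<le> u p" "AE p in M. u p \<le> w p" "solution f u U"
      using continuous_solution[OF f f0 w] by blast
    have "AE p in M. \<bar>u p\<bar> \<le> 3 * \<epsilon>"
      using u(2,3)
    proof eventually_elim
      case (elim p)
      then show ?case using w(3)[of p] by simp
    qed
    with u \<epsilon>(1) show "\<exists>u U c. H10 u U \<and> (AE p in M. \<bar>u p\<bar> \<le> c) \<and> 0 \<le> c \<and>
        solution (\<lambda>t. abs_power t a * t + l * g t) u U"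
      unfolding f_def[abs_def] by (intro exI[of _ u] exI[of _ U] exI[of _ "3 * \<epsilon>"]) simp
  qed
qed

lemma solution_uminus:
  assumes "solution F u U" "\<And>t. F' (- t) = - F t"
  shows "solution F' (\<lambda>p. - u p) (\<lambda>p. - U p)"
  using assms by (simp add: solution_def)

lemma bounded_solution:
  assumes a: "a > 0" and g: "continuous_on UNIV g" "g 0 \<noteq> 0"
  obtains L where "L > 0" "\<And>l. 0 < l \<Longrightarrow> l < L \<Longrightarrow> \<exists>u U c. H10 u U \<and> (AE p in M. \<bar>u p\<bar> \<le> c) \<and> 0 \<le> c \<and>
    solution (\<lambda>t. abs_power t a * t + l * g t) u U"
proof (cases "g 0 > 0")
  case True
  from positive_solution[OF a g(1) this] that show thesis by blast
next
  case False
  define g' where "g' t = - g (- t)" for t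
  have "continuous_on UNIV g'" unfolding g'_def[abs_def]
    by (intro continuous_intros continuous_on_compose2[OF g(1)]) auto
  moreover have "g' 0 > 0" using False g(2) by (simp add: g'_def)
  ultimately obtain L where L: "L > 0" "\<And>l. 0 < l \<Longrightarrow> l < L \<Longrightarrow> \<exists>u U c. H10 u U \<and> (AE p in M. \<bar>u p\<bar> \<le> c) \<and> 0 \<le> c \<and>
    solution (\<lambda>t. abs_power t a * t + l * g' t) u U"
    using positive_solution[OF a] by blast
  show thesis
  proof (rule that[OF L(1)])
    fix l assume "0 < l" "l < L"
    from L(2)[OF this] obtain u U c where u: "H10 u U" "AE p in M. \<bar>u p\<bar> \<le> c" "0 \<le> c"
      "solution (\<lambda>t. abs_power t a * t + l * g' t) u U" by blast
    have "H10 (\<lambda>p. - u p) (\<lambda>p. - U p)" using H10_cmult[OF u(1), of "-1"] by simp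
    \<comment> \<open>The critical term is odd and \<open>g'\<close> is the reflection of g, so
      negation carries a solution for \<open>g'\<close> to one for g with the same l.\<close>
    moreover have "solution (\<lambda>t. abs_power t a * t + l * g t) (\<lambda>p. - u p) (\<lambda>p. - U p)"
      by (rule solution_uminus[OF u(4)]) (simp add: g'_def abs_power_uminus)
    ultimately show "\<exists>u U c. H10 u U \<and> (AE p in M. \<bar>u p\<bar> \<le> c) \<and> 0 \<le> c \<and>
        solution (\<lambda>t. abs_power t a * t + l * g t) u U"
      using u(2,3) by (intro exI[of _ "\<lambda>p. - u p"] exI[of _ "\<lambda>p. - U p"] exI[of _ c]) simp
  qed
qed

section \<open>Nontriviality\<close>

lemma ex_test_function_integral_nonzero:
  assumes "D \<noteq> {}"
  obtains \<phi> where "\<phi> \<in> test_functions D" "(LINT p|M. \<phi> p) \<noteq> 0"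
proof -
  obtain p0 where "p0 \<in> D" using assms by blast
  then obtain r where r: "r > 0" "cball p0 r \<subseteq> D" using open_D by (meson open_contains_cball)
  \<comment> \<open>This is r^2 - |p - p0|^2, written as a sum over \<open>Basis\<close> so that
    smoothness follows from that of linear functionals; \<open>soft_pos\<close> of it is a bump
    function, positive exactly inside the ball.\<close>
  define s where "s p = r\<^sup>2 - (\<Sum>b\<in>Basis. ((p - p0) \<bullet> b) * ((p - p0) \<bullet> b))" for p
  have s: "s p = r\<^sup>2 - (dist p0 p)\<^sup>2" for p
    by (simp add: s_def dist_norm norm_minus_commute[of p0] power2_norm_eq_inner[of "p - p0"] euclidean_inner[of "p - p0" "p - p0"])
  have ss: "smooth_on UNIV s"
    unfolding s_def[abs_def] inner_diff_left
    by (intro smooth_on_diff smooth_on_const smooth_on_sum smooth_on_mult smooth_on_bounded_linear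
        bounded_linear_inner_left)
  define \<phi> where "\<phi> p = soft_pos (s p)" for p
  have sm: "smooth_on UNIV \<phi>" unfolding \<phi>_def[abs_def] by (rule smooth_on_soft_pos[OF ss])
  have "{p. \<phi> p \<noteq> 0} \<subseteq> cball p0 r"
  proof
    fix p assume "p \<in> {p. \<phi> p \<noteq> 0}"
    then have "s p > 0" using soft_pos_nonpos(1)[of "s p"] by (auto simp: \<phi>_def not_le[symmetric])
    then have "(dist p0 p)\<^sup>2 < r\<^sup>2" by (simp add: s)
    then show "p \<in> cball p0 r" using r(1) power_less_imp_less_base[of "dist p0 p" 2 r] by simp
  qed
  then have cl: "closure {p. \<phi> p \<noteq> 0} \<subseteq> cball p0 r" by (simp add: closure_minimal)
  then have "compact (closure {p. \<phi> p \<noteq> 0})"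
    by (meson bounded_cball bounded_subset closed_closure compact_eq_bounded_closed)
  with sm cl r(2) have t: "\<phi> \<in> test_functions D" unfolding test_functions_def by blast
  have pos: "\<phi> p > 0" if "p \<in> ball p0 r" for p
  proof -
    have "(dist p0 p)\<^sup>2 < r\<^sup>2" using that by (intro power_strict_mono) auto
    then show ?thesis by (auto simp: \<phi>_def s intro: soft_pos_pos)
  qed
  have "(LINT p|M. \<phi> p) \<noteq> 0"
  proof
    assume "(LINT p|M. \<phi> p) = 0"
    then have "(LINT p|lborel. \<phi> p) = 0" using test_functions_integral_lebesgue_on(1)[OF t open_D] by simp
    then have "AE p in lborel. \<phi> p = 0"
      by (rule integral_nonneg_eq_0_iff_AE[OF test_functions_integrable[OF t], THEN iffD1, rotated])
        (simp add: \<phi>_def soft_pos_nonneg)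
    then obtain N where N: "{p \<in> space lborel. \<phi> p \<noteq> 0} \<subseteq> N" "emeasure lborel N = 0" "N \<in> sets lborel"
      by (rule AE_E)
    then have "ball p0 r \<subseteq> N" using pos by force
    moreover have "negligible N"
      using N(2,3) by (simp add: negligible_iff_null_sets null_sets_completionI null_setsI)
    ultimately have "negligible (ball p0 r)" by (rule negligible_subset[rotated])
    then show False using open_not_negligible[OF open_ball, of p0 r] r(1) by simp
  qed
  with t show thesis by (rule that)
qed

text \<open>If u vanishes almost everywhere, so does U by closability, and the equation reads 0 = F
  0 times the integral of \<phi>, which fails for a bump function.\<close>

lemma solution_nontrivial:
  assumes "D \<noteq> {}" "continuous_on UNIV F" "H10 u U" "solution F u U" "F 0 \<noteq> 0"
  shows "\<not> (AE p in M. u p = 0)"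
proof
  assume u0: "AE p in M. u p = 0"
  obtain \<phi> where \<phi>: "\<phi> \<in> test_functions D" "(LINT p|M. \<phi> p) \<noteq> 0"
    using ex_test_function_integral_nonzero[OF assms(1)] .
  have "AE p in M. U p = 0" by (rule H10_zero_imp[OF assms(3) u0])
  then have "(LINT p|M. U p \<bullet> hgrad \<phi> p) = 0" by (intro integral_eq_zero_AE) auto
  then have "0 = (LINT p|M. F (u p) * \<phi> p)"
    using assms(4) H10_test[OF \<phi>(1)] by (simp add: solution_def)
  also have "\<dots> = (LINT p|M. F 0 * \<phi> p)"
  proof (rule Bochner_Integration.integral_cong_AE)
    note [measurable] = sq_integrable_measurable[OF H10_sq_integrable(1)[OF H10_test[OF \<phi>(1)]]]
      sq_integrable_measurable[OF H10_sq_integrable(1)[OF assms(3)]] borel_measurable_continuous_onI[OF assms(2)]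
    show "(\<lambda>p. F 0 * \<phi> p) \<in> borel_measurable M" by measurable
    show "AE p in M. F (u p) * \<phi> p = F 0 * \<phi> p" using u0 by eventually_elim simp
    show "(\<lambda>p. F (u p) * \<phi> p) \<in> borel_measurable M" by measurable
  qed
  finally show False using assms(5) \<phi>(2) by simp
qed

end

theorem theorem1p1:
  fixes D :: "'n::finite heis set" and g :: "real \<Rightarrow> real" and a1 a2 p :: real
  assumes "smooth_bounded_domain D"
    and "continuous_on UNIV g" and "g 0 \<noteq> 0"
    and "a1 > 0" and "a2 > 0"
    and "1 \<le> p" and "p < crit_exponent CARD('n)"
    and "\<And>t. \<bar>g t\<bar> \<le> a1 + a2 * abs_power t (p - 1)"
  shows "\<exists>\<Lambda> :: real set. open \<Lambda> \<and> is_interval \<Lambda> \<and> \<Lambda> \<noteq> {} \<and> \<Lambda> \<subseteq> {0<..} \<and>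
           (\<forall>l\<in>\<Lambda>. \<exists>u :: 'n heis \<Rightarrow> real.
              weak_solution D g l u \<and> \<not> (AE p in lebesgue_on D. u p = 0))"
proof -
  interpret bounded_open D
    using assms(1) by unfold_locales (auto simp: smooth_bounded_domain_def)
  have ne: "D \<noteq> {}" using assms(1) by (simp add: smooth_bounded_domain_def)
  let ?a = "crit_exponent CARD('n) - 2"
  have a: "?a > 0" using crit_exponent_gt_2[where 'n = 'n] by simp
  obtain L where L: "L > 0" "\<And>l. 0 < l \<Longrightarrow> l < L \<Longrightarrow> \<exists>u U c. H10 u U \<and> (AE p in M. \<bar>u p\<bar> \<le> c) \<and> 0 \<le> c \<and>
    solution (\<lambda>t. abs_power t ?a * t + l * g t) u U"
    using bounded_solution[OF a assms(2,3)] by blast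
  show ?thesis
  proof (intro exI[of _ "{0<..<L}"] conjI ballI)
    show "open {0<..<L}" "is_interval {0<..<L}" "{0<..<L} \<noteq> {}" "{0<..<L} \<subseteq> {0<..}"
      using L(1) by (auto simp: is_interval_oo)
    fix l assume l: "l \<in> {0<..<L}"
    with L(2)[of l] obtain u U c where u: "H10 u U" "AE p in M. \<bar>u p\<bar> \<le> c" "0 \<le> c"
      "solution (\<lambda>t. abs_power t ?a * t + l * g t) u U" by auto
    have "weak_solution D g l u" by (rule solution_imp_weak_solution[OF assms(2) u])
    moreover have "continuous_on UNIV (\<lambda>t. abs_power t ?a * t + l * g t)"
      by (intro continuous_intros abs_power_mult_continuous a assms(2))
    then have "\<not> (AE p in M. u p = 0)"
      \<comment> \<open>At 0 the critical term vanishes, which leaves l g 0 \<noteq> 0.\<close>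
      by (rule solution_nontrivial[OF ne _ u(1,4)]) (use assms(3) l in simp)
    ultimately show "\<exists>u. weak_solution D g l u \<and> \<not> (AE p in M. u p = 0)" by blast
  qed
qed

end
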